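(* Assume (A1)–(A3) and (B1), that $\mathrm{Var}_\pi(g_j(X_0))>0$ for all $j$, and that $\boldsymbol\delta=(\delta_1,\dots,\delta_d)$ satisfies $0<\delta_i\le\Delta(F_{g_i})$ for $i=1,\dots,d$. Then for every $x\in\mathsf{X}$, $\hat\Sigma^{(\boldsymbol\delta)}_{psd}\to\Sigma$ as $M\to\infty$, $P_x$-almost surely.
   Context: Let $(\mathsf{X},\mathscr{X})$ be a complete separable metric space with Borel $\sigma$-algebra, $\pi$ a probability measure, $Q$ a Markov kernel, $X=(X_0,X_1,\dots)$ a Markov chain with kernel $Q$, and $P_x$ the law of the chain started at $X_0=x$. (A1): $X$ is $\psi$-irreducible, aperiodic and positive Harris recurrent. (A2): $Q$ is $\pi$-reversible. (A3): there exist $\rho<1$ and a nonnegative function $M(\cdot)$ with $\|Q^n(x,\cdot)-\pi\|_{TV}\le M(x)\rho^n$ for all $x,n$. $g=(g_1,\dots,g_d)$ satisfies (B1): $\int g_j^2d\pi<\infty$. For real $f_1,f_2\in L^2(\pi)$: $\gamma_{f_1f_2}(k)=\mathrm{Cov}_\pi(f_1(X_0),f_2(X_k))$ for $k\ge0$, $\mathrm{Cov}_\pi(f_1(X_{|k|}),f_2(X_0))$ for $k<0$ (stationary chain); $\gamma_f=\gamma_{ff}$. $\Sigma\in\mathbb{R}^{d\times d}$, $\Sigma_{ij}=\sum_{k\in\mathbb{Z}}\gamma_{g_ig_j}(k)$. $F_f$ is the unique positive measure on $[-1,1]$ with $\gamma_f(k)=\int\alpha^{|k|}F_f(d\alpha)$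 (convention $0^0=1$); $\Delta(F)=1-\max\{|x|:x\in\mathrm{Supp}F\}$. $\mathscr{M}_\infty(b)$: sequences $m(k)=\int x^{|k|}\mu(dx)$ with $\mu$ positive on $[-b,b]$; $\Pi_\delta(r)=\arg\min_{m\in\mathscr{M}_\infty(1-\delta)}\sum_k(r(k)-m(k))^2$; $\sigma^2(m)=\sum_{k\in\mathbb{Z}}m(k)$. For real $f$, $r_{M,f}(k)=\frac1M\sum_{t=0}^{M-1-|k|}(f(X_t)-\bar f_M)(f(X_{t+|k|})-\bar f_M)$ for $|k|<M$, $0$ otherwise. With $s_i=\sqrt{r_{M,g_i}(0)}$ and $\delta_{ij}=\min\{\delta_i,\delta_j\}$, the plug-in estimator $\hat\Sigma^{(\boldsymbol\delta)}_{pw}$ is the symmetric matrix with $\hat\Sigma^{(\boldsymbol\delta)}_{pw,ii}=\sum_k\Pi_{\delta_i}(r_{M,g_i})(k)$ and, for $i<j$, $\hat\Sigma^{(\boldsymbol\delta)}_{pw,ij}=\hat\Sigma^{(\boldsymbol\delta)}_{pw,ji}=\frac{s_is_j}{4}\{\sum_k\Pi_{\delta_{ij}}(r_{M,g_i/s_i+g_j/s_j})(k)-\sum_k\Pi_{\delta_{ij}}(r_{M,g_i/s_i-g_j/s_j})(k)\}$. Let $\hat{\mathbf U}_M=[\hat{\mathbf U}_{M1},\dots,\hat{\mathbf U}_{Md}]$ be an orthogonal matrix of eigenvectors of $\hat\Sigma^{(\boldsymbol\delta)}_{pw}$, $\underline\delta=\min_i\delta_i$, and $\hat{\boldsymbol\Lambda}_{\boldsymbol\delta}$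 the diagonal matrix with $j$th entry $\sigma^2(\Pi_{\underline\delta}(r_{M,\hat{\mathbf U}_{Mj}^\top g}))$ (here $r_{M,\hat{\mathbf U}_{Mj}^\top g}$ is the empirical autocovariance of $Y_t=\hat{\mathbf U}_{Mj}^\top g(X_t)$). Then $\hat\Sigma^{(\boldsymbol\delta)}_{psd}=\hat{\mathbf U}_M\hat{\boldsymbol\Lambda}_{\boldsymbol\delta}\hat{\mathbf U}_M^\top$. *)

theory Defs
  imports "HOL-Probability.Probability"
begin

text \<open>A Markov kernel is a map Q :: 'a => 'a measure with
  Q in borel ->M prob_algebra borel. n-step kernel Q^n.\<close>

primrec kpow :: "('a::topological_space \<Rightarrow> 'a measure) \<Rightarrow> nat \<Rightarrow> 'a \<Rightarrow> 'a measure" where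
  "kpow Q 0 x = return borel x"
| "kpow Q (Suc n) x = bind (kpow Q n x) Q"

text \<open>First-entrance probabilities: hit Q A n x = P_x(tau_A = n+1),
  tau_A = min{n >= 1. X_n in A}; L(x,A) = P_x(tau_A < infinity).\<close>

primrec hit :: "('a::topological_space \<Rightarrow> 'a measure) \<Rightarrow> 'a set \<Rightarrow> nat \<Rightarrow> 'a \<Rightarrow> real" where
  "hit Q A 0 x = measure (Q x) A"
| "hit Q A (Suc n) x = (\<integral>z. indicator (- A) z * hit Q A n z \<partial>Q x)"

definition return_prob :: "('a::topological_space \<Rightarrow> 'a measure) \<Rightarrow> 'a set \<Rightarrow> 'a \<Rightarrow> real" where
  "return_prob Q A x = (\<Sum>n. hit Q A n x)"

definition psi_irreducible :: "('a::topological_space \<Rightarrow> 'a measure) \<Rightarrow> 'a measure \<Rightarrow> bool" where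
  "psi_irreducible Q \<psi> \<longleftrightarrow> sets \<psi> = sets borel \<and> sigma_finite_measure \<psi> \<and> emeasure \<psi> UNIV > 0 \<and>
     (\<forall>A\<in>sets borel. emeasure \<psi> A > 0 \<longrightarrow> (\<forall>x. return_prob Q A x > 0))"

text \<open>Aperiodic: there is no d-cycle with d >= 2 (Meyn--Tweedie, Sec. 5.4).\<close>
definition aperiodic :: "('a::topological_space \<Rightarrow> 'a measure) \<Rightarrow> 'a measure \<Rightarrow> bool" where
  "aperiodic Q \<psi> \<longleftrightarrow> \<not> (\<exists>d::nat. d \<ge> 2 \<and> (\<exists>D::nat \<Rightarrow> 'a set.
      (\<forall>i<d. D i \<in> sets borel) \<and> disjoint_family_on D {..<d} \<and>
      (\<forall>i<d. \<forall>x\<in>D i. measure (Q x) (D (Suc i mod d)) = 1) \<and>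
      emeasure \<psi> (UNIV - (\<Union>i<d. D i)) = 0))"

definition harris_recurrent :: "('a::topological_space \<Rightarrow> 'a measure) \<Rightarrow> 'a measure \<Rightarrow> bool" where
  "harris_recurrent Q \<psi> \<longleftrightarrow>
     (\<forall>A\<in>sets borel. emeasure \<psi> A > 0 \<longrightarrow> (\<forall>x. return_prob Q A x = 1))"

definition invariant_measure :: "('a::topological_space \<Rightarrow> 'a measure) \<Rightarrow> 'a measure \<Rightarrow> bool" where
  "invariant_measure Q \<mu> \<longleftrightarrow> sets \<mu> = sets borel \<and>
     (\<forall>A\<in>sets borel. emeasure \<mu> A = (\<integral>\<^sup>+x. emeasure (Q x) A \<partial>\<mu>))"

definition A1 :: "('a::topological_space \<Rightarrow> 'a measure) \<Rightarrow> bool" where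
  "A1 Q \<longleftrightarrow> (\<exists>\<psi>. psi_irreducible Q \<psi> \<and> aperiodic Q \<psi> \<and> harris_recurrent Q \<psi> \<and>
      (\<exists>\<mu>. prob_space \<mu> \<and> invariant_measure Q \<mu>))"

definition reversible :: "('a::topological_space \<Rightarrow> 'a measure) \<Rightarrow> 'a measure \<Rightarrow> bool" where
  "reversible Q \<pi> \<longleftrightarrow> (\<forall>A\<in>sets borel. \<forall>B\<in>sets borel.
     (\<integral>x. indicator A x * measure (Q x) B \<partial>\<pi>) = (\<integral>x. indicator B x * measure (Q x) A \<partial>\<pi>))"

definition tv_dist :: "'a::topological_space measure \<Rightarrow> 'a measure \<Rightarrow> real" where
  "tv_dist \<mu> \<nu> = (SUP A\<in>sets borel. \<bar>measure \<mu> A - measure \<nu> A\<bar>)"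

definition A3 :: "('a::topological_space \<Rightarrow> 'a measure) \<Rightarrow> 'a measure \<Rightarrow> bool" where
  "A3 Q \<pi> \<longleftrightarrow> (\<exists>\<rho>::real. \<rho> < 1 \<and> (\<exists>Mf::'a \<Rightarrow> real. (\<forall>x. Mf x \<ge> 0) \<and>
      (\<forall>x n. tv_dist (kpow Q n x) \<pi> \<le> Mf x * \<rho> ^ n)))"

primrec cyl :: "('a::topological_space \<Rightarrow> 'a measure) \<Rightarrow> 'a set list \<Rightarrow> 'a \<Rightarrow> real" where
  "cyl Q [] y = 1"
| "cyl Q (B # Bs) y = (\<integral>z. indicator B z * cyl Q Bs z \<partial>Q y)"

definition markov_chain_from :: "'b measure \<Rightarrow> (nat \<Rightarrow> 'b \<Rightarrow> 'a::topological_space) \<Rightarrow>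
    ('a \<Rightarrow> 'a measure) \<Rightarrow> 'a \<Rightarrow> bool" where
  "markov_chain_from M X Q x \<longleftrightarrow> prob_space M \<and> (\<forall>t. X t \<in> M \<rightarrow>\<^sub>M borel) \<and>
     (AE \<omega> in M. X 0 \<omega> = x) \<and>
     (\<forall>Bs. (\<forall>B\<in>set Bs. B \<in> sets borel) \<longrightarrow>
        measure M {\<omega>\<in>space M. \<forall>i<length Bs. X (Suc i) \<omega> \<in> Bs ! i} = cyl Q Bs x)"

definition gamma :: "('a::topological_space \<Rightarrow> 'a measure) \<Rightarrow> 'a measure \<Rightarrow> ('a \<Rightarrow> real) \<Rightarrow> ('a \<Rightarrow> real) \<Rightarrow> int \<Rightarrow> real" where
  "gamma Q \<pi> f1 f2 k = (if k \<ge> 0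
     then (\<integral>y. f1 y * (\<integral>z. f2 z \<partial>kpow Q (nat k) y) \<partial>\<pi>) - (\<integral>y. f1 y \<partial>\<pi>) * (\<integral>y. f2 y \<partial>\<pi>)
     else (\<integral>y. f2 y * (\<integral>z. f1 z \<partial>kpow Q (nat \<bar>k\<bar>) y) \<partial>\<pi>) - (\<integral>y. f1 y \<partial>\<pi>) * (\<integral>y. f2 y \<partial>\<pi>))"

definition spectral_measure :: "('a::topological_space \<Rightarrow> 'a measure) \<Rightarrow> 'a measure \<Rightarrow> ('a \<Rightarrow> real) \<Rightarrow> real measure" where
  "spectral_measure Q \<pi> f = (THE F. sets F = sets borel \<and> finite_measure F \<and>
      emeasure F (- {-1..1}) = 0 \<and> (\<forall>k. gamma Q \<pi> f f k = (\<integral>\<alpha>. \<alpha> ^ nat \<bar>k\<bar> \<partial>F)))"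

definition msupp :: "real measure \<Rightarrow> real set" where
  "msupp F = {x. \<forall>e>0. emeasure F (ball x e) > 0}"

definition Delta :: "real measure \<Rightarrow> real" where
  "Delta F = 1 - (SUP x\<in>msupp F. \<bar>x\<bar>)"

definition Sigma_true :: "('a::topological_space \<Rightarrow> 'a measure) \<Rightarrow> 'a measure \<Rightarrow> ('a \<Rightarrow> real^'d) \<Rightarrow> real^'d^'d" where
  "Sigma_true Q \<pi> g = (\<chi> i j. infsum (gamma Q \<pi> (\<lambda>x. g x $ i) (\<lambda>x. g x $ j)) UNIV)"

definition Minf :: "real \<Rightarrow> (int \<Rightarrow> real) set" where
  "Minf b = {m. \<exists>\<mu>::real measure. sets \<mu> = sets borel \<and> finite_measure \<mu> \<and>
      emeasure \<mu> (- {-b..b}) = 0 \<and> (\<forall>k. m k = (\<integral>x. x ^ nat \<bar>k\<bar> \<partial>\<mu>))}"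

definition seq_sqdist :: "(int \<Rightarrow> real) \<Rightarrow> (int \<Rightarrow> real) \<Rightarrow> real" where
  "seq_sqdist r m = infsum (\<lambda>k. (r k - m k)\<^sup>2) UNIV"

definition Proj :: "real \<Rightarrow> (int \<Rightarrow> real) \<Rightarrow> (int \<Rightarrow> real)" where
  "Proj \<delta> r = (SOME m. m \<in> Minf (1 - \<delta>) \<and> (\<forall>m'\<in>Minf (1 - \<delta>). seq_sqdist r m \<le> seq_sqdist r m'))"

definition sigma2 :: "(int \<Rightarrow> real) \<Rightarrow> real" where
  "sigma2 m = infsum m UNIV"

definition autocov_emp :: "nat \<Rightarrow> (nat \<Rightarrow> real) \<Rightarrow> int \<Rightarrow> real" where
  "autocov_emp M y k = (let ybar = (\<Sum>t<M. y t) / real M in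
     if nat \<bar>k\<bar> < M then (1 / real M) * (\<Sum>t<M - nat \<bar>k\<bar>. (y t - ybar) * (y (t + nat \<bar>k\<bar>) - ybar))
     else 0)"

text \<open>Pairwise plug-in estimator; y t = g(X_t). The off-diagonal formula is symmetric in i,j.\<close>
definition Sigma_pw :: "real^'d \<Rightarrow> nat \<Rightarrow> (nat \<Rightarrow> real^'d) \<Rightarrow> real^'d^'d" where
  "Sigma_pw \<delta> M y = (let s = (\<lambda>i. sqrt (autocov_emp M (\<lambda>t. y t $ i) 0)) in
     (\<chi> i j. if i = j then sigma2 (Proj (\<delta> $ i) (autocov_emp M (\<lambda>t. y t $ i)))
       else s i * s j / 4 *
         (sigma2 (Proj (min (\<delta> $ i) (\<delta> $ j)) (autocov_emp M (\<lambda>t. y t $ i / s i + y t $ j / s j)))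
        - sigma2 (Proj (min (\<delta> $ i) (\<delta> $ j)) (autocov_emp M (\<lambda>t. y t $ i / s i - y t $ j / s j))))))"

definition eigvec_selector :: "(real^'d^'d \<Rightarrow> real^'d^'d) \<Rightarrow> bool" where
  "eigvec_selector U \<longleftrightarrow> (\<forall>S. transpose S = S \<longrightarrow> orthogonal_matrix (U S) \<and>
      (\<forall>j. \<exists>c. S *v column j (U S) = c *s column j (U S)))"

definition Sigma_psd :: "(real^'d^'d \<Rightarrow> real^'d^'d) \<Rightarrow> real^'d \<Rightarrow> nat \<Rightarrow> (nat \<Rightarrow> real^'d) \<Rightarrow> real^'d^'d" where
  "Sigma_psd U \<delta> M y = (let V = U (Sigma_pw \<delta> M y); dmin = Min (range (\<lambda>i. \<delta> $ i));
      lam = (\<lambda>j. sigma2 (Proj dmin (autocov_emp M (\<lambda>t. column j V \<bullet> y t)))) in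
      V ** (\<chi> i j. if i = j then lam j else 0) ** transpose V)"

end

theory Submission
  imports Defs "HOL-Computational_Algebra.Polynomial"
begin

text \<open>
  The empirical autocovariances converge pointwise almost surely, from every starting point: the
  geometric total variation bound makes every bounded harmonic function constant, so shift-invariant
  events have the same probability, 0 or 1, under every initial state, and Birkhoff's theorem for the
  stationary chain transfers to each \<open>P\<^sub>x\<close>.

  Reversibility makes each autocovariance sequence a Hausdorff moment sequence on $[-1,1]$, and the
  condition on \<open>\<delta>\<close> restricts the representing measure of every linear combination of the components to
  $[-1+\delta_{\min}, 1-\delta_{\min}]$. The variational inequality of the projection, tested against the
  true autocovariance, pairs the estimation error only with geometrically decaying sequences. Hence
  pointwise convergence already gives convergence of the projected variances, uniformly
  over bounded directions.

  The eigenvectors of the pilot estimator need not converge. With \<open>V\<close> the matrix of eigenvectors, it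
  suffices that the diagonal of $V^T \Sigma V$ is estimated consistently and that its
  off-diagonal entries tend to 0. The latter holds because the pilot estimator is consistent and
  $V$ diagonalises it.
\<close>

section \<open>The Hausdorff moment problem on $[-1,1]$\<close>

text \<open>Two choice operators shape the development. \<open>spectral_measure\<close> is a
  \<open>THE\<close> and \<open>Proj\<close> a \<open>SOME\<close>, so nothing can be said about
  them before a unique representing measure and a minimiser over \<open>Minf\<close> are known to
  exist. Both come from one source: a moment sequence on [-1,1] is recognised by the linear
  inequalities that positivity of (1+x) p^2 and (1-x) p^2 imposes on its entries. For a reversible
  kernel these are expectations of squares, which produces F_f; and they survive pointwise limits
  and nonnegative combinations, which makes \<open>Minf\<close> a closed convex cone. The support
  radius is read off from the growth of even moments. In that form it passes to linear combinations
  through the parallelogram identity, although the spectral measure of a sum is not determined by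
  those of the summands. Randomness enters the estimators through the scales s_i and through the
  eigenvectors. Both are covered by one statement on arbitrary bounded sequences of directions,
  whose only probabilistic input is the convergence of countably many cross-covariances. After the
  strong law the argument is deterministic along one path.\<close>

definition moment_functional :: "(nat \<Rightarrow> real) \<Rightarrow> real poly \<Rightarrow> real" where
  "moment_functional a p = (\<Sum>i\<le>degree p. coeff p i * a i)"

lemma moment_functional_eq:
  "degree p \<le> n \<Longrightarrow> moment_functional a p = (\<Sum>i\<le>n. coeff p i * a i)"
  unfolding moment_functional_def
  by (rule sum.mono_neutral_left) (auto simp: coeff_eq_0)

lemma moment_functional_add: "moment_functional a (p + q) = moment_functional a p + moment_functional a q"
proof -
  let ?n = "max (degree p) (degree q)"
  have "degree (p + q) \<le> ?n" by (rule degree_add_le) auto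
  then show ?thesis
    by (simp add: moment_functional_eq[of _ ?n] sum.distrib algebra_simps)
qed

lemma moment_functional_smult: "moment_functional a (smult c p) = c * moment_functional a p"
  by (simp add: moment_functional_eq[of _ "degree p"] degree_smult_le sum_distrib_left mult.assoc)

lemma moment_functional_0 [simp]: "moment_functional a 0 = 0"
  by (simp add: moment_functional_def)

lemma moment_functional_sum: "moment_functional a (\<Sum>i\<in>I. f i) = (\<Sum>i\<in>I. moment_functional a (f i))"
  by (induction I rule: infinite_finite_induct) (auto simp: moment_functional_add)

lemma moment_functional_monom: "moment_functional a (monom c k) = c * a k"
  by (cases "c = 0") (auto simp: moment_functional_def degree_monom_eq if_distrib[of "\<lambda>x. x * _"]
      cong: if_cong)

lemma moment_functional_const [simp]: "moment_functional a [:c:] = c * a 0"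
  by (simp add: moment_functional_def)

lemma moment_functional_1 [simp]: "moment_functional a 1 = a 0"
  by (simp add: one_pCons)

text \<open>If \<open>a\<close> has a representing measure on [-1,1], then
  \<open>moment_functional a\<close> integrates polynomials against it, and 1 + x and 1 - x are
  nonnegative there. Each inequality is linear in finitely many entries of \<open>a\<close>, hence
  stable under limits and sums.\<close>

definition moment_positive :: "(nat \<Rightarrow> real) \<Rightarrow> bool" where
  "moment_positive a \<longleftrightarrow> (\<forall>p. moment_functional a ([:1, 1:] * p\<^sup>2) \<ge> 0 \<and> moment_functional a ([:1, -1:] * p\<^sup>2) \<ge> 0)"

text \<open>The weights 1 + x and 1 - x add up to 2.\<close>

lemma moment_positive_sq:
  assumes "moment_positive a"
  shows "moment_functional a (p\<^sup>2) \<ge> 0"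
proof -
  have "smult 2 (p\<^sup>2) = [:1, 1:] * p\<^sup>2 + [:1, -1:] * p\<^sup>2"
    by (simp flip: distrib_right add: numeral_poly)
  then have "2 * moment_functional a (p\<^sup>2) = moment_functional a ([:1, 1:] * p\<^sup>2) + moment_functional a ([:1, -1:] * p\<^sup>2)"
    by (metis moment_functional_add moment_functional_smult)
  moreover have "moment_functional a ([:1, 1:] * p\<^sup>2) \<ge> 0" "moment_functional a ([:1, -1:] * p\<^sup>2) \<ge> 0"
    using assms unfolding moment_positive_def by blast+
  ultimately show ?thesis by linarith
qed

text \<open>With P = 1 + x, N = 1 - x and P + N = 2 one has 2 P N p^2 = P (N p)^2 + N (P
  p)^2.\<close>

lemma moment_positive_one_minus_sq:
  assumes "moment_positive a"
  shows "moment_functional a ([:1, 1:] * [:1, -1:] * p\<^sup>2) \<ge> 0"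
proof -
  have "smult 2 ([:1, 1:] * [:1, -1:] * p\<^sup>2) = [:1, 1:] * ([:1, -1:] * p)\<^sup>2 + [:1, -1:] * ([:1, 1:] * p)\<^sup>2"
  proof -
    define P N where PN: "P = [:1, 1::real:]" "N = [:1, -1::real:]"
    have "smult 2 (P * N * p\<^sup>2) = (P + N) * (P * N * p\<^sup>2)" by (simp add: PN)
    also have "\<dots> = P * (N * p)\<^sup>2 + N * (P * p)\<^sup>2" by (simp add: power2_eq_square algebra_simps)
    finally show ?thesis unfolding PN .
  qed
  then have "2 * moment_functional a ([:1, 1:] * [:1, -1:] * p\<^sup>2)
      = moment_functional a ([:1, 1:] * ([:1, -1:] * p)\<^sup>2) + moment_functional a ([:1, -1:] * ([:1, 1:] * p)\<^sup>2)"
    by (metis moment_functional_add moment_functional_smult)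
  moreover have "moment_functional a ([:1, 1:] * ([:1, -1:] * p)\<^sup>2) \<ge> 0" "moment_functional a ([:1, -1:] * ([:1, 1:] * p)\<^sup>2) \<ge> 0"
    using assms unfolding moment_positive_def by blast+
  ultimately show ?thesis by linarith
qed

text \<open>In the variable t = (1 + x)/2 these are the Bernstein products t^j (1 - t)^l. Splitting
  off the even part of both exponents leaves a square times one of 1, A, B, A B, and each of these
  four cases is covered.\<close>

lemma bernstein_nonneg:
  assumes "moment_positive a"
  shows "moment_functional a ([:1/2, 1/2:] ^ j * [:1/2, -1/2:] ^ l) \<ge> 0"
proof -
  define A where "A = [:1/2, 1/2::real:]"
  define B where "B = [:1/2, -1/2::real:]"
  have A: "A = smult (1/2) [:1, 1:]" and B: "B = smult (1/2) [:1, -1:]"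
    by (auto simp: A_def B_def)
  define q where "q = A ^ (j div 2) * B ^ (l div 2)"
  have pj: "A ^ j = A ^ (j mod 2) * (A ^ (j div 2))\<^sup>2"
    by (metis mult_div_mod_eq power_add power_mult mult.commute power_even_eq)
  have pl: "B ^ l = B ^ (l mod 2) * (B ^ (l div 2))\<^sup>2"
    by (metis mult_div_mod_eq power_add power_mult mult.commute power_even_eq)
  have eq: "A ^ j * B ^ l = A ^ (j mod 2) * B ^ (l mod 2) * q\<^sup>2"
    unfolding q_def pj pl power_mult_distrib by (simp only: ac_simps)
  have "moment_functional a (A ^ (j mod 2) * B ^ (l mod 2) * q\<^sup>2) \<ge> 0"
  proof -
    have 1: "moment_functional a (A * q\<^sup>2) \<ge> 0"
      using assms unfolding A moment_positive_def by (simp only: mult_smult_left moment_functional_smult) simp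
    have 2: "moment_functional a (B * q\<^sup>2) \<ge> 0"
      using assms unfolding B moment_positive_def by (simp only: mult_smult_left moment_functional_smult) simp
    have 3: "moment_functional a (A * B * q\<^sup>2) \<ge> 0"
      using moment_positive_one_minus_sq[OF assms, of q] unfolding A B
      by (simp only: mult_smult_left mult_smult_right moment_functional_smult)
    have "j mod 2 = 0 \<or> j mod 2 = 1" "l mod 2 = 0 \<or> l mod 2 = 1" by auto
    then show ?thesis using 1 2 3 moment_positive_sq[OF assms, of q] by (elim disjE) (simp_all)
  qed
  then show ?thesis using eq unfolding A_def B_def by simp
qed

lemma smult_sum_right: "smult c (sum f I) = (\<Sum>i\<in>I. smult c (f i))"
  by (induction I rule: infinite_finite_induct) (auto simp: smult_add_right)

text \<open>The l-th factorial moment of the binomial distribution, as a polynomial identity. The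
  falling factor turns C(n,j) into l! C(n,l) C(n-l,j-l), and the binomial theorem for (A + B)^(n-l)
  does the rest.\<close>

lemma binomial_falling_sum:
  fixes A B :: "real poly"
  assumes AB: "A + B = 1"
  shows "(\<Sum>j\<le>n. smult (real (n choose j) * (\<Prod>i<l. real j - real i)) (A ^ j * B ^ (n - j)))
    = smult (\<Prod>i<l. real n - real i) (A ^ l)"
proof -
  have P: "(\<Prod>i<l. real j - real i) = fact l * real (j choose l)" for j
    by (simp add: binomial_gbinomial gbinomial_prod_rev atLeast0LessThan)
  show ?thesis
  proof (cases "l \<le> n")
    case True
    have "(\<Sum>j\<le>n. smult (real (n choose j) * (\<Prod>i<l. real j - real i)) (A ^ j * B ^ (n - j)))
       = (\<Sum>j\<in>{l..n}. smult (real (n choose j) * (\<Prod>i<l. real j - real i)) (A ^ j * B ^ (n - j)))"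
      by (rule sum.mono_neutral_right) (auto simp: P)
    also have "\<dots> = (\<Sum>j\<in>{0..n-l}. smult (real (n choose (j+l)) * (\<Prod>i<l. real (j+l) - real i)) (A ^ (j+l) * B ^ (n - (j+l))))"
      using True sum.shift_bounds_cl_nat_ivl[of "\<lambda>j. smult (real (n choose j) * (\<Prod>i<l. real j - real i)) (A ^ j * B ^ (n - j))" 0 l "n-l"]
      by simp
    also have "\<dots> = (\<Sum>j\<le>n-l. smult (fact l * real (n choose l)) (A ^ l * (of_nat ((n-l) choose j) * A ^ j * B ^ (n - l - j))))"
    proof (rule sum.cong)
      fix j assume j: "j \<in> {..n-l}"
      have "(n choose (j+l)) * ((j+l) choose l) = (n choose l) * ((n-l) choose j)"
        using choose_mult[of l "j+l" n] j True by simp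
      then have "real (n choose (j+l)) * real ((j+l) choose l) = real (n choose l) * real ((n-l) choose j)"
        by (metis of_nat_mult)
      then have "real (n choose (j+l)) * (\<Prod>i<l. real (j+l) - real i) = fact l * real (n choose l) * real ((n-l) choose j)"
        unfolding P by (simp add: algebra_simps)
      then show "smult (real (n choose (j+l)) * (\<Prod>i<l. real (j+l) - real i)) (A ^ (j+l) * B ^ (n - (j+l)))
        = smult (fact l * real (n choose l)) (A ^ l * (of_nat ((n-l) choose j) * A ^ j * B ^ (n - l - j)))"
        by (simp add: power_add of_nat_poly algebra_simps)
    qed auto
    also have "\<dots> = smult (fact l * real (n choose l)) (A ^ l * (A + B) ^ (n - l))"
      unfolding binomial_ring by (simp only: sum_distrib_left smult_sum_right)
    finally show ?thesis by (simp add: AB P)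
  next
    case False
    then show ?thesis by (simp add: P binomial_eq_0 cong: sum.cong_simp)
  qed
qed

text \<open>These weights are the masses of a discrete measure; the total mass is the factorial
  moment identity with l = 0.\<close>

lemma bernstein_weights:
  assumes "moment_positive a"
  defines "w \<equiv> \<lambda>n j. real (n choose j) * moment_functional a ([:1/2, 1/2:] ^ j * [:1/2, -1/2:] ^ (n - j))"
  shows "0 \<le> w n j" "(\<Sum>j\<le>n. w n j) = a 0"
proof -
  show "0 \<le> w n j" using bernstein_nonneg[OF assms(1)] by (simp add: w_def)
  have "[:1/2, 1/2:] + [:1/2, -1/2:] = (1 :: real poly)" by (simp add: one_pCons)
  note * = binomial_falling_sum[OF this, of n 0]
  have "(\<Sum>j\<le>n. w n j) = moment_functional a (\<Sum>j\<le>n. smult (real (n choose j) * (\<Prod>i<0. real j - real i)) ([:1/2, 1/2:] ^ j * [:1/2, -1/2:] ^ (n - j)))"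
    by (simp add: w_def moment_functional_sum moment_functional_smult)
  then show "(\<Sum>j\<le>n. w n j) = a 0" unfolding * by simp
qed

text \<open>Put mass \<open>w n j\<close> at the point j/n. The factorial moments of this measure
  are known exactly, and the powers of j/n differ from them by terms of order 1/n.\<close>

lemma hausdorff_scaled_moments:
  assumes pos: "moment_positive a"
  defines "A \<equiv> [:1/2, 1/2::real:]" and "B \<equiv> [:1/2, -1/2::real:]"
  defines "w \<equiv> \<lambda>n j. real (n choose j) * moment_functional a (A ^ j * B ^ (n - j))"
  shows "(\<lambda>n. \<Sum>j\<le>n. w n j * (real j / real n) ^ k) \<longlonglongrightarrow> moment_functional a (A ^ k)"
proof -
  have AB: "A + B = 1" by (simp add: A_def B_def one_pCons)
  \<comment> \<open>Mixed moments with l falling factors and k plain powers. The induction trades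
    plain powers for falling factors one at a time.\<close>
  define S where "S = (\<lambda>k l n. \<Sum>j\<le>n. w n j * ((\<Prod>i<l. real j - real i) / real n ^ l) * (real j / real n) ^ k)"
  have "S k l \<longlonglongrightarrow> moment_functional a (A ^ (k + l))" for l
  proof (induction k arbitrary: l)
    case 0
    have "S 0 l n = (\<Prod>i<l. (real n - real i) / real n) * moment_functional a (A ^ l)" for n
    proof -
      have "S 0 l n = (\<Sum>j\<le>n. (real (n choose j) * (\<Prod>i<l. real j - real i)) * moment_functional a (A ^ j * B ^ (n - j))) / real n ^ l"
        unfolding S_def w_def by (simp add: sum_divide_distrib algebra_simps)
      also have "\<dots> = moment_functional a (\<Sum>j\<le>n. smult (real (n choose j) * (\<Prod>i<l. real j - real i)) (A ^ j * B ^ (n - j))) / real n ^ l"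
        by (simp only: moment_functional_sum moment_functional_smult)
      also have "\<dots> = (\<Prod>i<l. real n - real i) / real n ^ l * moment_functional a (A ^ l)"
        unfolding binomial_falling_sum[OF AB] by (simp add: moment_functional_smult)
      also have "(\<Prod>i<l. real n - real i) / real n ^ l = (\<Prod>i<l. (real n - real i) / real n)"
        by (simp add: prod_dividef)
      finally show ?thesis .
    qed
    moreover have "(\<lambda>n. (\<Prod>i<l. (real n - real i) / real n) * moment_functional a (A ^ l)) \<longlonglongrightarrow> (\<Prod>i<l. 1) * moment_functional a (A ^ l)"
    proof (intro tendsto_intros)
      fix i
      have "(\<lambda>n. 1 - real i / real n) \<longlonglongrightarrow> 1 - 0"
        by (intro tendsto_intros lim_const_over_n)
      moreover have "\<forall>\<^sub>F n in sequentially. 1 - real i / real n = (real n - real i) / real n"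
        using eventually_gt_at_top[of 0] by eventually_elim (simp add: field_simps)
      ultimately show "(\<lambda>n. (real n - real i) / real n) \<longlonglongrightarrow> 1"
        by (simp add: filterlim_cong)
    qed
    ultimately show ?case by simp
  next
    case (Suc k)
    \<comment> \<open>This is j/n = (j - l)/n + l/n, where the first summand lengthens the falling
      product by one factor.\<close>
    have rec: "\<forall>\<^sub>F n in sequentially. S k (Suc l) n + real l / real n * S k l n = S (Suc k) l n"
      using eventually_gt_at_top[of 0]
    proof eventually_elim
      case (elim n)
      have "w n j * ((\<Prod>i<Suc l. real j - real i) / real n ^ Suc l) * (real j / real n) ^ k
         + real l / real n * (w n j * ((\<Prod>i<l. real j - real i) / real n ^ l) * (real j / real n) ^ k)
         = w n j * ((\<Prod>i<l. real j - real i) / real n ^ l) * (real j / real n) ^ Suc k" for j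
        using elim by (simp add: field_simps power_divide)
      then show ?case unfolding S_def sum_distrib_left sum.distrib[symmetric] by simp
    qed
    have "(\<lambda>n. S k (Suc l) n + real l / real n * S k l n) \<longlonglongrightarrow> moment_functional a (A ^ (k + Suc l)) + 0 * moment_functional a (A ^ (k + l))"
      by (intro tendsto_intros Suc lim_const_over_n)
    then show ?case using rec by (simp add: filterlim_cong)
  qed
  from this[of 0] show ?thesis by (simp add: S_def)
qed

text \<open>Helly selection for the normalised Bernstein measures: they live on [0,1], hence are
  tight, and a weak limit along a subsequence has the limiting moments.\<close>

lemma hausdorff_moment_unit:
  assumes pos: "moment_positive a" and a0: "a 0 > 0"
  obtains F where "real_distribution F" "AE t in F. t \<in> {0..1}"
    "\<And>k. moment_functional a ([:1/2, 1/2:] ^ k) = a 0 * (\<integral>t. t ^ k \<partial>F)"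
proof -
  define A where "A = [:1/2, 1/2::real:]"
  define B where "B = [:1/2, -1/2::real:]"
  define w where "w = (\<lambda>n j. real (n choose j) * moment_functional a (A ^ j * B ^ (n - j)))"
  have w_nonneg: "w n j \<ge> 0" and w_sum: "(\<Sum>j\<le>n. w n j) = a 0" for n j
    using bernstein_weights[OF pos] by (simp_all add: w_def A_def B_def)
  define p where "p = (\<lambda>n. embed_pmf (\<lambda>j. if j \<le> n then w n j / a 0 else 0))"
  have pmf_p: "pmf (p n) j = (if j \<le> n then w n j / a 0 else 0)" for n j
    unfolding p_def
  proof (rule pmf_embed_pmf)
    have "(\<integral>\<^sup>+ j. ennreal (if j \<le> n then w n j / a 0 else 0) \<partial>count_space UNIV)
      = (\<integral>\<^sup>+ j. ennreal (w n j / a 0) * indicator {..n} j \<partial>count_space UNIV)"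
      by (intro nn_integral_cong) (auto split: split_indicator)
    also have "\<dots> = (\<Sum>j\<le>n. ennreal (w n j / a 0))"
      by (subst nn_integral_count_space_indicator[symmetric]) (auto simp: nn_integral_count_space_finite)
    also have "\<dots> = ennreal (\<Sum>j\<le>n. w n j / a 0)"
      using a0 w_nonneg by (subst sum_ennreal) auto
    also have "(\<Sum>j\<le>n. w n j / a 0) = 1" using w_sum[of n] a0 by (simp flip: sum_divide_distrib)
    finally show "(\<integral>\<^sup>+ j. ennreal (if j \<le> n then w n j / a 0 else 0) \<partial>count_space UNIV) = 1" by simp
  qed (use a0 w_nonneg in auto)
  define \<mu> where "\<mu> = (\<lambda>n. distr (measure_pmf (p n)) borel (\<lambda>j. real j / real n))"
  have rd: "real_distribution (\<mu> n)" for n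
    unfolding \<mu>_def by (intro prob_space.real_distribution_distr measure_pmf.prob_space_axioms) auto
  have set_p: "set_pmf (p n) \<subseteq> {..n}" for n
    by (auto simp: set_pmf_iff pmf_p split: if_splits)
  have in01: "AE t in \<mu> n. t \<in> {0..1}" for n
    unfolding \<mu>_def using set_p[of n]
    by (subst AE_distr_iff) (auto simp: AE_measure_pmf_iff divide_le_eq)
  have int_\<mu>: "(\<integral>t. t ^ k \<partial>\<mu> n) = (\<Sum>j\<le>n. w n j * (real j / real n) ^ k) / a 0" for n k
  proof -
    have "(\<integral>t. t ^ k \<partial>\<mu> n) = (\<integral>j. (real j / real n) ^ k \<partial>measure_pmf (p n))"
      unfolding \<mu>_def by (subst integral_distr) auto
    also have "\<dots> = (\<Sum>j\<le>n. (real j / real n) ^ k * pmf (p n) j)"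
      using set_p[of n] by (intro integral_measure_pmf_real) auto
    finally show ?thesis by (simp add: pmf_p sum_divide_distrib mult.commute)
  qed
  have tight: "tight \<mu>"
    unfolding tight_def
  proof safe
    fix \<epsilon> :: real assume e: "0 < \<epsilon>"
    \<comment> \<open>Tightness is phrased with intervals open on the left, so the left end -1 keeps
      the point 0 inside.\<close>
    have "measure (\<mu> n) {-1<..1} = 1" for n
    proof -
      interpret real_distribution "\<mu> n" by (rule rd)
      show ?thesis
        by (rule prob_eq_1[THEN iffD2]) (use in01[of n] in auto)
    qed
    then show "\<exists>a b. a < b \<and> (\<forall>n. 1 - \<epsilon> < measure (\<mu> n) {a<..b})"
      using e by (intro exI[of _ "-1"] exI[of _ 1]) auto
  qed (rule rd)
  obtain s F0 where s: "strict_mono s" and F0: "real_distribution F0" and conv: "weak_conv_m (\<mu> \<circ> s) F0"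
    using tight_imp_convergent_subsubsequence[OF tight strict_mono_id] by auto
  interpret F0: real_distribution F0 by fact
  \<comment> \<open>Weak convergence tests bounded continuous functions on the whole line. Clipping
    turns t^k into one without changing it on [0,1], and the image of the limit under
    \<open>clip\<close> sits on [0,1] by construction.\<close>
  define clip where "clip = (\<lambda>t::real. max 0 (min 1 t))"
  have clip_cont: "isCont clip t" for t unfolding clip_def by (intro continuous_intros)
  have clip_meas[measurable]: "clip \<in> borel_measurable borel" unfolding clip_def by measurable
  have clip01: "clip t \<in> {0..1}" for t by (auto simp: clip_def)
  have "moment_functional a (A ^ k) = a 0 * (\<integral>t. clip t ^ k \<partial>F0)" for k
  proof -
    have "(\<lambda>n. (\<integral>t. clip t ^ k \<partial>(\<mu> \<circ> s) n)) \<longlonglongrightarrow> (\<integral>t. clip t ^ k \<partial>F0)"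
    proof (rule weak_conv_imp_integral_bdd_continuous_conv[OF _ F0 conv])
      show "norm (clip t ^ k) \<le> 1" for t
        using clip01[of t] by (auto simp: power_le_one)
    qed (use rd in \<open>auto intro!: continuous_intros clip_cont\<close>)
    moreover have "(\<integral>t. clip t ^ k \<partial>(\<mu> \<circ> s) n) = (\<Sum>j\<le>s n. w (s n) j * (real j / real (s n)) ^ k) / a 0" for n
    proof -
      have "(\<integral>t. clip t ^ k \<partial>(\<mu> \<circ> s) n) = (\<integral>t. t ^ k \<partial>(\<mu> \<circ> s) n)"
      proof (rule integral_cong_AE)
        show "AE t in (\<mu> \<circ> s) n. clip t ^ k = t ^ k"
          using in01[of "s n"] unfolding comp_def by eventually_elim (simp add: clip_def)
      qed (simp_all add: \<mu>_def)
      then show ?thesis using int_\<mu>[where n="s n"] by simp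
    qed
    ultimately have "(\<lambda>n. (\<Sum>j\<le>s n. w (s n) j * (real j / real (s n)) ^ k) / a 0) \<longlonglongrightarrow> (\<integral>t. clip t ^ k \<partial>F0)"
      by simp
    moreover have "(\<lambda>n. (\<Sum>j\<le>s n. w (s n) j * (real j / real (s n)) ^ k) / a 0) \<longlonglongrightarrow> moment_functional a (A ^ k) / a 0"
      using LIMSEQ_subseq_LIMSEQ[OF hausdorff_scaled_moments[OF pos, of k] s] a0
      unfolding comp_def w_def A_def B_def by (intro tendsto_divide tendsto_const) auto
    ultimately show ?thesis using a0 LIMSEQ_unique by (fastforce simp: field_simps)
  qed
  then show ?thesis
    by (intro that[of "distr F0 borel clip"] F0.real_distribution_distr)
       (auto simp: A_def integral_distr AE_distr_iff clip01 simp del: atLeastAtMost_iff)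
qed

text \<open>The substitution x = 2 t - 1 carries [0,1] to [-1,1], and expanding (2 t - 1)^k
  expresses \<open>a k\<close> through the values at powers of t. If \<open>a 0 = 0\<close> no
  normalisation is possible, but then all Bernstein weights vanish and the zero measure represents
  \<open>a\<close>.\<close>

theorem hausdorff_moment:
  assumes pos: "moment_positive a"
  obtains F where "sets F = sets borel" "finite_measure F" "emeasure F (- {-1..1}) = 0"
    "\<And>k. a k = (\<integral>x. x ^ k \<partial>F)"
proof -
  define A where "A = [:1/2, 1/2::real:]"
  have expand: "a k = (\<Sum>i\<le>k. real (k choose i) * (2 ^ i * (-1) ^ (k - i)) * moment_functional a (A ^ i))" for k
  proof -
    have "a k = moment_functional a (monom 1 k)" by (simp add: moment_functional_monom)
    also have "monom 1 k = (smult 2 A + (-1)) ^ k"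
      by (simp add: A_def monom_altdef one_pCons flip: minus_pCons)
    also have "\<dots> = (\<Sum>i\<le>k. smult (real (k choose i) * (2 ^ i * (-1) ^ (k - i))) (A ^ i))"
      unfolding binomial_ring
    proof (rule sum.cong)
      fix i
      have 1: "(-1 :: real poly) ^ n = smult ((-1)^n) 1" for n
        by (induction n) auto
      show "of_nat (k choose i) * smult 2 A ^ i * (- 1) ^ (k - i) = smult (real (k choose i) * (2 ^ i * (- 1) ^ (k - i))) (A ^ i)"
        unfolding 1 smult_power[symmetric] of_nat_poly by (simp add: ac_simps smult_power)
    qed simp
    finally show ?thesis by (simp only: moment_functional_sum moment_functional_smult)
  qed
  have "a 0 \<ge> 0" using moment_positive_sq[OF pos, of 1] by (simp add: moment_functional_1)
  then consider "a 0 = 0" | "a 0 > 0" by linarith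
  then show ?thesis
  proof cases
    case 1
    have "moment_functional a (A ^ k) = 0" for k
    proof -
      define w where "w = (\<lambda>n j. real (n choose j) * moment_functional a (A ^ j * [:1/2, -1/2:] ^ (n - j)))"
      have w_nonneg: "w n j \<ge> 0" and "(\<Sum>j\<le>n. w n j) = 0" for n j
        using bernstein_weights[OF pos] by (simp_all add: w_def A_def 1)
      then have "w n j = 0" if "j \<le> n" for n j
        using that sum_nonneg_eq_0_iff[of "{..n}" "w n"] w_nonneg by auto
      \<comment> \<open>For j = n the second factor has exponent 0, so \<open>w k k\<close> is the
        value in question.\<close>
      from this[of k k] show ?thesis by (simp add: w_def)
    qed
    then have "a k = 0" for k using expand[of k] by simp
    then show ?thesis
      by (intro that[of "density lborel (\<lambda>_. 0)"])
        (auto simp: emeasure_density integral_density[where g="\<lambda>_. 0 :: real", simplified] intro!: finite_measureI)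
  next
    case 2
    obtain F where F: "real_distribution F" "AE t in F. t \<in> {0..1}"
      "\<And>k. moment_functional a ([:1/2, 1/2:] ^ k) = a 0 * (\<integral>t. t ^ k \<partial>F)"
      using hausdorff_moment_unit[OF pos 2] by blast
    interpret F: real_distribution F by fact
    define G where "G = density (distr F borel (\<lambda>t. 2 * t - 1)) (\<lambda>_. ennreal (a 0))"
    have intb: "integrable F (\<lambda>t. t ^ k)" for k
      using F(2) by (intro F.integrable_const_bound[of _ 1]) (auto simp: power_le_one)
    show ?thesis
    proof (rule that[of G])
      show "sets G = sets borel" by (simp add: G_def)
      show "finite_measure G"
        by (rule finite_measureI) (simp add: G_def emeasure_density nn_integral_cmult_indicator emeasure_distr F.emeasure_eq_measure ennreal_mult_eq_top_iff)
      have "AE t in distr F borel (\<lambda>t. 2 * t - 1). t \<in> {-1..1::real}"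
        using F(2) by (subst AE_distr_iff) auto
      then have "emeasure (distr F borel (\<lambda>t. 2 * t - 1)) (- {-1..1::real}) = 0"
        by (subst (asm) AE_iff_measurable[OF _ refl]) (auto simp: Compl_eq)
      then show "emeasure G (- {-1..1}) = 0" by (simp add: G_def emeasure_density nn_integral_cmult_indicator)
      fix k
      have "(\<integral>x. x ^ k \<partial>G) = a 0 * (\<integral>x. x ^ k \<partial>(distr F borel (\<lambda>t. 2 * t - 1)))"
        unfolding G_def using 2 by (subst integral_density) auto
      also have "\<dots> = a 0 * (\<integral>t. (2 * t - 1) ^ k \<partial>F)"
        by (subst integral_distr) auto
      also have "(\<integral>t. (2 * t - 1) ^ k \<partial>F) = (\<integral>t. (\<Sum>i\<le>k. real (k choose i) * (2 ^ i * (-1) ^ (k - i)) * t ^ i) \<partial>F)"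
        using binomial_ring[of "2 * _" "-1::real" k] by (simp add: power_mult_distrib algebra_simps)
      also have "\<dots> = (\<Sum>i\<le>k. real (k choose i) * (2 ^ i * (-1) ^ (k - i)) * (\<integral>t. t ^ i \<partial>F))"
        using intb by (subst Bochner_Integration.integral_sum) auto
      finally show "a k = (\<integral>x. x ^ k \<partial>G)"
        unfolding expand[of k] A_def F(3) by (simp add: sum_distrib_left algebra_simps)
    qed
  qed
qed

section \<open>Uniqueness and support of representing measures\<close>

text \<open>Moments of a probability measure on [-1,1] are bounded by 1, so the Taylor polynomials
  of the characteristic function, which contain only moments, converge to it everywhere.
  Characteristic functions determine the law.\<close>

lemma moments_determine_prob:
  assumes rd: "real_distribution F" "real_distribution G"
    and supp: "AE x in F. \<bar>x\<bar> \<le> 1" "AE x in G. \<bar>x\<bar> \<le> 1"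
    and eq: "\<And>k. (\<integral>x. x ^ k \<partial>F) = (\<integral>x. x ^ k \<partial>G)"
  shows "F = G"
proof (rule Levy_uniqueness[OF rd])
  have approx: "(\<lambda>n. \<Sum>k\<le>n. ((\<i> * t)^k / fact k) * (\<integral>x. x ^ k \<partial>H)) \<longlonglongrightarrow> char H t"
    if H: "real_distribution H" and s: "AE x in H. \<bar>x\<bar> \<le> 1" for H and t :: real
  proof -
    interpret H: real_distribution H by fact
    have int: "integrable H (\<lambda>x. x ^ k)" for k
      using s by (intro H.integrable_const_bound[of _ 1]) (auto simp: power_abs power_le_one)
    have lim0: "(\<lambda>n. 2 * (\<bar>t\<bar>^n / fact n)) \<longlonglongrightarrow> 2 * 0"
      using summable_LIMSEQ_zero[OF summable_exp[of "\<bar>t\<bar>"]]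
      by (intro tendsto_intros) (simp add: divide_inverse mult.commute)
    have le: "norm (char H t - (\<Sum>k\<le>n. ((\<i> * t)^k / fact k) * (\<integral>x. x ^ k \<partial>H))) \<le> 2 * (\<bar>t\<bar>^n / fact n)" for n
    proof -
      have "(\<integral>x. \<bar>x\<bar> ^ n \<partial>H) \<le> (\<integral>x. 1 \<partial>H)"
      proof (rule integral_mono_AE)
        show "integrable H (\<lambda>x. \<bar>x\<bar> ^ n)"
          using integrable_abs[OF int[of n]] by (simp add: power_abs)
        show "AE x in H. \<bar>x\<bar> ^ n \<le> 1"
          using s by eventually_elim (simp add: power_le_one)
      qed simp
      then have "(\<integral>x. \<bar>x\<bar> ^ n \<partial>H) \<le> 1" using H.prob_space by simp
      then have "(2*\<bar>t\<bar>^n / fact n) * (\<integral>x. \<bar>x\<bar>^n \<partial>H) \<le> (2*\<bar>t\<bar>^n / fact n) * 1"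
        by (intro mult_left_mono) auto
      with H.char_approx1[of n t] int show ?thesis by simp
    qed
    have "(\<lambda>n. char H t - (\<Sum>k\<le>n. ((\<i> * t)^k / fact k) * (\<integral>x. x ^ k \<partial>H))) \<longlonglongrightarrow> 0"
      by (rule Lim_null_comparison[OF always_eventually[OF allI[OF le]]]) (use lim0 in simp)
    from tendsto_diff[OF tendsto_const[of "char H t"] this] show ?thesis by simp
  qed
  show "char F = char G"
    using approx[OF rd(1) supp(1)] approx[OF rd(2) supp(2)] unfolding eq
    by (intro ext) (blast intro: LIMSEQ_unique)
qed

lemma AE_abs_le_iff:
  fixes F :: "real measure"
  assumes "sets F = sets borel"
  shows "emeasure F (- {-b..b}) = 0 \<longleftrightarrow> (AE x in F. \<bar>x\<bar> \<le> b)"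
proof -
  have sp: "space F = UNIV" using sets_eq_imp_space_eq[OF assms] by simp
  have "{x \<in> space F. \<not> \<bar>x\<bar> \<le> b} = - {-b..b}" by (auto simp: sp)
  then show ?thesis
    using assms by (subst AE_iff_measurable[of "- {-b..b}"]) auto
qed

text \<open>Reduction to probability measures: the zeroth moments give both measures the same mass,
  by which they are divided unless it is 0.\<close>

lemma moments_determine_measure:
  fixes F G :: "real measure"
  assumes sets: "sets F = sets borel" "sets G = sets borel"
    and fin: "finite_measure F" "finite_measure G"
    and supp: "emeasure F (- {-1..1}) = 0" "emeasure G (- {-1..1}) = 0"
    and eq: "\<And>k. (\<integral>x. x ^ k \<partial>F) = (\<integral>x. x ^ k \<partial>G)"
  shows "F = G"
proof -
  interpret F: finite_measure F by fact
  interpret G: finite_measure G by fact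
  have sp: "space F = UNIV" "space G = UNIV" using sets[THEN sets_eq_imp_space_eq] by simp_all
  have mass: "measure F UNIV = measure G UNIV" using eq[of 0] by (simp add: sp)
  show ?thesis
  proof (cases "measure F UNIV = 0")
    case True
    then have "emeasure F A = 0" "emeasure G A = 0" for A
      using F.finite_measure_mono[of A UNIV] G.finite_measure_mono[of A UNIV] mass sets
      by (auto simp: F.emeasure_eq_measure G.emeasure_eq_measure measure_le_0_iff)
    then show ?thesis by (intro measure_eqI) (auto simp: sets)
  next
    case False
    define c where "c = measure F UNIV"
    have c: "c > 0" using False by (simp add: c_def zero_less_measure_iff)
    define nrm where "nrm H = density H (\<lambda>_. ennreal (1 / c))" for H :: "real measure"
    have nrm: "real_distribution (nrm H) \<and> (AE x in nrm H. \<bar>x\<bar> \<le> 1) \<and> density (nrm H) (\<lambda>_. ennreal c) = H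
        \<and> (\<forall>k. (\<integral>x. x ^ k \<partial>nrm H) = (\<integral>x. x ^ k \<partial>H) / c)"
      if H: "sets H = sets borel" "finite_measure H" "emeasure H (- {-1..1}) = 0" "measure H UNIV = c" for H
    proof (intro conjI allI)
      interpret H: finite_measure H by fact
      have sp: "space H = UNIV" using H(1)[THEN sets_eq_imp_space_eq] by simp
      show "real_distribution (nrm H)"
      proof (rule real_distribution.intro)
        show "prob_space (nrm H)"
          by (rule prob_spaceI) (use c H(1,4) sp in \<open>simp add: nrm_def emeasure_density nn_integral_cmult_indicator H.emeasure_eq_measure flip: ennreal_mult\<close>)
        show "real_distribution_axioms (nrm H)"
          by standard (simp_all add: nrm_def H sp)
      qed
      show "AE x in nrm H. \<bar>x\<bar> \<le> 1"
        using H(3) unfolding AE_abs_le_iff[OF H(1)] nrm_def by (subst AE_density) auto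
      have "density (nrm H) (\<lambda>_. ennreal c) = density H (\<lambda>x. ennreal (1 / c) * ennreal c)"
        unfolding nrm_def by (subst density_density_eq) auto
      also have "\<dots> = H" using c by (simp add: density_1 flip: ennreal_mult)
      finally show "density (nrm H) (\<lambda>_. ennreal c) = H" .
      show "(\<integral>x. x ^ k \<partial>nrm H) = (\<integral>x. x ^ k \<partial>H) / c" for k
        unfolding nrm_def using c H(1) by (subst integral_density) (auto simp: measurable_cong_sets[OF H(1) refl])
    qed
    have F': "real_distribution (nrm F)" "AE x in nrm F. \<bar>x\<bar> \<le> 1" "density (nrm F) (\<lambda>_. ennreal c) = F"
       "\<And>k. (\<integral>x. x ^ k \<partial>nrm F) = (\<integral>x. x ^ k \<partial>F) / c"
      using nrm[OF sets(1) fin(1) supp(1)] by (auto simp: c_def)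
    have G': "real_distribution (nrm G)" "AE x in nrm G. \<bar>x\<bar> \<le> 1" "density (nrm G) (\<lambda>_. ennreal c) = G"
       "\<And>k. (\<integral>x. x ^ k \<partial>nrm G) = (\<integral>x. x ^ k \<partial>G) / c"
      using nrm[OF sets(2) fin(2) supp(2)] by (auto simp: c_def mass)
    have "nrm F = nrm G"
      by (rule moments_determine_prob[OF F'(1) G'(1) F'(2) G'(2)]) (simp add: F'(4) G'(4) eq)
    with F'(3) G'(3) show ?thesis by metis
  qed
qed

text \<open>Markov's inequality for x^(2k): for c > b the mass of |x| >= c is at most C (b/c)^(2k),
  which tends to 0. Even powers control both tails at once.\<close>

lemma support_from_even_moments:
  fixes F :: "real measure"
  assumes sets: "sets F = sets borel" and fin: "finite_measure F" and supp: "emeasure F (- {-1..1}) = 0"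
    and b: "0 \<le> b" and le: "\<And>k. (\<integral>x. x ^ (2 * k) \<partial>F) \<le> C * b ^ (2 * k)"
  shows "emeasure F (- {-b..b}) = 0"
proof -
  interpret F: finite_measure F by fact
  have sp: "space F = UNIV" using sets[THEN sets_eq_imp_space_eq] by simp
  have AE1: "AE x in F. \<bar>x\<bar> \<le> 1" using supp AE_abs_le_iff[OF sets] by simp
  have int: "integrable F (\<lambda>x. x ^ k)" for k
    using AE1 by (intro F.integrable_const_bound[of _ 1]) (auto simp: power_abs power_le_one measurable_cong_sets[OF sets refl])
  have null: "measure F {x. c \<le> \<bar>x\<bar>} = 0" if c: "c > b" for c
  proof -
    have meas: "{x. c \<le> \<bar>x\<bar>} \<in> sets F" using sets by measurable
    have le': "measure F {x. c \<le> \<bar>x\<bar>} * c ^ (2 * k) \<le> C * b ^ (2 * k)" for k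
    proof -
      have "(\<integral>x. indicator {x. c \<le> \<bar>x\<bar>} x * c ^ (2 * k) \<partial>F) \<le> (\<integral>x. x ^ (2 * k) \<partial>F)"
      proof (intro integral_mono int)
        show "integrable F (\<lambda>x. indicator {x. c \<le> \<bar>x\<bar>} x * c ^ (2 * k))"
          by (intro integrable_mult_left integrable_real_indicator meas) (simp add: F.emeasure_eq_measure)
        fix x
        have "c ^ (2 * k) \<le> \<bar>x\<bar> ^ (2 * k)" if "c \<le> \<bar>x\<bar>" using that b c by (intro power_mono) auto
        then show "indicator {x. c \<le> \<bar>x\<bar>} x * c ^ (2 * k) \<le> x ^ (2 * k)"
          by (auto split: split_indicator simp: power_even_abs)
      qed
      also have "(\<integral>x. indicator {x. c \<le> \<bar>x\<bar>} x * c ^ (2 * k) \<partial>F) = measure F {x. c \<le> \<bar>x\<bar>} * c ^ (2 * k)"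
        using meas by simp
      finally show ?thesis using le[of k] by linarith
    qed
    have le'': "measure F {x. c \<le> \<bar>x\<bar>} \<le> C * ((b / c)\<^sup>2) ^ k" for k
    proof -
      have "measure F {x. c \<le> \<bar>x\<bar>} \<le> C * b ^ (2 * k) / c ^ (2 * k)"
        using le'[of k] b c by (subst pos_le_divide_eq) auto
      then show ?thesis by (simp only: power_divide power_mult times_divide_eq_right)
    qed
    have "(\<lambda>k. C * ((b / c)\<^sup>2) ^ k) \<longlonglongrightarrow> C * 0"
      using b c by (intro tendsto_intros LIMSEQ_power_zero) (simp add: abs_square_less_1)
    then have "measure F {x. c \<le> \<bar>x\<bar>} \<le> C * 0"
      by (rule LIMSEQ_le_const) (use le'' in auto)
    then show ?thesis by (simp add: measure_le_0_iff)
  qed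
  have "- {-b..b} \<subseteq> (\<Union>n. {x. b + 1 / real (Suc n) \<le> \<bar>x\<bar>})"
  proof
    fix x assume "x \<in> - {-b..b}"
    then have "\<bar>x\<bar> - b > 0" by auto
    then obtain n where "1 / real (Suc n) < \<bar>x\<bar> - b" using nat_approx_posE by blast
    then show "x \<in> (\<Union>n. {x. b + 1 / real (Suc n) \<le> \<bar>x\<bar>})" by (auto intro!: exI[of _ n])
  qed
  moreover have "(\<Union>n. {x. b + 1 / real (Suc n) \<le> \<bar>x\<bar>}) \<in> null_sets F"
  proof (intro null_sets_UN)
    fix n
    show "{x. b + 1 / real (Suc n) \<le> \<bar>x\<bar>} \<in> null_sets F"
    proof (rule null_setsI)
      show "{x. b + 1 / real (Suc n) \<le> \<bar>x\<bar>} \<in> sets F" using sets by measurable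
    qed (simp add: F.emeasure_eq_measure null)
  qed
  ultimately show ?thesis
    using sets by (intro null_setsD1[OF null_sets_subset]) auto
qed

section \<open>Moment sequences of measures on [-b,b]\<close>

lemma moment_functional_integral:
  assumes "\<And>k. integrable F (\<lambda>x. x ^ k)"
  shows "moment_functional (\<lambda>k. \<integral>x. x ^ k \<partial>F) p = (\<integral>x. poly p x \<partial>F)"
  unfolding moment_functional_def poly_altdef using assms
  by (subst Bochner_Integration.integral_sum) auto

text \<open>The existential measure is traded for three conditions on the sequence itself:
  positivity, evenness and geometric decay. For the converse the moment problem is solved on [-1,1],
  and the decay of the even moments then shrinks the support to [-b,b].\<close>

lemma Minf_iff:
  assumes b: "0 \<le> b" "b \<le> 1"
  shows "m \<in> Minf b \<longleftrightarrow> moment_positive (\<lambda>k. m (int k)) \<and> (\<forall>k. m k = m \<bar>k\<bar>) \<and> (\<forall>k. \<bar>m k\<bar> \<le> m 0 * b ^ nat \<bar>k\<bar>)"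
proof
  assume "m \<in> Minf b"
  then obtain F where sets: "sets F = sets borel" and fin: "finite_measure F"
    and supp: "emeasure F (- {-b..b}) = 0" and m: "\<And>k. m k = (\<integral>x. x ^ nat \<bar>k\<bar> \<partial>F)"
    unfolding Minf_def by blast
  interpret F: finite_measure F by fact
  have AE: "AE x in F. \<bar>x\<bar> \<le> b" using supp AE_abs_le_iff[OF sets] by simp
  have pb: "AE x in F. \<bar>x\<bar> ^ k \<le> b ^ k" for k
    using AE by eventually_elim (auto intro!: power_mono)
  have int: "integrable F (\<lambda>x. x ^ k)" for k
    using pb[of k] by (intro F.integrable_const_bound[of _ "b ^ k"]) (auto simp: power_abs measurable_cong_sets[OF sets refl])
  have intp: "integrable F (poly p)" for p
    unfolding poly_altdef using int by (intro Bochner_Integration.integrable_sum integrable_mult_right) auto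
  have "moment_positive (\<lambda>k. m (int k))"
  proof -
    have "poly ([:1, 1:] * p\<^sup>2) x = (1 + x) * (poly p x)\<^sup>2" "poly ([:1, -1:] * p\<^sup>2) x = (1 - x) * (poly p x)\<^sup>2" for p and x :: real
      by (simp_all add: algebra_simps)
    then show ?thesis
      unfolding moment_positive_def m abs_of_nat nat_int moment_functional_integral[OF int] using AE b
      by (auto intro!: integral_nonneg_AE mult_nonneg_nonneg elim!: eventually_mono simp del: poly_mult)
  qed
  moreover have "\<bar>m k\<bar> \<le> m 0 * b ^ nat \<bar>k\<bar>" for k
  proof -
    have "\<bar>m k\<bar> \<le> (\<integral>x. \<bar>x ^ nat \<bar>k\<bar>\<bar> \<partial>F)" unfolding m by (rule integral_abs_bound)
    also have "\<dots> \<le> (\<integral>x. b ^ nat \<bar>k\<bar> \<partial>F)"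
      using pb by (intro integral_mono_AE integrable_abs int) (auto simp: power_abs)
    finally show ?thesis by (simp add: m)
  qed
  ultimately show "moment_positive (\<lambda>k. m (int k)) \<and> (\<forall>k. m k = m \<bar>k\<bar>) \<and> (\<forall>k. \<bar>m k\<bar> \<le> m 0 * b ^ nat \<bar>k\<bar>)"
    by (auto simp: m)
next
  assume *: "moment_positive (\<lambda>k. m (int k)) \<and> (\<forall>k. m k = m \<bar>k\<bar>) \<and> (\<forall>k. \<bar>m k\<bar> \<le> m 0 * b ^ nat \<bar>k\<bar>)"
  then obtain F where F: "sets F = sets borel" "finite_measure F" "emeasure F (- {-1..1}) = 0"
    "\<And>k. m (int k) = (\<integral>x. x ^ k \<partial>F)"
    using hausdorff_moment[of "\<lambda>k. m (int k)"] by metis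
  have "emeasure F (- {-b..b}) = 0"
  proof (rule support_from_even_moments[OF F(1-3) b(1)])
    fix k show "(\<integral>x. x ^ (2 * k) \<partial>F) \<le> m 0 * b ^ (2 * k)"
      using * F(4)[of "2*k", symmetric] by (metis abs_ge_self abs_of_nat nat_int order_trans)
  qed
  moreover have "m k = (\<integral>x. x ^ nat \<bar>k\<bar> \<partial>F)" for k
    using * F(4)[of "nat \<bar>k\<bar>"] by (metis abs_ge_zero int_nat_eq)
  ultimately show "m \<in> Minf b" unfolding Minf_def using F by blast
qed

lemma Minf_bound: "m \<in> Minf b \<Longrightarrow> 0 \<le> b \<Longrightarrow> b \<le> 1 \<Longrightarrow> \<bar>m k\<bar> \<le> m 0 * b ^ nat \<bar>k\<bar>"
  using Minf_iff by blast

lemma Minf_abs: "m \<in> Minf b \<Longrightarrow> m \<bar>k\<bar> = m k"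
  by (auto simp: Minf_def)

lemma Minf_moment_nonneg:
  assumes "m \<in> Minf b" "0 \<le> b" "b \<le> 1"
  shows "0 \<le> moment_functional (\<lambda>k. m (int k)) ([:1, 1:] * p\<^sup>2)"
    "0 \<le> moment_functional (\<lambda>k. m (int k)) ([:1, -1:] * p\<^sup>2)"
  using assms Minf_iff[of b m] unfolding moment_positive_def by blast+

lemma Minf_zero: "0 \<le> b \<Longrightarrow> b \<le> 1 \<Longrightarrow> (\<lambda>_. 0) \<in> Minf b"
  by (simp add: Minf_iff moment_positive_def moment_functional_def)

text \<open>\<open>Minf b\<close> is a convex cone. Midpoints serve the existence of minimisers,
  segments the variational inequality.\<close>

lemma Minf_comb:
  assumes "m \<in> Minf b" "m' \<in> Minf b" "0 \<le> b" "b \<le> 1" "0 \<le> c" "0 \<le> d"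
  shows "(\<lambda>k. c * m k + d * m' k) \<in> Minf b"
proof -
  have lin: "moment_functional (\<lambda>k. c * m (int k) + d * m' (int k)) p
     = c * moment_functional (\<lambda>k. m (int k)) p + d * moment_functional (\<lambda>k. m' (int k)) p" for p
    by (simp add: moment_functional_def sum_distrib_left sum.distrib algebra_simps)
  show ?thesis
    unfolding Minf_iff[OF assms(3,4)] moment_positive_def lin
  proof (intro conjI allI)
    fix k
    have 1: "\<bar>m k\<bar> \<le> m 0 * b ^ nat \<bar>k\<bar>" "\<bar>m' k\<bar> \<le> m' 0 * b ^ nat \<bar>k\<bar>"
      using assms Minf_bound by blast+
    have "\<bar>c * m k + d * m' k\<bar> \<le> c * \<bar>m k\<bar> + d * \<bar>m' k\<bar>"
      using assms(5,6) by (metis abs_mult abs_of_nonneg abs_triangle_ineq)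
    also have "\<dots> \<le> c * (m 0 * b ^ nat \<bar>k\<bar>) + d * (m' 0 * b ^ nat \<bar>k\<bar>)"
      using 1 assms(5,6) by (intro add_mono mult_left_mono) auto
    finally show "\<bar>c * m k + d * m' k\<bar> \<le> (c * m 0 + d * m' 0) * b ^ nat \<bar>k\<bar>" by (simp add: algebra_simps)
    show "c * m k + d * m' k = c * m \<bar>k\<bar> + d * m' \<bar>k\<bar>"
      using assms(1,2) by (simp only: Minf_abs)
  next
    fix p
    note nn = Minf_moment_nonneg[OF assms(1,3,4), of p] Minf_moment_nonneg[OF assms(2,3,4), of p]
    show "0 \<le> c * moment_functional (\<lambda>k. m (int k)) ([:1, 1:] * p\<^sup>2) + d * moment_functional (\<lambda>k. m' (int k)) ([:1, 1:] * p\<^sup>2)"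
      by (intro add_nonneg_nonneg mult_nonneg_nonneg nn assms)
    show "0 \<le> c * moment_functional (\<lambda>k. m (int k)) ([:1, -1:] * p\<^sup>2) + d * moment_functional (\<lambda>k. m' (int k)) ([:1, -1:] * p\<^sup>2)"
      by (intro add_nonneg_nonneg mult_nonneg_nonneg nn assms)
  qed
qed

text \<open>Every condition in \<open>Minf_iff\<close> is an equation or a weak inequality between
  finitely many entries, so it passes to pointwise limits.\<close>

lemma Minf_closed:
  assumes m: "\<And>n. m n \<in> Minf b" and lim: "\<And>k. (\<lambda>n. m n k) \<longlonglongrightarrow> l k" and b: "0 \<le> b" "b \<le> 1"
  shows "l \<in> Minf b"
proof -
  have mf: "(\<lambda>n. moment_functional (\<lambda>k. m n (int k)) p) \<longlonglongrightarrow> moment_functional (\<lambda>k. l (int k)) p" for p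
    unfolding moment_functional_def by (intro tendsto_intros lim)
  show ?thesis
    unfolding Minf_iff[OF b] moment_positive_def
  proof (intro conjI allI)
    fix p
    show "0 \<le> moment_functional (\<lambda>k. l (int k)) ([:1, 1:] * p\<^sup>2)"
      by (rule LIMSEQ_le_const[OF mf]) (use Minf_moment_nonneg[OF m b] in blast)
    show "0 \<le> moment_functional (\<lambda>k. l (int k)) ([:1, -1:] * p\<^sup>2)"
      by (rule LIMSEQ_le_const[OF mf]) (use Minf_moment_nonneg[OF m b] in blast)
  next
    fix k
    have "(\<lambda>n. m n k) = (\<lambda>n. m n \<bar>k\<bar>)" using Minf_abs[OF m] by simp
    then show "l k = l \<bar>k\<bar>" using LIMSEQ_unique[OF lim[of k]] lim[of "\<bar>k\<bar>"] by simp
    show "\<bar>l k\<bar> \<le> l 0 * b ^ nat \<bar>k\<bar>"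
      by (rule LIMSEQ_le[of "\<lambda>n. \<bar>m n k\<bar>" _ "\<lambda>n. m n 0 * b ^ nat \<bar>k\<bar>"])
         (auto intro!: tendsto_intros lim Minf_bound[OF m b])
  qed
qed

section \<open>Projection onto moment sequences\<close>

lemma summable_on_power_abs_int:
  fixes b :: real
  assumes "0 \<le> b" "b < 1"
  shows "(\<lambda>k::int. b ^ nat \<bar>k\<bar>) summable_on UNIV"
proof -
  have geo: "(\<lambda>n. b ^ (n + j)) summable_on UNIV" for j
    using assms by (intro norm_summable_imp_summable_on) (simp add: power_add summable_mult2 summable_geometric)
  have "bij_betw int UNIV {0..}"
    by (rule bij_betwI[where g=nat]) auto
  from summable_on_reindex_bij_betw[OF this, of "\<lambda>k. b ^ nat \<bar>k\<bar>"] geo[of 0]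
  have 1: "(\<lambda>k::int. b ^ nat \<bar>k\<bar>) summable_on {0..}" by simp
  \<comment> \<open>The negative half is enumerated by -(n+1), with exponents starting at 1; k = 0
    belongs to the other half.\<close>
  have "bij_betw (\<lambda>n. - int (n + 1)) UNIV {..<0}"
    by (rule bij_betwI[where g="\<lambda>k. nat (- k) - 1"]) auto
  from summable_on_reindex_bij_betw[OF this, of "\<lambda>k. b ^ nat \<bar>k\<bar>"] geo[of 1]
  have 2: "(\<lambda>k::int. b ^ nat \<bar>k\<bar>) summable_on {..<0}" by (simp add: nat_add_distrib add.commute)
  have "UNIV = {0..} \<union> {..<0::int}" "{0..} \<inter> {..<0::int} = {}" by auto
  then show ?thesis using summable_on_Un_disjoint[OF 1 2] by simp
qed

lemma summable_on_real_comparison: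
  fixes f g :: "'a \<Rightarrow> real"
  assumes "g summable_on A" "\<And>k. k \<in> A \<Longrightarrow> \<bar>f k\<bar> \<le> g k"
  shows "f summable_on A"
proof -
  have "(\<lambda>k. norm (g k)) summable_on A" using assms(1) summable_on_iff_abs_summable_on_real by blast
  then have "(\<lambda>k. norm (f k)) summable_on A"
    by (rule Infinite_Sum.abs_summable_on_comparison_test) (use assms(2) in fastforce)
  then show ?thesis using summable_on_iff_abs_summable_on_real by blast
qed

lemma abs_infsum_le:
  fixes f g :: "'a \<Rightarrow> real"
  assumes "g summable_on A" "\<And>k. k \<in> A \<Longrightarrow> \<bar>f k\<bar> \<le> g k"
  shows "\<bar>infsum f A\<bar> \<le> infsum g A"
proof -
  have f: "f summable_on A" by (rule summable_on_real_comparison[OF assms])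
  have ng: "(\<lambda>k. - g k) summable_on A" using assms(1) by (simp add: summable_on_uminus)
  have "infsum f A \<le> infsum g A"
    by (intro infsum_mono f assms(1)) (use assms(2) in fastforce)
  moreover have "infsum (\<lambda>k. - g k) A \<le> infsum f A"
    by (intro infsum_mono f ng) (use assms(2) in fastforce)
  ultimately show ?thesis by (simp add: infsum_uminus)
qed

text \<open>Enumerating the integers by \<open>int_decode\<close> turns the sums into series, to
  which Tannery's theorem applies.\<close>

lemma infsum_dominated_convergence_int:
  fixes f :: "nat \<Rightarrow> int \<Rightarrow> real"
  assumes lim: "\<And>k. (\<lambda>n. f n k) \<longlonglongrightarrow> g k" and h: "h summable_on UNIV" and le: "\<And>n k. \<bar>f n k\<bar> \<le> h k"
  shows "(\<lambda>n. infsum (f n) UNIV) \<longlonglongrightarrow> infsum g UNIV"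
proof -
  have leg: "\<bar>g k\<bar> \<le> h k" for k
    by (rule LIMSEQ_le_const2[OF tendsto_rabs[OF lim]]) (use le in auto)
  have sums: "(\<lambda>n. u (int_decode n)) sums infsum u UNIV" if "u summable_on UNIV" for u :: "int \<Rightarrow> real"
  proof -
    have "(u has_sum infsum u UNIV) UNIV" using that by simp
    then have "((\<lambda>n. u (int_decode n)) has_sum infsum u UNIV) UNIV"
      using has_sum_reindex_bij_betw[OF bij_int_decode, of u] by simp
    then show ?thesis by (rule has_sum_imp_sums)
  qed
  have sf: "f n summable_on UNIV" for n by (rule summable_on_real_comparison[OF h]) (simp add: le)
  have sg: "g summable_on UNIV" by (rule summable_on_real_comparison[OF h]) (simp add: leg)
  have "eventually (\<lambda>(k, n). norm (f n (int_decode k)) \<le> h (int_decode k)) (at_top \<times>\<^sub>F sequentially)"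
    by (rule always_eventually) (auto simp: le)
  then have "(\<lambda>n. \<Sum>k. f n (int_decode k)) \<longlonglongrightarrow> (\<Sum>k. g (int_decode k))"
    using tannerys_theorem[of "\<lambda>k n. f n (int_decode k)" "\<lambda>k. g (int_decode k)" sequentially "\<lambda>k. h (int_decode k)"]
      lim sums[OF h] by (auto simp: sums_iff)
  then show ?thesis using sums[OF sf] sums[OF sg] by (simp add: sums_iff)
qed

text \<open>One factor is bounded, being summable, and the other is absolutely summable.\<close>

lemma summable_on_mult_real:
  fixes u v :: "'a \<Rightarrow> real"
  assumes "u summable_on A" "v summable_on A"
  shows "(\<lambda>k. u k * v k) summable_on A"
proof -
  have absu: "(\<lambda>k. \<bar>u k\<bar>) summable_on A" and absv: "(\<lambda>k. \<bar>v k\<bar>) summable_on A"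
    using assms summable_on_iff_abs_summable_on_real[of _ A] by auto
  define B where "B = infsum (\<lambda>k. \<bar>v k\<bar>) A"
  have "\<bar>v k\<bar> \<le> B" if "k \<in> A" for k
    using finite_sum_le_infsum[OF absv, of "{k}"] that by (simp add: B_def)
  then have "\<bar>u k * v k\<bar> \<le> B * \<bar>u k\<bar>" if "k \<in> A" for k
    using mult_left_mono[of "\<bar>v k\<bar>" B "\<bar>u k\<bar>"] that by (simp add: abs_mult mult.commute)
  then show ?thesis
    by (intro summable_on_real_comparison[OF summable_on_cmult_right[OF absu, of B]]) auto
qed

lemma summable_on_lincomb:
  fixes u v :: "'a \<Rightarrow> real"
  assumes "u summable_on A" "v summable_on A"
  shows "(\<lambda>k. c * u k + d * v k) summable_on A"
  by (intro summable_on_add summable_on_cmult_right assms)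

lemma infsum_lincomb:
  fixes u v :: "'a \<Rightarrow> real"
  assumes "u summable_on A" "v summable_on A"
  shows "infsum (\<lambda>k. c * u k + d * v k) A = c * infsum u A + d * infsum v A"
  by (subst infsum_add) (auto intro!: summable_on_cmult_right assms simp: infsum_cmult_right')

lemma summable_on_finite_support:
  fixes r :: "'a \<Rightarrow> real"
  assumes "finite {k. r k \<noteq> 0}"
  shows "r summable_on UNIV"
proof -
  have "r summable_on {k. r k \<noteq> 0}" using assms by simp
  then show ?thesis by (rule summable_on_cong_neutral[THEN iffD1, rotated -1]) auto
qed

section \<open>Least-squares projection onto the cone of moment sequences\<close>

lemma Minf_summable:
  assumes "m \<in> Minf b" "0 \<le> b" "b < 1"
  shows "m summable_on UNIV"
  by (rule summable_on_real_comparison[OF summable_on_cmult_right[OF summable_on_power_abs_int[OF assms(2,3)], of "m 0"]])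
     (use Minf_bound[OF assms(1,2)] assms(3) in auto)

lemma Minf_0_nonneg: "m \<in> Minf b \<Longrightarrow> 0 \<le> b \<Longrightarrow> b \<le> 1 \<Longrightarrow> 0 \<le> m 0"
  using Minf_bound[of m b 0] by simp

lemma seq_sqdist_summable:
  fixes r m :: "int \<Rightarrow> real"
  assumes "r summable_on UNIV" "m summable_on UNIV"
  shows "(\<lambda>k. (r k - m k)\<^sup>2) summable_on UNIV"
proof -
  have "(\<lambda>k. r k - m k) summable_on UNIV"
    using summable_on_lincomb[OF assms, of 1 "-1"] by simp
  from summable_on_mult_real[OF this this] show ?thesis by (simp add: power2_eq_square)
qed

text \<open>The Hilbert space argument for closed convex sets: a minimising sequence is Cauchy by
  the parallelogram identity. Only coordinatewise limits are extracted, which fits the closedness of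
  \<open>Minf\<close> under pointwise convergence.\<close>

lemma Minf_minimizer_exists:
  fixes r :: "int \<Rightarrow> real"
  assumes r: "r summable_on UNIV" and b: "0 \<le> b" "b < 1"
  shows "\<exists>m. m \<in> Minf b \<and> (\<forall>m'\<in>Minf b. seq_sqdist r m \<le> seq_sqdist r m')"
proof -
  have b': "b \<le> 1" using b by simp
  note sq = seq_sqdist_summable[OF r Minf_summable[OF _ b]]
  define d where "d = (INF m\<in>Minf b. seq_sqdist r m)"
  have bdd: "bdd_below (seq_sqdist r ` Minf b)"
    by (rule bdd_belowI[of _ 0]) (auto simp: seq_sqdist_def intro!: infsum_nonneg)
  have ne: "Minf b \<noteq> {}" using Minf_zero[OF b(1) b'] by auto
  have d_le: "d \<le> seq_sqdist r m" if "m \<in> Minf b" for m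
    unfolding d_def using that by (intro cINF_lower bdd)
  have "\<exists>m. m \<in> Minf b \<and> seq_sqdist r m < d + 1 / real (Suc n)" for n
  proof -
    have "(INF m\<in>Minf b. seq_sqdist r m) < d + 1 / real (Suc n)" by (simp add: d_def)
    then show ?thesis using cINF_less_iff[OF ne bdd] by auto
  qed
  then obtain m where m: "\<And>n. m n \<in> Minf b" and m_less: "\<And>n. seq_sqdist r (m n) < d + 1 / real (Suc n)"
    by metis
  have "Cauchy (\<lambda>n. m n k)" for k
  proof (rule metric_CauchyI)
    fix e :: real assume e: "0 < e"
    obtain N where N: "1 / real (Suc N) < e\<^sup>2 / 4" using nat_approx_posE[of "e\<^sup>2 / 4"] e by auto
    have "dist (m i k) (m j k) < e" if "N \<le> i" "N \<le> j" for i j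
    proof -
      \<comment> \<open>The midpoint is admissible, so its squared distance to r is at least d. With
        D_i and D_j the squared distances of the two members, the parallelogram identity gives ||m_i
        - m_j||^2 <= 2 (D_i - d) + 2 (D_j - d).\<close>
      define h where "h = (\<lambda>k. (1/2) * m i k + (1/2) * m j k)"
      have h: "h \<in> Minf b" unfolding h_def by (intro Minf_comb m b b') auto
      have sij: "(\<lambda>k. (m i k - m j k)\<^sup>2) summable_on UNIV"
        by (intro seq_sqdist_summable Minf_summable[OF m b])
      have "2 * seq_sqdist r (m i) + 2 * seq_sqdist r (m j)
          = infsum (\<lambda>k. 2 * (r k - m i k)\<^sup>2 + 2 * (r k - m j k)\<^sup>2) UNIV"
        unfolding seq_sqdist_def by (intro infsum_lincomb[symmetric] sq m)
      also have "\<dots> = infsum (\<lambda>k. 4 * (r k - h k)\<^sup>2 + 1 * (m i k - m j k)\<^sup>2) UNIV"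
        by (intro infsum_cong) (simp add: h_def power2_eq_square field_simps)
      also have "\<dots> = 4 * seq_sqdist r h + 1 * infsum (\<lambda>k. (m i k - m j k)\<^sup>2) UNIV"
        unfolding seq_sqdist_def by (intro infsum_lincomb sq h sij)
      finally have "infsum (\<lambda>k. (m i k - m j k)\<^sup>2) UNIV \<le> 2 * seq_sqdist r (m i) + 2 * seq_sqdist r (m j) - 4 * d"
        using d_le[OF h] by simp
      also have "\<dots> < 2 * (1 / real (Suc i)) + 2 * (1 / real (Suc j))"
        using m_less[of i] m_less[of j] by simp
      also have "\<dots> \<le> 2 * (1 / real (Suc N)) + 2 * (1 / real (Suc N))"
        using that by (intro add_mono mult_left_mono divide_left_mono) auto
      also have "\<dots> < e\<^sup>2" using N by simp
      finally have "infsum (\<lambda>k. (m i k - m j k)\<^sup>2) UNIV < e\<^sup>2" .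
      moreover have "(m i k - m j k)\<^sup>2 \<le> infsum (\<lambda>k. (m i k - m j k)\<^sup>2) UNIV"
        using finite_sum_le_infsum[OF sij, of "{k}"] by simp
      ultimately have "(m i k - m j k)\<^sup>2 < e\<^sup>2" by simp
      then have "\<bar>m i k - m j k\<bar> < \<bar>e\<bar>" using abs_square_less_1 real_sqrt_less_iff[of "(m i k - m j k)\<^sup>2" "e\<^sup>2"] by simp
      then show ?thesis using e by (simp add: dist_real_def)
    qed
    then show "\<exists>M. \<forall>i\<ge>M. \<forall>j\<ge>M. dist (m i k) (m j k) < e" by blast
  qed
  then have "\<exists>l. (\<lambda>n. m n k) \<longlonglongrightarrow> l" for k using Cauchy_convergent convergent_def by blast
  then obtain l where l: "\<And>k. (\<lambda>n. m n k) \<longlonglongrightarrow> l k" by metis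
  have lM: "l \<in> Minf b" by (rule Minf_closed[OF m l b(1) b'])
  \<comment> \<open>Lower semicontinuity in the manner of Fatou: the bound is proved for every
    finite partial sum, where pointwise limits may be taken.\<close>
  have "seq_sqdist r l \<le> d"
    unfolding seq_sqdist_def
  proof (rule infsum_le_finite_sums[OF sq[OF lM]])
    fix F :: "int set" assume F: "finite F"
    have "(\<lambda>n. \<Sum>k\<in>F. (r k - m n k)\<^sup>2) \<longlonglongrightarrow> (\<Sum>k\<in>F. (r k - l k)\<^sup>2)"
      by (intro tendsto_intros l)
    moreover have "(\<lambda>n. d + 1 / real (Suc n)) \<longlonglongrightarrow> d + 0"
      by (intro tendsto_intros LIMSEQ_inverse_real_of_nat[unfolded inverse_eq_divide])
    moreover have "(\<Sum>k\<in>F. (r k - m n k)\<^sup>2) \<le> d + 1 / real (Suc n)" for n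
      using finite_sum_le_infsum[OF sq[OF m[of n]] F] m_less[of n] by (simp add: seq_sqdist_def)
    ultimately show "(\<Sum>k\<in>F. (r k - l k)\<^sup>2) \<le> d"
      using LIMSEQ_le[of "\<lambda>n. \<Sum>k\<in>F. (r k - m n k)\<^sup>2" "\<Sum>k\<in>F. (r k - l k)\<^sup>2" "\<lambda>n. d + 1 / real (Suc n)" "d + 0"] by auto
  qed
  then show ?thesis using lM d_le by fastforce
qed

lemma Proj_minimizer:
  assumes "r summable_on UNIV" "0 < \<delta>" "\<delta> \<le> 1"
  shows "Proj \<delta> r \<in> Minf (1 - \<delta>)" "m' \<in> Minf (1 - \<delta>) \<Longrightarrow> seq_sqdist r (Proj \<delta> r) \<le> seq_sqdist r m'"
  using someI_ex[OF Minf_minimizer_exists[OF assms(1), of "1 - \<delta>"]] assms(2,3) unfolding Proj_def by auto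

text \<open>The residual r - m forms no acute angle with a direction m' - m into the convex set.
  Otherwise a short step t towards m' would lower the squared distance, which changes by -2 t p +
  t^2 E.\<close>

lemma Proj_variational:
  assumes r: "r summable_on UNIV" and \<delta>: "0 < \<delta>" "\<delta> \<le> 1" and m': "m' \<in> Minf (1 - \<delta>)"
  shows "infsum (\<lambda>k. (r k - Proj \<delta> r k) * (m' k - Proj \<delta> r k)) UNIV \<le> 0"
proof (rule ccontr)
  define m where "m = Proj \<delta> r"
  have m: "m \<in> Minf (1 - \<delta>)" unfolding m_def by (rule Proj_minimizer[OF r \<delta>])
  have b: "0 \<le> 1 - \<delta>" "1 - \<delta> < 1" "1 - \<delta> \<le> 1" using \<delta> by auto
  have sm: "m summable_on UNIV" and sm': "m' summable_on UNIV"
    using Minf_summable[OF _ b(1,2)] m m' by auto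
  have s1: "(\<lambda>k. r k - m k) summable_on UNIV" and s2: "(\<lambda>k. m' k - m k) summable_on UNIV"
    using summable_on_lincomb[OF r sm, of 1 "-1"] summable_on_lincomb[OF sm' sm, of 1 "-1"] by simp_all
  have sip: "(\<lambda>k. (r k - m k) * (m' k - m k)) summable_on UNIV" by (rule summable_on_mult_real[OF s1 s2])
  have sE: "(\<lambda>k. (m' k - m k)\<^sup>2) summable_on UNIV" by (rule seq_sqdist_summable[OF sm' sm])
  have sD: "(\<lambda>k. (r k - m k)\<^sup>2) summable_on UNIV" by (rule seq_sqdist_summable[OF r sm])
  define p where "p = infsum (\<lambda>k. (r k - m k) * (m' k - m k)) UNIV"
  define E where "E = infsum (\<lambda>k. (m' k - m k)\<^sup>2) UNIV"
  assume "\<not> infsum (\<lambda>k. (r k - Proj \<delta> r k) * (m' k - Proj \<delta> r k)) UNIV \<le> 0"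
  then have p: "p > 0" by (simp add: p_def m_def)
  have E: "E \<ge> 0" unfolding E_def by (intro infsum_nonneg) auto
  \<comment> \<open>t <= 1 keeps the point on the segment, and the other bound forces t E <= p,
    against 2 p <= t E. The denominator E + 1 covers E = 0.\<close>
  define t where "t = min 1 (p / (E + 1))"
  have t: "0 < t" "t \<le> 1" using p E by (auto simp: t_def)
  have "(\<lambda>k. (1 - t) * m k + t * m' k) \<in> Minf (1 - \<delta>)"
    using t by (intro Minf_comb m m' b) auto
  then have "seq_sqdist r m \<le> seq_sqdist r (\<lambda>k. (1 - t) * m k + t * m' k)"
    unfolding m_def by (rule Proj_minimizer(2)[OF r \<delta>])
  also have "\<dots> = infsum (\<lambda>k. 1 * (1 * (r k - m k)\<^sup>2 + (- 2 * t) * ((r k - m k) * (m' k - m k))) + t\<^sup>2 * (m' k - m k)\<^sup>2) UNIV"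
    unfolding seq_sqdist_def by (intro infsum_cong) (simp add: power2_eq_square algebra_simps)
  also have "\<dots> = seq_sqdist r m - 2 * t * p + t\<^sup>2 * E"
    by (subst infsum_lincomb[OF summable_on_lincomb[OF sD sip] sE], subst infsum_lincomb[OF sD sip])
       (simp add: seq_sqdist_def p_def E_def)
  finally have "2 * t * p \<le> t * (t * E)" by (simp add: power2_eq_square)
  then have "2 * p \<le> t * E" using t by simp
  also have "\<dots> \<le> p / (E + 1) * E" using E by (intro mult_right_mono) (auto simp: t_def)
  also have "\<dots> = p * (E / (E + 1))" by simp
  also have "\<dots> \<le> p * 1" using p E by (intro mult_left_mono) auto
  finally show False using p by simp
qed

text \<open>The empirical autocovariances need not converge in $\ell^2$. Testing the variational inequality
  against \<open>m n\<close> pairs \<open>r n - m n\<close> only with geometrically decaying sequences, so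
  pointwise convergence suffices.\<close>

proposition sigma2_Proj_consistent:
  fixes r m :: "nat \<Rightarrow> int \<Rightarrow> real"
  assumes \<delta>: "0 < \<delta>" "\<delta> \<le> 1" and fin: "\<And>n. finite {k. r n k \<noteq> 0}" and rR: "\<And>n k. \<bar>r n k\<bar> \<le> R"
    and m: "\<And>n. m n \<in> Minf (1 - \<delta>)" and mR: "\<And>n. m n 0 \<le> R"
    and lim: "\<And>k. (\<lambda>n. r n k - m n k) \<longlonglongrightarrow> 0"
  shows "(\<lambda>n. sigma2 (Proj \<delta> (r n)) - sigma2 (m n)) \<longlonglongrightarrow> 0"
proof -
  define b where "b = 1 - \<delta>"
  have b: "0 \<le> b" "b < 1" "b \<le> 1" using \<delta> by (auto simp: b_def)
  define p where "p = (\<lambda>n. Proj \<delta> (r n))"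
  define g where "g = (\<lambda>k::int. b ^ nat \<bar>k\<bar>)"
  have g: "g summable_on UNIV" unfolding g_def by (rule summable_on_power_abs_int[OF b(1,2)])
  have g0: "0 \<le> g k" "g k \<le> 1" for k using b by (auto simp: g_def power_le_one)
  define S where "S = infsum g UNIV"
  have R0: "0 \<le> R" using rR[of 0 0] by simp
  have sr: "r n summable_on UNIV" for n by (rule summable_on_finite_support[OF fin])
  have p: "p n \<in> Minf b" for n unfolding p_def b_def by (rule Proj_minimizer[OF sr \<delta>])
  have sp: "p n summable_on UNIV" for n by (rule Minf_summable[OF p b(1,2)])
  have mb: "m n \<in> Minf b" for n using m by (simp add: b_def)
  have sm: "m n summable_on UNIV" for n by (rule Minf_summable[OF mb b(1,2)])
  have p0: "0 \<le> p n 0" for n by (rule Minf_0_nonneg[OF p b(1,3)])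
  have m0: "0 \<le> m n 0" for n by (rule Minf_0_nonneg[OF mb b(1,3)])
  have pg: "\<bar>p n k\<bar> \<le> p n 0 * g k" for n k using Minf_bound[OF p b(1,3)] by (simp add: g_def)
  have mg: "\<bar>m n k\<bar> \<le> m n 0 * g k" for n k using Minf_bound[OF mb b(1,3)] by (simp add: g_def)
  have mg': "\<bar>m n k\<bar> \<le> R * g k" for n k
    using mg[of n k] mult_right_mono[OF mR g0(1), of n k] by simp
  \<comment> \<open>Testing against the zero sequence gives ||p||^2 <= <r, p>. Since |p_k| <= p_0
    b^|k|, the right side is at most R S p_0, while p_0^2 is one term of the left side.\<close>
  have p_bound: "p n 0 \<le> R * S" for n
  proof (cases "p n 0 = 0")
    case True
    then show ?thesis using R0 by (simp add: S_def infsum_nonneg g0)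
  next
    case False
    have s1: "(\<lambda>k. r n k * p n k) summable_on UNIV" by (rule summable_on_mult_real[OF sr sp])
    have s2: "(\<lambda>k. (p n k)\<^sup>2) summable_on UNIV"
      using summable_on_mult_real[OF sp[of n] sp[of n]] by (simp add: power2_eq_square)
    have "(p n 0)\<^sup>2 \<le> infsum (\<lambda>k. (p n k)\<^sup>2) UNIV"
      using finite_sum_le_infsum[OF s2, of "{0}"] by simp
    also have "\<dots> \<le> infsum (\<lambda>k. r n k * p n k) UNIV"
    proof -
      have "infsum (\<lambda>k. (r n k - p n k) * (0 - p n k)) UNIV \<le> 0"
        unfolding p_def by (rule Proj_variational[OF sr \<delta> Minf_zero]) (use \<delta> in auto)
      moreover have "infsum (\<lambda>k. (r n k - p n k) * (0 - p n k)) UNIV = infsum (\<lambda>k. 1 * (p n k)\<^sup>2 + (-1) * (r n k * p n k)) UNIV"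
        by (intro infsum_cong) (simp add: power2_eq_square algebra_simps)
      ultimately show ?thesis using infsum_lincomb[OF s2 s1, where c=1 and d="-1"] by simp
    qed
    also have "\<dots> \<le> infsum (\<lambda>k. (R * p n 0) * g k) UNIV"
    proof (rule abs_le_D1[OF abs_infsum_le], goal_cases)
      case 1 show ?case by (rule summable_on_cmult_right[OF g])
    next
      case (2 k)
      have "\<bar>r n k * p n k\<bar> \<le> R * (p n 0 * g k)" unfolding abs_mult using R0 by (intro mult_mono rR pg) auto
      then show ?case by (simp add: mult.assoc)
    qed
    also have "\<dots> = R * p n 0 * S" by (simp add: infsum_cmult_right' S_def)
    finally have "p n 0 * p n 0 \<le> p n 0 * (R * S)" by (simp add: power2_eq_square algebra_simps)
    then show ?thesis using False p0[of n] by (simp add: mult_le_cancel_left)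
  qed
  define C where "C = R * S + R"
  have pg': "\<bar>p n k - m n k\<bar> \<le> C * g k" for n k
  proof -
    have "\<bar>p n k\<bar> \<le> R * S * g k" using pg[of n k] mult_right_mono[OF p_bound g0(1), of n k] by simp
    then show ?thesis using mg'[of n k] by (simp add: C_def algebra_simps)
  qed
  have C0: "0 \<le> C" using R0 by (simp add: C_def S_def infsum_nonneg g0)
  \<comment> \<open>An upper bound for the pairing of r - m with p - m. The geometric weight is
    summable, so pointwise convergence of r - m makes it vanish.\<close>
  define e where "e = (\<lambda>n. infsum (\<lambda>k. \<bar>r n k - m n k\<bar> * (C * g k)) UNIV)"
  have e0: "e \<longlonglongrightarrow> 0"
  proof -
    have "e \<longlonglongrightarrow> infsum (\<lambda>k::int. 0) UNIV"
      unfolding e_def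
    proof (rule infsum_dominated_convergence_int)
      show "(\<lambda>n. \<bar>r n k - m n k\<bar> * (C * g k)) \<longlonglongrightarrow> 0" for k
        using tendsto_mult[OF tendsto_rabs[OF lim[of k]] tendsto_const[of "C * g k"]] by simp
      show "(\<lambda>k. (2 * R * C) * g k) summable_on UNIV" by (rule summable_on_cmult_right[OF g])
      fix n k
      have "\<bar>m n k\<bar> \<le> R" using mg'[of n k] mult_left_mono[OF g0(2)[of k] R0] by simp
      then have "\<bar>r n k - m n k\<bar> \<le> 2 * R" using rR[of n k] by linarith
      then have "\<bar>r n k - m n k\<bar> * (C * g k) \<le> 2 * R * (C * g k)"
        by (intro mult_right_mono mult_nonneg_nonneg C0 g0)
      then show "\<bar>\<bar>r n k - m n k\<bar> * (C * g k)\<bar> \<le> 2 * R * C * g k"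
        using C0 g0(1)[of k] by (simp add: abs_mult mult.assoc)
    qed
    then show ?thesis by simp
  qed
  have dist: "(p n k - m n k)\<^sup>2 \<le> e n" for n k
  proof -
    have sd: "(\<lambda>k. (p n k - m n k)\<^sup>2) summable_on UNIV" by (rule seq_sqdist_summable[OF sp sm])
    have s1: "(\<lambda>k. r n k - p n k) summable_on UNIV" and s2: "(\<lambda>k. m n k - p n k) summable_on UNIV"
      and s3: "(\<lambda>k. r n k - m n k) summable_on UNIV" and s4: "(\<lambda>k. p n k - m n k) summable_on UNIV"
      using summable_on_lincomb[OF sr[of n] sp[of n], where c=1 and d="-1"] summable_on_lincomb[OF sm[of n] sp[of n], where c=1 and d="-1"]
        summable_on_lincomb[OF sr[of n] sm[of n], where c=1 and d="-1"] summable_on_lincomb[OF sp[of n] sm[of n], where c=1 and d="-1"] by simp_all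
    note t1 = summable_on_mult_real[OF s1 s2] and t2 = summable_on_mult_real[OF s3 s4]
    have "(p n k - m n k)\<^sup>2 \<le> infsum (\<lambda>k. (p n k - m n k)\<^sup>2) UNIV"
      using finite_sum_le_infsum[OF sd, of "{k}"] by simp
    \<comment> \<open>Termwise (p - m)^2 = (r - p)(m - p) + (r - m)(p - m); the variational
      inequality at m disposes of the first sum.\<close>
    also have "\<dots> = infsum (\<lambda>k. 1 * ((r n k - p n k) * (m n k - p n k)) + 1 * ((r n k - m n k) * (p n k - m n k))) UNIV"
      by (intro infsum_cong) (simp add: power2_eq_square algebra_simps)
    also have "\<dots> = infsum (\<lambda>k. (r n k - p n k) * (m n k - p n k)) UNIV + infsum (\<lambda>k. (r n k - m n k) * (p n k - m n k)) UNIV"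
      by (subst infsum_lincomb[OF t1 t2]) simp
    also have "\<dots> \<le> infsum (\<lambda>k. (r n k - m n k) * (p n k - m n k)) UNIV"
      using Proj_variational[OF sr[of n] \<delta> m[of n]] by (simp add: p_def)
    also have "\<dots> \<le> e n"
      unfolding e_def
    proof (rule abs_le_D1[OF abs_infsum_le], goal_cases)
      case 1
      have "(\<lambda>k. \<bar>r n k - m n k\<bar>) summable_on UNIV"
        using s3 summable_on_iff_abs_summable_on_real[of "\<lambda>k. r n k - m n k" UNIV] by simp
      then show ?case by (intro summable_on_mult_real summable_on_cmult_right[OF g])
    next
      case (2 k) show ?case unfolding abs_mult by (intro mult_left_mono pg') simp
    qed
    finally show ?thesis .
  qed
  have pt: "(\<lambda>n. p n k - m n k) \<longlonglongrightarrow> 0" for k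
  proof -
    have "(\<lambda>n. (p n k - m n k)\<^sup>2) \<longlonglongrightarrow> 0"
      by (rule tendsto_sandwich[OF _ _ tendsto_const[of 0] e0]) (auto simp: dist)
    then show ?thesis by simp
  qed
  have "(\<lambda>n. infsum (\<lambda>k. p n k - m n k) UNIV) \<longlonglongrightarrow> infsum (\<lambda>k::int. 0) UNIV"
    by (rule infsum_dominated_convergence_int[OF pt summable_on_cmult_right[OF g] pg'])
  moreover have "infsum (\<lambda>k. p n k - m n k) UNIV = sigma2 (p n) - sigma2 (m n)" for n
    using infsum_lincomb[OF sp[of n] sm[of n], where c=1 and d="-1"] by (simp add: sigma2_def)
  ultimately show ?thesis by (simp add: p_def)
qed

section \<open>Reversible kernels and autocovariances\<close>

text \<open>Tonelli for \<open>bind\<close>, carried over to Bochner integrals. The inner integral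
  is finite only almost everywhere, hence the form of the first claim.\<close>

lemma nonneg_integral_bind:
  fixes f :: "'b \<Rightarrow> real"
  assumes K: "K \<in> M \<rightarrow>\<^sub>M subprob_algebra N" and ne: "space M \<noteq> {}"
    and f: "integrable (M \<bind> K) f" and nn: "\<And>x. 0 \<le> f x"
  shows "AE x in M. integrable (K x) f" "integrable M (\<lambda>x. \<integral>y. f y \<partial>K x)"
    "(\<integral>y. f y \<partial>(M \<bind> K)) = (\<integral>x. \<integral>y. f y \<partial>K x \<partial>M)"
proof -
  have sb: "sets (M \<bind> K) = sets N" by (rule sets_bind[OF sets_kernel[OF K] ne])
  have fm[measurable]: "f \<in> borel_measurable N"
    using borel_measurable_integrable[OF f] by (simp add: measurable_cong_sets[OF sb refl])
  have eq: "(\<integral>\<^sup>+y. f y \<partial>(M \<bind> K)) = (\<integral>\<^sup>+x. \<integral>\<^sup>+y. f y \<partial>K x \<partial>M)"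
    by (rule nn_integral_bind[OF _ K]) simp
  have fin: "(\<integral>\<^sup>+y. f y \<partial>(M \<bind> K)) < \<infinity>"
    using f nn by (simp add: integrable_iff_bounded)
  have meas: "(\<lambda>x. \<integral>\<^sup>+y. f y \<partial>K x) \<in> borel_measurable M"
    by (rule measurable_compose[OF K]) measurable
  have meas': "(\<lambda>x. \<integral>y. f y \<partial>K x) \<in> borel_measurable M"
    by (rule measurable_compose[OF K]) measurable
  have "AE x in M. (\<integral>\<^sup>+y. f y \<partial>K x) \<noteq> \<infinity>"
    by (rule nn_integral_PInf_AE[OF meas]) (use fin eq in auto)
  then have *: "AE x in M. integrable (K x) f"
  proof (rule AE_mp, intro AE_I2 impI)
    fix x assume x: "x \<in> space M" and le: "(\<integral>\<^sup>+y. f y \<partial>K x) \<noteq> \<infinity>"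
    have "f \<in> borel_measurable (K x)" using fm by (simp add: measurable_cong_sets[OF sets_kernel[OF K x] refl])
    then show "integrable (K x) f" using le nn by (simp add: integrable_iff_bounded less_top)
  qed
  then show "AE x in M. integrable (K x) f" .
  have **: "AE x in M. (\<integral>\<^sup>+y. f y \<partial>K x) = ennreal (\<integral>y. f y \<partial>K x)"
    using * by eventually_elim (simp add: nn_integral_eq_integral nn)
  have eq2: "(\<integral>\<^sup>+y. f y \<partial>(M \<bind> K)) = (\<integral>\<^sup>+x. ennreal (\<integral>y. f y \<partial>K x) \<partial>M)"
    unfolding eq by (rule nn_integral_cong_AE[OF **])
  show int: "integrable M (\<lambda>x. \<integral>y. f y \<partial>K x)"
    using fin eq2 meas' by (simp add: integrable_iff_bounded nn integral_nonneg)
  show "(\<integral>y. f y \<partial>(M \<bind> K)) = (\<integral>x. \<integral>y. f y \<partial>K x \<partial>M)"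
    using eq2 by (simp add: integral_eq_nn_integral nn integral_nonneg borel_measurable_integrable[OF f] meas')
qed

text \<open>Positive and negative parts are treated separately; almost everywhere both inner
  integrals are finite and may be subtracted.\<close>

lemma integrable_bind_kernel:
  fixes f :: "'b \<Rightarrow> real"
  assumes K: "K \<in> M \<rightarrow>\<^sub>M subprob_algebra N" and ne: "space M \<noteq> {}"
    and f: "integrable (M \<bind> K) f"
  shows "AE x in M. integrable (K x) f" "integrable M (\<lambda>x. \<integral>y. f y \<partial>K x)"
    "(\<integral>y. f y \<partial>(M \<bind> K)) = (\<integral>x. \<integral>y. f y \<partial>K x \<partial>M)"
proof -
  define p q where pq: "p = (\<lambda>x. max 0 (f x))" "q = (\<lambda>x. max 0 (- f x))"
  have f_eq: "f = (\<lambda>x. p x - q x)" by (auto simp: pq fun_eq_iff)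
  have p: "integrable (M \<bind> K) p" and q: "integrable (M \<bind> K) q"
    unfolding pq using f by (auto intro!: integrable_max)
  have nn: "0 \<le> p x" "0 \<le> q x" for x by (auto simp: pq)
  note P = nonneg_integral_bind[OF K ne p nn(1)] and Q = nonneg_integral_bind[OF K ne q nn(2)]
  show 1: "AE x in M. integrable (K x) f"
    using P(1) Q(1) by eventually_elim (simp add: f_eq)
  have sb: "sets (M \<bind> K) = sets N" by (rule sets_bind[OF sets_kernel[OF K] ne])
  have fm[measurable]: "f \<in> borel_measurable N"
    using borel_measurable_integrable[OF f] by (simp add: measurable_cong_sets[OF sb refl])
  have meas: "(\<lambda>x. \<integral>y. f y \<partial>K x) \<in> borel_measurable M"
    by (rule measurable_compose[OF K]) measurable
  have 2: "AE x in M. (\<integral>y. f y \<partial>K x) = (\<integral>y. p y \<partial>K x) - (\<integral>y. q y \<partial>K x)"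
    using P(1) Q(1) by eventually_elim (simp add: f_eq)
  show "integrable M (\<lambda>x. \<integral>y. f y \<partial>K x)"
    by (rule integrable_cong_AE_imp[OF Bochner_Integration.integrable_diff[OF P(2) Q(2)] meas])
       (use 2 in \<open>auto simp: eq_commute\<close>)
  have "(\<integral>y. f y \<partial>(M \<bind> K)) = (\<integral>x. \<integral>y. p y \<partial>K x \<partial>M) - (\<integral>x. \<integral>y. q y \<partial>K x \<partial>M)"
    unfolding f_eq using p q P(3) Q(3) by simp
  also have "\<dots> = (\<integral>x. (\<integral>y. p y \<partial>K x) - (\<integral>y. q y \<partial>K x) \<partial>M)"
    using P(2) Q(2) by simp
  also have "\<dots> = (\<integral>x. \<integral>y. f y \<partial>K x \<partial>M)"
    using 2 by (intro integral_cong_AE borel_measurable_diff borel_measurable_integrable[OF P(2)] borel_measurable_integrable[OF Q(2)] meas) auto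
  finally show "(\<integral>y. f y \<partial>(M \<bind> K)) = (\<integral>x. \<integral>y. f y \<partial>K x \<partial>M)" .
qed

text \<open>Kept without the factor 1/2, since it only serves to dominate products of square
  integrable functions.\<close>

lemma abs_mult_le_squares: "\<bar>a * b\<bar> \<le> a\<^sup>2 + b\<^sup>2" for a b :: real
proof -
  have "2 * (\<bar>a\<bar> * \<bar>b\<bar>) \<le> a\<^sup>2 + b\<^sup>2"
    using sum_squares_bound[of "\<bar>a\<bar>" "\<bar>b\<bar>"] by (simp add: mult.assoc)
  moreover have "0 \<le> \<bar>a\<bar> * \<bar>b\<bar>" by simp
  ultimately show ?thesis unfolding abs_mult by linarith
qed

lemma measure_eqI_rectangles:
  fixes \<mu> \<nu> :: "('a::topological_space \<times> 'b::topological_space) measure"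
  assumes sets: "sets \<mu> = sets (borel \<Otimes>\<^sub>M borel)" "sets \<nu> = sets (borel \<Otimes>\<^sub>M borel)" and fin: "finite_measure \<mu>"
    and eq: "\<And>A B. A \<in> sets borel \<Longrightarrow> B \<in> sets borel \<Longrightarrow> emeasure \<mu> (A \<times> B) = emeasure \<nu> (A \<times> B)"
  shows "\<mu> = \<nu>"
proof (rule measure_eqI_generator_eq)
  let ?E = "{A \<times> B | A B. A \<in> sets (borel :: 'a measure) \<and> B \<in> sets (borel :: 'b measure)}"
  show "Int_stable ?E" using Int_stable_pair_measure_generator by auto
  show "?E \<subseteq> Pow UNIV" by auto
  show "sets \<mu> = sigma_sets UNIV ?E" "sets \<nu> = sigma_sets UNIV ?E"
    unfolding sets by (simp_all add: sets_pair_measure)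
  have "UNIV \<times> UNIV \<in> ?E"
    by (rule CollectI, rule exI[of _ UNIV], rule exI[of _ UNIV]) simp
  then show "range (\<lambda>_::nat. UNIV \<times> UNIV) \<subseteq> ?E" by blast
  show "(\<Union>i::nat. UNIV \<times> UNIV) = UNIV" by auto
  show "emeasure \<mu> (UNIV \<times> UNIV) \<noteq> \<infinity>" for i :: nat
    using finite_measure.emeasure_finite[OF fin, of "UNIV \<times> UNIV"] by (simp only: infinity_ennreal_def not_False_eq_True)
  show "emeasure \<mu> X = emeasure \<nu> X" if "X \<in> ?E" for X using that eq by auto
qed

section \<open>The operator of a reversible kernel on square integrable functions\<close>

locale markov_kernel =
  fixes Q :: "'a::polish_space \<Rightarrow> 'a measure"
  assumes kernel: "Q \<in> borel \<rightarrow>\<^sub>M prob_algebra borel"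
begin

lemma prob_space_Q: "prob_space (Q x)" and sets_Q [simp, measurable_cong]: "sets (Q x) = sets borel"
  using measurable_space[OF kernel, of x] by (auto simp: space_prob_algebra)

lemma space_Q [simp]: "space (Q x) = UNIV"
  using sets_eq_imp_space_eq[OF sets_Q] by simp

lemma Q_measurable [measurable]: "Q \<in> borel \<rightarrow>\<^sub>M subprob_algebra borel"
  using kernel by (rule measurable_prob_algebraD)

lemma kpow_prob: "kpow Q n \<in> borel \<rightarrow>\<^sub>M prob_algebra borel"
proof (induction n)
  case 0
  have "kpow Q 0 = return borel" by (simp add: fun_eq_iff)
  then show ?case by (simp add: measurable_return_prob_space)
next
  case (Suc n)
  have "kpow Q (Suc n) = (\<lambda>x. kpow Q n x \<bind> Q)" by (simp add: fun_eq_iff)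
  then show ?case using measurable_bind_prob_space[OF Suc kernel] by simp
qed

lemma prob_space_kpow: "prob_space (kpow Q n x)"
  and sets_kpow [simp, measurable_cong]: "sets (kpow Q n x) = sets borel"
  using measurable_space[OF kpow_prob, of x n] by (auto simp: space_prob_algebra)

lemma space_kpow [simp]: "space (kpow Q n x) = UNIV"
  using sets_eq_imp_space_eq[OF sets_kpow] by simp

lemma kpow_measurable [measurable]: "kpow Q n \<in> borel \<rightarrow>\<^sub>M subprob_algebra borel"
  using kpow_prob by (rule measurable_prob_algebraD)

lemma kpow_1: "kpow Q 1 x = Q x"
  by (simp add: bind_return[OF Q_measurable])

text \<open>Chapman-Kolmogorov: \<open>kpow\<close> appends steps at the end, whereas conditioning
  on the first step needs them in front.\<close>

lemma kpow_Suc_left: "kpow Q (Suc n) x = Q x \<bind> kpow Q n"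
proof (induction n arbitrary: x)
  case 0
  have "kpow Q 0 = return borel" by (simp add: fun_eq_iff)
  then show ?case by (simp add: bind_return[OF Q_measurable] bind_return'')
next
  case (Suc n)
  have "kpow Q (Suc (Suc n)) x = (Q x \<bind> kpow Q n) \<bind> Q" using Suc by simp
  also have "\<dots> = Q x \<bind> (\<lambda>z. kpow Q n z \<bind> Q)"
    by (rule bind_assoc) measurable
  finally show ?case by simp
qed

end

locale reversible_kernel = markov_kernel Q for Q :: "'a::polish_space \<Rightarrow> 'a measure" +
  fixes \<pi> :: "'a measure"
  assumes prob_pi: "prob_space \<pi>" and sets_pi [simp, measurable_cong]: "sets \<pi> = sets borel"
    and rev: "reversible Q \<pi>"
begin

sublocale pi: prob_space \<pi> by (rule prob_pi)

lemma space_pi [simp]: "space \<pi> = UNIV"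
  using sets_eq_imp_space_eq[OF sets_pi] by simp

lemma measurable_pi [simp]: "measurable \<pi> N = measurable borel N"
  by (rule measurable_cong_sets) auto

lemma detailed_balance:
  assumes [measurable]: "A \<in> sets borel" "B \<in> sets borel"
  shows "(\<integral>\<^sup>+x. indicator A x * emeasure (Q x) B \<partial>\<pi>) = (\<integral>\<^sup>+x. indicator B x * emeasure (Q x) A \<partial>\<pi>)"
proof -
  have "(\<integral>\<^sup>+x. indicator C x * emeasure (Q x) D \<partial>\<pi>) = ennreal (\<integral>x. indicator C x * measure (Q x) D \<partial>\<pi>)"
    if [measurable]: "C \<in> sets borel" "D \<in> sets borel" for C D
  proof -
    interpret Q: prob_space "Q x" for x by (rule prob_space_Q)
    have "integrable \<pi> (\<lambda>x. indicator C x * measure (Q x) D)"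
      by (rule pi.integrable_const_bound[of _ 1]) (auto simp: indicator_def)
    then have "ennreal (\<integral>x. indicator C x * measure (Q x) D \<partial>\<pi>) = (\<integral>\<^sup>+x. ennreal (indicator C x * measure (Q x) D) \<partial>\<pi>)"
      by (intro nn_integral_eq_integral[symmetric]) auto
    also have "\<dots> = (\<integral>\<^sup>+x. indicator C x * emeasure (Q x) D \<partial>\<pi>)"
      by (intro nn_integral_cong) (auto simp: Q.emeasure_eq_measure split: split_indicator)
    finally show ?thesis by simp
  qed
  then show ?thesis using rev assms unfolding reversible_def by simp
qed

text \<open>Detailed balance with \<open>UNIV\<close> as one of the two sets.\<close>

lemma stationary: "\<pi> \<bind> Q = \<pi>"
proof (rule measure_eqI)
  show s: "sets (\<pi> \<bind> Q) = sets \<pi>" by simp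
  fix A assume "A \<in> sets (\<pi> \<bind> Q)"
  then have [measurable]: "A \<in> sets borel" using s by simp
  have "emeasure (\<pi> \<bind> Q) A = (\<integral>\<^sup>+x. indicator UNIV x * emeasure (Q x) A \<partial>\<pi>)"
    by (subst emeasure_bind[where N=borel]) auto
  also have "\<dots> = (\<integral>\<^sup>+x. indicator A x * emeasure (Q x) UNIV \<partial>\<pi>)"
    by (rule detailed_balance) auto
  also have "\<dots> = (\<integral>\<^sup>+x. indicator A x \<partial>\<pi>)"
    using prob_space.emeasure_space_1[OF prob_space_Q] by simp
  finally show "emeasure (\<pi> \<bind> Q) A = emeasure \<pi> A" by simp
qed

lemma stationary_kpow: "\<pi> \<bind> kpow Q n = \<pi>"
proof (induction n)
  case 0
  have "kpow Q 0 = return borel" by (simp add: fun_eq_iff)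
  then show ?case by (simp add: bind_return'')
next
  case (Suc n)
  have "\<pi> \<bind> kpow Q (Suc n) = \<pi> \<bind> (\<lambda>x. kpow Q n x \<bind> Q)"
    by (intro bind_cong) auto
  also have "\<dots> = (\<pi> \<bind> kpow Q n) \<bind> Q"
    by (rule bind_assoc[symmetric, where N=borel and R=borel]) simp_all
  finally show ?case by (simp only: Suc stationary)
qed

text \<open>The law of (X_0, X_n) for the stationary chain. Both marginals are \<pi>, so products
  f(X_0) h(X_n) of square integrable functions are integrable, and reversibility becomes symmetry of
  \<open>joint 1\<close>.\<close>

definition joint :: "nat \<Rightarrow> ('a \<times> 'a) measure" where
  "joint n = \<pi> \<bind> (\<lambda>y. distr (kpow Q n y) (borel \<Otimes>\<^sub>M borel) (Pair y))"

lemma joint_kernel [measurable]: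
  "(\<lambda>y. distr (kpow Q n y) (borel \<Otimes>\<^sub>M borel) (Pair y)) \<in> borel \<rightarrow>\<^sub>M subprob_algebra (borel \<Otimes>\<^sub>M borel)"
  by (rule measurable_distr2[where M=borel]) measurable

lemma sets_joint [simp, measurable_cong]: "sets (joint n) = sets (borel \<Otimes>\<^sub>M borel)"
  unfolding joint_def by (rule sets_bind) auto

lemma space_joint [simp]: "space (joint n) = UNIV"
  using sets_eq_imp_space_eq[OF sets_joint] by (simp add: space_pair_measure)

lemma prob_space_joint: "prob_space (joint n)"
  unfolding joint_def
  by (rule pi.prob_space_bind[where S="borel \<Otimes>\<^sub>M borel"])
     (auto intro!: AE_I2 prob_space.prob_space_distr[OF prob_space_kpow])

lemma nn_integral_joint:
  assumes [measurable]: "f \<in> borel_measurable (borel \<Otimes>\<^sub>M borel)"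
  shows "(\<integral>\<^sup>+p. f p \<partial>joint n) = (\<integral>\<^sup>+y. \<integral>\<^sup>+z. f (y, z) \<partial>kpow Q n y \<partial>\<pi>)"
  unfolding joint_def
  by (subst nn_integral_bind[where B="borel \<Otimes>\<^sub>M borel"]) (auto simp: nn_integral_distr intro!: nn_integral_cong)

lemma emeasure_joint_times:
  assumes [measurable]: "A \<in> sets borel" "B \<in> sets borel"
  shows "emeasure (joint n) (A \<times> B) = (\<integral>\<^sup>+y. indicator A y * emeasure (kpow Q n y) B \<partial>\<pi>)"
proof -
  have "emeasure (joint n) (A \<times> B) = (\<integral>\<^sup>+p. indicator (A \<times> B) p \<partial>joint n)" by simp
  also have "\<dots> = (\<integral>\<^sup>+y. \<integral>\<^sup>+z. indicator A y * indicator B z \<partial>kpow Q n y \<partial>\<pi>)"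
    by (subst nn_integral_joint) (auto simp: indicator_times)
  also have "\<dots> = (\<integral>\<^sup>+y. indicator A y * emeasure (kpow Q n y) B \<partial>\<pi>)"
    by (simp add: nn_integral_cmult)
  finally show ?thesis .
qed

text \<open>Detailed balance is this equality on rectangles, and rectangles determine the
  measure.\<close>

lemma joint_symmetric: "distr (joint 1) (borel \<Otimes>\<^sub>M borel) (\<lambda>(y, z). (z, y)) = joint 1"
proof (rule measure_eqI_rectangles)
  interpret J: prob_space "joint 1" by (rule prob_space_joint)
  have "prob_space (distr (joint 1) (borel \<Otimes>\<^sub>M borel) (\<lambda>(y, z). (z, y)))"
    by (rule J.prob_space_distr) measurable
  then show "finite_measure (distr (joint 1) (borel \<Otimes>\<^sub>M borel) (\<lambda>(y, z). (z, y)))"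
    by (simp add: prob_space_def)
  fix A B :: "'a set" assume [measurable]: "A \<in> sets borel" "B \<in> sets borel"
  have "(\<lambda>(y, z). (z, y)) -` (A \<times> B) = B \<times> A" by auto
  then have "emeasure (distr (joint 1) (borel \<Otimes>\<^sub>M borel) (\<lambda>(y, z). (z, y))) (A \<times> B) = emeasure (joint 1) (B \<times> A)"
    by (subst emeasure_distr) simp_all
  also have "\<dots> = emeasure (joint 1) (A \<times> B)"
    using detailed_balance[of A B] unfolding emeasure_joint_times[OF \<open>A \<in> _\<close> \<open>B \<in> _\<close>] emeasure_joint_times[OF \<open>B \<in> _\<close> \<open>A \<in> _\<close>] kpow_1
    by simp
  finally show "emeasure (distr (joint 1) (borel \<Otimes>\<^sub>M borel) (\<lambda>(y, z). (z, y))) (A \<times> B) = emeasure (joint 1) (A \<times> B)" .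
qed simp_all

definition L2 :: "('a \<Rightarrow> real) \<Rightarrow> bool" where
  "L2 f \<longleftrightarrow> f \<in> borel_measurable borel \<and> integrable \<pi> (\<lambda>x. (f x)\<^sup>2)"

lemma L2_measurable: "L2 f \<Longrightarrow> f \<in> borel_measurable borel" by (simp add: L2_def)
lemma L2_sq: "L2 f \<Longrightarrow> integrable \<pi> (\<lambda>x. (f x)\<^sup>2)" by (simp add: L2_def)

lemma L2_integrable: "L2 f \<Longrightarrow> integrable \<pi> f"
  by (rule pi.square_integrable_imp_integrable) (simp_all add: L2_def)

lemma L2_const [simp]: "L2 (\<lambda>_. c)" by (simp add: L2_def)

lemma L2_cmult: "L2 f \<Longrightarrow> L2 (\<lambda>x. c * f x)"
  by (auto simp: L2_def power_mult_distrib)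

lemma L2_mult_integrable: "L2 f \<Longrightarrow> L2 h \<Longrightarrow> integrable \<pi> (\<lambda>x. f x * h x)"
proof -
  assume f: "L2 f" and h: "L2 h"
  note [measurable] = L2_measurable[OF f] L2_measurable[OF h]
  show ?thesis
  proof (rule Bochner_Integration.integrable_bound[where f="\<lambda>x. (f x)\<^sup>2 + (h x)\<^sup>2"])
    show "AE x in \<pi>. norm (f x * h x) \<le> norm ((f x)\<^sup>2 + (h x)\<^sup>2)"
      by (rule AE_I2) (simp only: real_norm_def abs_mult_le_squares abs_of_nonneg sum_power2_ge_zero)
  qed (use L2_sq[OF f] L2_sq[OF h] in auto)
qed

lemma L2_add: "L2 f \<Longrightarrow> L2 h \<Longrightarrow> L2 (\<lambda>x. f x + h x)"
  using L2_mult_integrable[of f h] by (auto simp: L2_def power2_sum mult.assoc)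

lemma L2_diff: "L2 f \<Longrightarrow> L2 h \<Longrightarrow> L2 (\<lambda>x. f x - h x)"
  using L2_add[of f "\<lambda>x. (-1) * h x"] L2_cmult[of h "-1"] by simp

lemma L2_sum: "(\<And>i. i \<in> I \<Longrightarrow> L2 (f i)) \<Longrightarrow> L2 (\<lambda>x. \<Sum>i\<in>I. f i x)"
  by (induction I rule: infinite_finite_induct) (auto intro: L2_add)

text \<open>The n-step operator on functions rather than on classes. Where \<open>f\<close> is not
  integrable the Bochner integral is 0 by convention, so operator identities are stated \<pi>-almost
  everywhere or under the integral.\<close>

definition K :: "nat \<Rightarrow> ('a \<Rightarrow> real) \<Rightarrow> 'a \<Rightarrow> real" where
  "K n f y = (\<integral>z. f z \<partial>kpow Q n y)"

lemma K_measurable [measurable]: "f \<in> borel_measurable borel \<Longrightarrow> K n f \<in> borel_measurable borel"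
  unfolding K_def by (rule measurable_compose[OF kpow_measurable]) measurable

lemma AE_integrable_kpow: "integrable \<pi> f \<Longrightarrow> AE y in \<pi>. integrable (kpow Q n y) f"
  for f :: "'a \<Rightarrow> real"
  using integrable_bind_kernel(1)[of "kpow Q n" \<pi> borel f] by (simp add: stationary_kpow)

lemma integrable_K: "integrable \<pi> f \<Longrightarrow> integrable \<pi> (K n f)"
  and integral_K: "integrable \<pi> f \<Longrightarrow> (\<integral>y. K n f y \<partial>\<pi>) = (\<integral>y. f y \<partial>\<pi>)"
  using integrable_bind_kernel(2,3)[of "kpow Q n" \<pi> borel f] by (simp_all add: stationary_kpow K_def[abs_def])

text \<open>Jensen's inequality under each Q^n(y), in the form that a variance is nonnegative,
  followed by stationarity.\<close>

lemma L2_K: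
  assumes f: "L2 f"
  shows "L2 (K n f)"
proof -
  note [measurable] = L2_measurable[OF f]
  have "AE y in \<pi>. (K n f y)\<^sup>2 \<le> K n (\<lambda>z. (f z)\<^sup>2) y"
    using AE_integrable_kpow[OF L2_sq[OF f], of n]
  proof eventually_elim
    case (elim y)
    interpret P: prob_space "kpow Q n y" by (rule prob_space_kpow)
    have fm: "f \<in> borel_measurable (kpow Q n y)" by measurable
    have "integrable (kpow Q n y) f"
      by (rule P.square_integrable_imp_integrable[OF fm elim])
    then show ?case using P.variance_eq[of f] P.variance_positive[of f] elim by (simp add: K_def)
  qed
  then have AE: "AE y in \<pi>. norm ((K n f y)\<^sup>2) \<le> norm (K n (\<lambda>z. (f z)\<^sup>2) y)"
    by eventually_elim (simp add: K_def)
  have "(\<lambda>y. (K n f y)\<^sup>2) \<in> borel_measurable \<pi>" by simp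
  from Bochner_Integration.integrable_bound[OF integrable_K[OF L2_sq[OF f], of n] this AE]
  show ?thesis by (simp add: L2_def)
qed

lemma joint_fst_integrable: "integrable \<pi> f \<Longrightarrow> integrable (joint n) (\<lambda>p. f (fst p))"
  and joint_snd_integrable: "integrable \<pi> f \<Longrightarrow> integrable (joint n) (\<lambda>p. f (snd p))"
  for f :: "'a \<Rightarrow> real"
proof -
  assume f: "integrable \<pi> f"
  have [measurable]: "f \<in> borel_measurable borel" using borel_measurable_integrable[OF f] by simp
  have fin: "(\<integral>\<^sup>+y. ennreal (norm (f y)) \<partial>\<pi>) < \<infinity>" using f by (simp add: integrable_iff_bounded)
  have "(\<integral>\<^sup>+p. ennreal (norm (f (fst p))) \<partial>joint n) = (\<integral>\<^sup>+y. ennreal (norm (f y)) \<partial>\<pi>)"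
    using prob_space.emeasure_space_1[OF prob_space_kpow] by (subst nn_integral_joint) auto
  then show "integrable (joint n) (\<lambda>p. f (fst p))" using fin by (simp add: integrable_iff_bounded)
  have "(\<integral>\<^sup>+p. ennreal (norm (f (snd p))) \<partial>joint n) = (\<integral>\<^sup>+y. ennreal (norm (f y)) \<partial>(\<pi> \<bind> kpow Q n))"
    by (subst nn_integral_joint, simp) (subst nn_integral_bind[where B=borel], auto)
  then show "integrable (joint n) (\<lambda>p. f (snd p))" using fin by (simp add: integrable_iff_bounded stationary_kpow)
qed

lemma joint_mult_integrable:
  assumes f: "L2 f" and h: "L2 h"
  shows "integrable (joint n) (\<lambda>p. f (fst p) * h (snd p))"
proof -
  note [measurable] = L2_measurable[OF f] L2_measurable[OF h]
  show ?thesis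
  proof (rule Bochner_Integration.integrable_bound[where f="\<lambda>p. (f (fst p))\<^sup>2 + (h (snd p))\<^sup>2"])
    show "AE p in joint n. norm (f (fst p) * h (snd p)) \<le> norm ((f (fst p))\<^sup>2 + (h (snd p))\<^sup>2)"
      by (rule AE_I2) (simp only: real_norm_def abs_mult_le_squares abs_of_nonneg sum_power2_ge_zero)
  qed (use joint_fst_integrable[OF L2_sq[OF f]] joint_snd_integrable[OF L2_sq[OF h]] in auto)
qed

lemma integral_joint:
  fixes F :: "'a \<times> 'a \<Rightarrow> real"
  assumes F: "integrable (joint n) F"
  shows "(\<integral>p. F p \<partial>joint n) = (\<integral>y. \<integral>z. F (y, z) \<partial>kpow Q n y \<partial>\<pi>)"
proof -
  have [measurable]: "F \<in> borel_measurable (borel \<Otimes>\<^sub>M borel)"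
    using borel_measurable_integrable[OF F] by (simp add: measurable_cong_sets[OF sets_joint refl])
  have "(\<integral>p. F p \<partial>joint n) = (\<integral>y. \<integral>p. F p \<partial>distr (kpow Q n y) (borel \<Otimes>\<^sub>M borel) (Pair y) \<partial>\<pi>)"
    using F unfolding joint_def by (intro integrable_bind_kernel(3)[where N="borel \<Otimes>\<^sub>M borel"]) auto
  also have "\<dots> = (\<integral>y. \<integral>z. F (y, z) \<partial>kpow Q n y \<partial>\<pi>)"
    by (intro Bochner_Integration.integral_cong refl integral_distr) auto
  finally show ?thesis .
qed

lemma integral_joint_mult:
  assumes f: "L2 f" and h: "L2 h"
  shows "(\<integral>p. f (fst p) * h (snd p) \<partial>joint n) = (\<integral>y. f y * K n h y \<partial>\<pi>)"
  using integral_joint[OF joint_mult_integrable[OF f h]] by (simp add: K_def)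

lemma integral_joint_1_swap:
  assumes f: "L2 f" and h: "L2 h"
  shows "(\<integral>p. f (fst p) * h (snd p) \<partial>joint 1) = (\<integral>p. h (fst p) * f (snd p) \<partial>joint 1)"
proof -
  note [measurable] = L2_measurable[OF f] L2_measurable[OF h]
  have "(\<integral>p. f (fst p) * h (snd p) \<partial>joint 1) = (\<integral>p. f (fst p) * h (snd p) \<partial>distr (joint 1) (borel \<Otimes>\<^sub>M borel) (\<lambda>(y, z). (z, y)))"
    by (simp only: joint_symmetric)
  also have "\<dots> = (\<integral>p. h (fst p) * f (snd p) \<partial>joint 1)"
    by (subst integral_distr) (auto simp: case_prod_beta mult.commute)
  finally show ?thesis .
qed

lemma K_1_selfadjoint:
  assumes f: "L2 f" and h: "L2 h"
  shows "(\<integral>y. f y * K 1 h y \<partial>\<pi>) = (\<integral>y. K 1 f y * h y \<partial>\<pi>)"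
  using integral_joint_1_swap[OF f h] unfolding integral_joint_mult[OF f h] integral_joint_mult[OF h f]
  by (simp add: mult.commute)

text \<open>The first-step formula for \<open>bind\<close> needs \<open>f\<close> integrable under
  Q^(n+1)(y), which stationarity gives for almost every y.\<close>

lemma K_Suc:
  assumes f: "L2 f"
  shows "AE y in \<pi>. K (Suc n) f y = K 1 (K n f) y"
  using AE_integrable_kpow[OF L2_integrable[OF f], of "Suc n"]
proof eventually_elim
  case (elim y)
  then have "(\<integral>z. f z \<partial>(Q y \<bind> kpow Q n)) = (\<integral>z. (\<integral>w. f w \<partial>kpow Q n z) \<partial>Q y)"
    by (intro integrable_bind_kernel(3)[where N=borel]) (auto simp: kpow_Suc_left simp del: kpow.simps)
  then show ?case unfolding K_def kpow_Suc_left kpow_1 by simp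
qed

lemma K_0: "f \<in> borel_measurable borel \<Longrightarrow> K 0 f = f"
  by (auto simp: K_def integral_return)

text \<open>Self-adjointness moves one application of Q at a time to the right factor, so j has to
  stay arbitrary in the induction.\<close>

lemma inner_K_K:
  assumes f: "L2 f" and h: "L2 h"
  shows "(\<integral>y. K i f y * K j h y \<partial>\<pi>) = (\<integral>y. f y * K (i + j) h y \<partial>\<pi>)"
proof (induction i arbitrary: j)
  case 0
  then show ?case using K_0[OF L2_measurable[OF f]] by simp
next
  case (Suc i)
  note [measurable] = L2_measurable[OF f] L2_measurable[OF h]
  have "(\<integral>y. K (Suc i) f y * K j h y \<partial>\<pi>) = (\<integral>y. K 1 (K i f) y * K j h y \<partial>\<pi>)"
    using K_Suc[OF f, of i] by (intro integral_cong_AE) auto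
  also have "\<dots> = (\<integral>y. K i f y * K 1 (K j h) y \<partial>\<pi>)"
    by (rule K_1_selfadjoint[OF L2_K[OF f] L2_K[OF h], symmetric])
  also have "\<dots> = (\<integral>y. K i f y * K (Suc j) h y \<partial>\<pi>)"
    using K_Suc[OF h, of j] by (intro integral_cong_AE) auto
  also have "\<dots> = (\<integral>y. f y * K (Suc i + j) h y \<partial>\<pi>)" using Suc[of "Suc j"] by simp
  finally show ?case .
qed

lemma K_selfadjoint:
  assumes f: "L2 f" and h: "L2 h"
  shows "(\<integral>y. f y * K n h y \<partial>\<pi>) = (\<integral>y. h y * K n f y \<partial>\<pi>)"
  using inner_K_K[OF f h, of n 0] K_0[OF L2_measurable[OF h]] by (simp add: mult.commute)

abbreviation mean :: "('a \<Rightarrow> real) \<Rightarrow> real" where "mean f \<equiv> (\<integral>y. f y \<partial>\<pi>)"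

abbreviation cov :: "('a \<Rightarrow> real) \<Rightarrow> ('a \<Rightarrow> real) \<Rightarrow> int \<Rightarrow> real" where "cov \<equiv> gamma Q \<pi>"

abbreviation acov :: "('a \<Rightarrow> real) \<Rightarrow> int \<Rightarrow> real" where "acov f \<equiv> gamma Q \<pi> f f"

text \<open>The two branches of \<open>gamma\<close> differ in the function on which Q^|k| acts, and
  self-adjointness removes the difference.\<close>

lemma gamma_eq_K:
  assumes f: "L2 f" and h: "L2 h"
  shows "cov f h k = (\<integral>y. f y * K (nat \<bar>k\<bar>) h y \<partial>\<pi>) - mean f * mean h"
proof (cases "0 \<le> k")
  case True
  then show ?thesis by (simp add: gamma_def K_def)
next
  case False
  then have "cov f h k = (\<integral>y. h y * K (nat \<bar>k\<bar>) f y \<partial>\<pi>) - mean f * mean h"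
    by (simp add: gamma_def K_def)
  then show ?thesis by (simp only: K_selfadjoint[OF h f])
qed

lemma gamma_eq_joint:
  assumes f: "L2 f" and h: "L2 h"
  shows "cov f h k = (\<integral>p. f (fst p) * h (snd p) \<partial>joint (nat \<bar>k\<bar>)) - mean f * mean h"
  by (simp add: gamma_eq_K[OF f h] integral_joint_mult[OF f h])

lemma gamma_commute: "L2 f \<Longrightarrow> L2 h \<Longrightarrow> cov f h k = cov h f k"
  by (simp only: gamma_eq_K K_selfadjoint[of f h] mult.commute[of "mean f"])

lemma gamma_abs: "L2 f \<Longrightarrow> L2 h \<Longrightarrow> cov f h \<bar>k\<bar> = cov f h k"
  by (simp add: gamma_eq_K)

lemma gamma_cmult_left: "L2 f \<Longrightarrow> L2 h \<Longrightarrow> cov (\<lambda>x. c * f x) h k = c * cov f h k"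
  by (simp add: gamma_eq_K L2_cmult mult.assoc right_diff_distrib)

lemma gamma_add_left:
  assumes f: "L2 f" "L2 f'" "L2 h"
  shows "cov (\<lambda>x. f x + f' x) h k = cov f h k + cov f' h k"
  using L2_mult_integrable[OF f(1) L2_K[OF f(3), of "nat \<bar>k\<bar>"]] L2_mult_integrable[OF f(2) L2_K[OF f(3), of "nat \<bar>k\<bar>"]]
    L2_integrable[OF f(1)] L2_integrable[OF f(2)]
  by (simp add: gamma_eq_K assms L2_add distrib_right)

lemma gamma_sum_left:
  assumes "\<And>i. i \<in> I \<Longrightarrow> L2 (f i)" "L2 h"
  shows "cov (\<lambda>x. \<Sum>i\<in>I. f i x) h k = (\<Sum>i\<in>I. cov (f i) h k)"
  using assms(1)
proof (induction I rule: infinite_finite_induct)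
  case (insert i I)
  then show ?case using assms(2) by (simp add: gamma_add_left L2_sum)
qed (simp_all add: gamma_def)

text \<open>Linearity in the second argument is borrowed from the first through
  \<open>gamma_commute\<close>.\<close>

lemma gamma_sum_sum:
  assumes "\<And>i. i \<in> I \<Longrightarrow> L2 (f i)"
  shows "acov (\<lambda>x. \<Sum>i\<in>I. u i * f i x) k
    = (\<Sum>i\<in>I. \<Sum>j\<in>I. u i * u j * cov (f i) (f j) k)"
proof -
  let ?h = "\<lambda>x. \<Sum>i\<in>I. u i * f i x"
  have h: "L2 ?h" using assms by (intro L2_sum L2_cmult)
  have "cov ?h ?h k = (\<Sum>i\<in>I. u i * cov (f i) ?h k)"
    using assms h by (subst gamma_sum_left) (auto intro!: L2_cmult sum.cong simp: gamma_cmult_left)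
  also have "\<dots> = (\<Sum>i\<in>I. u i * (\<Sum>j\<in>I. u j * cov (f j) (f i) k))"
  proof (intro sum.cong refl arg_cong2[where f="(*)"])
    fix i assume i: "i \<in> I"
    have "cov (f i) ?h k = cov ?h (f i) k" by (rule gamma_commute[OF assms[OF i] h])
    also have "\<dots> = (\<Sum>j\<in>I. u j * cov (f j) (f i) k)"
      using assms i by (subst gamma_sum_left) (auto intro!: L2_cmult sum.cong simp: gamma_cmult_left)
    finally show "cov (f i) ?h k = (\<Sum>j\<in>I. u j * cov (f j) (f i) k)" .
  qed
  also have "\<dots> = (\<Sum>i\<in>I. \<Sum>j\<in>I. u i * u j * cov (f i) (f j) k)"
    unfolding sum_distrib_left using assms gamma_commute
    by (intro sum.cong refl) (auto simp: mult.assoc)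
  finally show ?thesis .
qed

end

section \<open>Spectral measures and spectral gap\<close>

lemma pCons_1_mult_monom: "[:1, s:] * monom c k = monom c k + monom (s * c) (k + 1)"
  for s :: real
proof -
  have "[:1, s:] = monom 1 0 + monom s 1" by (simp add: monom_0 monom_Suc)
  then show ?thesis by (simp only: distrib_right mult_monom) simp
qed

text \<open>The right side has the shape that results from expanding <h, (1 + s Q) h> for h = p(Q)
  f.\<close>

lemma moment_functional_quadratic:
  "moment_functional a ([:1, s:] * p\<^sup>2)
    = (\<Sum>i\<le>degree p. \<Sum>j\<le>degree p. coeff p i * coeff p j * (a (i + j) + s * a (Suc (i + j))))"
proof -
  have p: "p = (\<Sum>i\<le>degree p. monom (coeff p i) i)" by (rule poly_as_sum_of_monoms[symmetric])
  have "p\<^sup>2 = (\<Sum>i\<le>degree p. \<Sum>j\<le>degree p. monom (coeff p i * coeff p j) (i + j))"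
    unfolding power2_eq_square by (subst p, subst (2) p) (simp only: sum_product mult_monom)
  then have "[:1, s:] * p\<^sup>2 = (\<Sum>i\<le>degree p. \<Sum>j\<le>degree p. monom (coeff p i * coeff p j) (i + j) + monom (s * (coeff p i * coeff p j)) (i + j + 1))"
    by (simp only: sum_distrib_left pCons_1_mult_monom)
  then show ?thesis
    by (simp add: moment_functional_sum moment_functional_add moment_functional_monom algebra_simps)
qed

text \<open>Separability makes the complement of the support a null set. Positive mass makes the
  support nonempty, so that the supremum in \<open>Delta\<close> is a genuine one.\<close>

lemma Delta_support:
  fixes F :: "real measure"
  assumes sets: "sets F = sets borel" and fin: "finite_measure F" and supp: "emeasure F (- {-1..1}) = 0"
    and pos: "measure F UNIV > 0" and \<delta>: "0 < \<delta>" "\<delta> \<le> Delta F"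
  shows "\<delta> \<le> 1" "emeasure F (- {-(1-\<delta>)..1-\<delta>}) = 0"
proof -
  interpret F: finite_measure F by fact
  have null: "N \<in> null_sets F" if "open N" "N \<inter> msupp F = {}" for N
  proof -
    have "\<exists>e>0. emeasure F (ball x e) = 0" if "x \<in> N" for x
      using that \<open>N \<inter> msupp F = {}\<close> by (auto simp: msupp_def disjoint_iff)
    then obtain e where e: "\<And>x. x \<in> N \<Longrightarrow> e x > 0 \<and> emeasure F (ball x (e x)) = 0" by metis
    \<comment> \<open>Lindelof reduces the cover of N by null balls to a countable one.\<close>
    obtain D where D: "D \<subseteq> (\<lambda>x. ball x (e x)) ` N" "countable D" "\<Union>D = \<Union>((\<lambda>x. ball x (e x)) ` N)"
      using Lindelof[of "(\<lambda>x. ball x (e x)) ` N"] by auto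
    have "\<Union>D \<in> null_sets F"
    proof (rule null_sets_UN'[OF D(2), of "\<lambda>d. d", simplified])
      fix d assume "d \<in> D"
      then obtain x where "x \<in> N" "d = ball x (e x)" using D(1) by auto
      then show "d \<in> null_sets F" using e sets by (intro null_setsI) auto
    qed
    moreover have "N \<subseteq> \<Union>D" unfolding D(3) using e by fastforce
    ultimately show ?thesis using \<open>open N\<close> sets by (metis borel_open null_sets_subset)
  qed
  have ne: "msupp F \<noteq> {}"
  proof
    assume "msupp F = {}"
    then have "UNIV \<in> null_sets F" using null[of UNIV] by simp
    then show False using pos by (auto simp: measure_def)
  qed
  have "msupp F \<subseteq> {-1..1}"
  proof
    fix x assume x: "x \<in> msupp F"
    show "x \<in> {-1..1}"
    proof (rule ccontr)
      assume "x \<notin> {-1..1}"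
      then obtain e where e: "e > 0" "ball x e \<subseteq> - {-1..1}"
        using open_Compl[OF closed_atLeastAtMost[of "-1" "1::real"]] unfolding open_contains_ball by (meson ComplI)
      have "emeasure F (ball x e) \<le> emeasure F (- {-1..1})"
        using sets by (intro emeasure_mono e) auto
      then show False using x e supp by (auto simp: msupp_def)
    qed
  qed
  then have bdd: "bdd_above (abs ` msupp F)" by (intro bdd_aboveI[of _ 1]) (fastforce simp: abs_le_iff)
  have le: "\<bar>x\<bar> \<le> 1 - \<delta>" if "x \<in> msupp F" for x
    using cSUP_upper[OF that bdd] \<delta>(2) by (simp add: Delta_def)
  show "\<delta> \<le> 1" using ne le by fastforce
  have "- {-(1-\<delta>)..1-\<delta>} \<in> null_sets F"
    by (rule null) (use le in \<open>force intro!: open_Compl\<close>)+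
  then show "emeasure F (- {-(1-\<delta>)..1-\<delta>}) = 0" by auto
qed

context reversible_kernel
begin

lemma prob_pi_UNIV [simp]: "measure \<pi> UNIV = 1"
  using pi.prob_space by simp

lemma gamma_const_left: "L2 h \<Longrightarrow> cov (\<lambda>_. c) h k = 0"
  by (simp add: gamma_eq_K integral_K L2_integrable)

text \<open>A constant is uncorrelated with everything. After centring, the product of the means
  drops out and the autocovariance is <f, Q^k f>.\<close>

lemma gamma_centre:
  assumes f: "L2 f"
  shows "acov f k = acov (\<lambda>x. f x - c) k"
proof -
  define f0 where "f0 = (\<lambda>x. f x - c)"
  have f0: "L2 f0" unfolding f0_def by (intro L2_diff f) simp
  have eq: "f = (\<lambda>x. f0 x + c)" by (simp add: f0_def)
  have "acov f k = cov f0 f k"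
    using gamma_add_left[OF f0 L2_const f, of c k] by (simp add: eq[symmetric] gamma_const_left f)
  also have "\<dots> = cov f f0 k" by (rule gamma_commute[OF f0 f])
  also have "\<dots> = cov f0 f0 k"
    using gamma_add_left[OF f0 L2_const f0, of c k] by (simp add: eq[symmetric] gamma_const_left f0)
  finally show ?thesis by (simp add: f0_def)
qed

lemma inner_K_1_K:
  assumes f: "L2 f"
  shows "(\<integral>p. K i f (fst p) * K j f (snd p) \<partial>joint 1) = (\<integral>y. f y * K (Suc (i + j)) f y \<partial>\<pi>)"
proof -
  note [measurable] = L2_measurable[OF f]
  have "(\<integral>p. K i f (fst p) * K j f (snd p) \<partial>joint 1) = (\<integral>y. K i f y * K 1 (K j f) y \<partial>\<pi>)"
    by (rule integral_joint_mult[OF L2_K[OF f] L2_K[OF f]])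
  also have "\<dots> = (\<integral>y. K i f y * K (Suc j) f y \<partial>\<pi>)"
    using K_Suc[OF f, of j] by (intro integral_cong_AE) auto
  finally show ?thesis by (simp add: inner_K_K[OF f f])
qed

lemma integral_joint_fst: "integrable \<pi> f \<Longrightarrow> (\<integral>p. f (fst p) \<partial>joint n) = (\<integral>y. f y \<partial>\<pi>)"
  for f :: "'a \<Rightarrow> real"
  using integral_joint[OF joint_fst_integrable, of f n] prob_space.prob_space[OF prob_space_kpow] by simp

lemma integral_joint_snd: "integrable \<pi> f \<Longrightarrow> (\<integral>p. f (snd p) \<partial>joint n) = (\<integral>y. f y \<partial>\<pi>)"
  for f :: "'a \<Rightarrow> real"
  using integral_joint[OF joint_snd_integrable, of f n] integral_K[of f n] by (simp add: K_def)

text \<open>For \<open>h = p(Q) f\<close> one has \<open>2 \<langle>h, (1 + s Q) h\<rangle> = E (h(X\<^sub>0) + s h(X\<^sub>1))\<^sup>2\<close> when \<open>s = \<plusminus>1\<close>.\<close>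

lemma gamma_moment_positive:
  assumes f: "L2 f"
  shows "moment_positive (\<lambda>k. acov f (int k))"
proof -
  define f0 where "f0 = (\<lambda>x. f x - mean f)"
  have f0: "L2 f0" unfolding f0_def by (intro L2_diff f) simp
  have mean0: "mean f0 = 0"
    unfolding f0_def using L2_integrable[OF f] by simp
  define a where "a = (\<lambda>k. \<integral>y. f0 y * K k f0 y \<partial>\<pi>)"
  have a: "acov f (int k) = a k" for k
    using gamma_centre[OF f, of "int k" "mean f"] by (simp add: f0_def[symmetric] gamma_eq_K[OF f0 f0] mean0 a_def)
  have "0 \<le> moment_functional a ([:1, s:] * p\<^sup>2)" if s: "s\<^sup>2 = 1" for s p
  proof -
    define c where "c = coeff p"
    define d where "d = degree p"
    define h where "h = (\<lambda>y. \<Sum>i\<le>d. c i * K i f0 y)"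
    have h: "L2 h" unfolding h_def by (intro L2_sum L2_cmult L2_K f0)
    have A: "(\<integral>y. (h y)\<^sup>2 \<partial>\<pi>) = (\<Sum>i\<le>d. \<Sum>j\<le>d. c i * c j * a (i + j))"
    proof -
      have int: "integrable \<pi> (\<lambda>y. K i f0 y * K j f0 y)" for i j by (intro L2_mult_integrable L2_K f0)
      have "(\<integral>y. (h y)\<^sup>2 \<partial>\<pi>) = (\<integral>y. (\<Sum>i\<le>d. \<Sum>j\<le>d. c i * c j * (K i f0 y * K j f0 y)) \<partial>\<pi>)"
        by (simp add: h_def power2_eq_square sum_product ac_simps)
      also have "\<dots> = (\<Sum>i\<le>d. \<Sum>j\<le>d. c i * c j * a (i + j))"
        using int by (simp add: Bochner_Integration.integral_sum inner_K_K[OF f0 f0] a_def)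
      finally show ?thesis .
    qed
    have B: "(\<integral>p. h (fst p) * h (snd p) \<partial>joint 1) = (\<Sum>i\<le>d. \<Sum>j\<le>d. c i * c j * a (Suc (i + j)))"
    proof -
      have int: "integrable (joint 1) (\<lambda>p. K i f0 (fst p) * K j f0 (snd p))" for i j
        by (intro joint_mult_integrable L2_K f0)
      have "(\<integral>p. h (fst p) * h (snd p) \<partial>joint 1) = (\<integral>p. (\<Sum>i\<le>d. \<Sum>j\<le>d. c i * c j * (K i f0 (fst p) * K j f0 (snd p))) \<partial>joint 1)"
        by (simp add: h_def sum_product ac_simps)
      also have "\<dots> = (\<Sum>i\<le>d. \<Sum>j\<le>d. c i * c j * a (Suc (i + j)))"
        using int inner_K_1_K[OF f0] by (simp add: Bochner_Integration.integral_sum a_def)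
      finally show ?thesis .
    qed
    have i1: "integrable (joint 1) (\<lambda>p. (h (fst p))\<^sup>2)" and i2: "integrable (joint 1) (\<lambda>p. (h (snd p))\<^sup>2)"
      using joint_fst_integrable[OF L2_sq[OF h]] joint_snd_integrable[OF L2_sq[OF h]] by simp_all
    have i3: "integrable (joint 1) (\<lambda>p. h (fst p) * h (snd p))" by (rule joint_mult_integrable[OF h h])
    have "0 \<le> (\<integral>p. (h (fst p) + s * h (snd p))\<^sup>2 \<partial>joint 1)" by simp
    also have "\<dots> = (\<integral>p. (h (fst p))\<^sup>2 + s\<^sup>2 * (h (snd p))\<^sup>2 + 2 * s * (h (fst p) * h (snd p)) \<partial>joint 1)"
      by (simp add: power2_eq_square algebra_simps)
    also have "\<dots> = (\<integral>y. (h y)\<^sup>2 \<partial>\<pi>) + (\<integral>y. (h y)\<^sup>2 \<partial>\<pi>) + 2 * s * (\<integral>p. h (fst p) * h (snd p) \<partial>joint 1)"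
      using i1 i2 i3 integral_joint_fst[OF L2_sq[OF h], of 1] integral_joint_snd[OF L2_sq[OF h], of 1] by (simp add: s)
    also have "\<dots> = 2 * moment_functional a ([:1, s:] * p\<^sup>2)"
      unfolding A B moment_functional_quadratic c_def[symmetric] d_def[symmetric]
      by (simp add: sum.distrib sum_distrib_left algebra_simps)
    finally show ?thesis by simp
  qed
  from this[of 1] this[of "-1"] show ?thesis unfolding moment_positive_def a by simp
qed

text \<open>This discharges the \<open>THE\<close> in the definition: existence comes from the
  moment problem, uniqueness from the fact that moments determine measures on [-1,1].\<close>

lemma spectral_measure:
  assumes f: "L2 f"
  shows "sets (spectral_measure Q \<pi> f) = sets borel" "finite_measure (spectral_measure Q \<pi> f)"
    "emeasure (spectral_measure Q \<pi> f) (- {-1..1}) = 0"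
    "acov f k = (\<integral>\<alpha>. \<alpha> ^ nat \<bar>k\<bar> \<partial>spectral_measure Q \<pi> f)"
proof -
  let ?P = "\<lambda>F. sets F = sets borel \<and> finite_measure F \<and>
      emeasure F (- {-1..1}) = 0 \<and> (\<forall>k. acov f k = (\<integral>\<alpha>. \<alpha> ^ nat \<bar>k\<bar> \<partial>F))"
  obtain F where F: "sets F = sets borel" "finite_measure F" "emeasure F (- {-1..1}) = 0"
    "\<And>k. acov f (int k) = (\<integral>x. x ^ k \<partial>F)"
    using hausdorff_moment[OF gamma_moment_positive[OF f]] by blast
  have "\<exists>!F. ?P F"
  proof (rule ex1I[of _ F])
    have "acov f k = (\<integral>x. x ^ nat \<bar>k\<bar> \<partial>F)" for k
      using F(4)[of "nat \<bar>k\<bar>"] gamma_abs[OF f f, of k] by simp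
    then show "?P F" using F(1-3) by simp
    fix G assume G: "?P G"
    have "(\<integral>x. x ^ k \<partial>G) = (\<integral>x. x ^ k \<partial>F)" for k
      using G F(4)[of k] by (metis abs_of_nat nat_int)
    then show "G = F" using G F by (intro moments_determine_measure) auto
  qed
  from theI'[OF this] have *: "?P (spectral_measure Q \<pi> f)" unfolding spectral_measure_def .
  then show "sets (spectral_measure Q \<pi> f) = sets borel" "finite_measure (spectral_measure Q \<pi> f)"
    "emeasure (spectral_measure Q \<pi> f) (- {-1..1}) = 0"
    "acov f k = (\<integral>\<alpha>. \<alpha> ^ nat \<bar>k\<bar> \<partial>spectral_measure Q \<pi> f)" by blast+
qed

text \<open>For b >= 0 this expresses that the spectral measure of \<open>f\<close> is carried by
  [-b,b]. Only even lags appear, because autocovariances are nonnegative there, and this makes the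
  property additive.\<close>

definition gap :: "real \<Rightarrow> ('a \<Rightarrow> real) \<Rightarrow> bool" where
  "gap b f \<longleftrightarrow> L2 f \<and> (\<exists>C. \<forall>k. acov f (int (2 * k)) \<le> C * b ^ (2 * k))"

lemma gap_L2: "gap b f \<Longrightarrow> L2 f" by (simp add: gap_def)

lemma gap_Minf:
  assumes f: "gap b f" and b: "0 \<le> b"
  shows "acov f \<in> Minf b"
proof -
  obtain C where C: "\<And>k. acov f (int (2 * k)) \<le> C * b ^ (2 * k)" using f by (auto simp: gap_def)
  note S = spectral_measure[OF gap_L2[OF f]]
  have "emeasure (spectral_measure Q \<pi> f) (- {-b..b}) = 0"
  proof (rule support_from_even_moments[OF S(1-3) b])
    fix k show "(\<integral>x. x ^ (2 * k) \<partial>spectral_measure Q \<pi> f) \<le> C * b ^ (2 * k)"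
      using C[of k] unfolding S(4)[of "int (2 * k)"] abs_of_nat nat_int .
  qed
  then show ?thesis unfolding Minf_def using S by blast
qed

text \<open>Positive variance gives the spectral measure positive mass, as
  \<open>Delta_support\<close> demands.\<close>

lemma Delta_gap:
  assumes f: "L2 f" and pos: "acov f 0 > 0" and \<delta>: "0 < \<delta>" "\<delta> \<le> Delta (spectral_measure Q \<pi> f)"
  shows "\<delta> \<le> 1" "gap (1 - \<delta>) f"
proof -
  note S = spectral_measure[OF f]
  have "space (spectral_measure Q \<pi> f) = UNIV" using sets_eq_imp_space_eq[OF S(1)] by simp
  then have p: "measure (spectral_measure Q \<pi> f) UNIV > 0"
    using pos S(4)[of 0] by simp
  note D = Delta_support[OF S(1-3) p \<delta>]
  show "\<delta> \<le> 1" by (rule D(1))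
  have "acov f \<in> Minf (1 - \<delta>)"
    unfolding Minf_def using S D(2) by blast
  from Minf_bound[OF this] D(1) \<delta>(1)
  have le: "\<bar>acov f k\<bar> \<le> acov f 0 * (1 - \<delta>) ^ nat \<bar>k\<bar>" for k by simp
  have "acov f (int (2 * k)) \<le> acov f 0 * (1 - \<delta>) ^ (2 * k)" for k
    using le[of "int (2 * k)"] unfolding abs_of_nat nat_int by linarith
  then show "gap (1 - \<delta>) f" using f by (auto simp: gap_def)
qed

lemma gap_mono:
  assumes "gap b f" "0 \<le> b" "b \<le> b'"
  shows "gap b' f"
proof -
  obtain C where C: "\<And>k. acov f (int (2 * k)) \<le> C * b ^ (2 * k)" using assms(1) by (auto simp: gap_def)
  \<comment> \<open>C may have either sign; its absolute value makes the bound monotone in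
    b.\<close>
  have "C * b ^ (2 * k) \<le> \<bar>C\<bar> * b' ^ (2 * k)" for k
    using assms(2,3) by (intro mult_mono power_mono) auto
  then show ?thesis using assms(1) C by (auto simp: gap_def intro!: exI[of _ "\<bar>C\<bar>"] intro: order_trans)
qed

lemma gap_cmult:
  assumes f: "gap b f"
  shows "gap b (\<lambda>x. c * f x)"
proof -
  obtain C where C: "\<And>k. acov f (int (2 * k)) \<le> C * b ^ (2 * k)" using assms(1) by (auto simp: gap_def)
  note l = gap_L2[OF f]
  have eq: "acov (\<lambda>x. c * f x) k = c * c * acov f k" for k
    using gamma_commute[OF l L2_cmult[OF l], of c k] by (simp add: gamma_cmult_left l L2_cmult)
  have "c * c * acov f (int (2 * k)) \<le> (c * c * C) * b ^ (2 * k)" for k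
    using mult_left_mono[OF C[of k], of "c * c"] by (simp add: mult.assoc)
  then show ?thesis unfolding gap_def eq using L2_cmult[OF l] by blast
qed

lemma gamma_even_nonneg: "L2 f \<Longrightarrow> 0 \<le> acov f (int (2 * k))"
  unfolding spectral_measure(4) abs_of_nat nat_int by simp

text \<open>Expand the quadratic form at f + c h and take c = 1 and c = -1.\<close>

lemma gamma_parallelogram:
  assumes f: "L2 f" and h: "L2 h"
  shows "acov (\<lambda>x. f x + h x) k + acov (\<lambda>x. f x - h x) k
    = 2 * acov f k + 2 * acov h k"
    "acov (\<lambda>x. f x + h x) k - acov (\<lambda>x. f x - h x) k
    = 4 * cov f h k"
proof -
  have exp: "acov (\<lambda>x. f x + c * h x) k
      = acov f k + 2 * c * cov f h k + c * c * acov h k" for c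
  proof -
    let ?s = "\<lambda>x. f x + c * h x"
    have s: "L2 ?s" by (intro L2_add L2_cmult f h)
    have "cov ?s ?s k = cov ?s f k + c * cov ?s h k"
      using gamma_add_left[OF f L2_cmult[OF h] s] gamma_commute[OF s f] gamma_commute[OF s h]
      by (simp add: gamma_cmult_left h s)
    also have "cov ?s f k = acov f k + c * cov f h k"
      using gamma_add_left[OF f L2_cmult[OF h] f] gamma_commute[OF f h]
      by (simp add: gamma_cmult_left h f)
    also have "cov ?s h k = cov f h k + c * acov h k"
      using gamma_add_left[OF f L2_cmult[OF h] h] by (simp add: gamma_cmult_left h f)
    finally show ?thesis by (simp add: algebra_simps)
  qed
  show "acov (\<lambda>x. f x + h x) k + acov (\<lambda>x. f x - h x) k
    = 2 * acov f k + 2 * acov h k"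
    "acov (\<lambda>x. f x + h x) k - acov (\<lambda>x. f x - h x) k
    = 4 * cov f h k"
    using exp[of 1] exp[of "-1"] by simp_all
qed

text \<open>At even lags the autocovariance of f - h is nonnegative and may be dropped from the
  parallelogram identity. Hence the gap of the components is inherited by every linear
  combination.\<close>

lemma gap_add:
  assumes f: "gap b f" and h: "gap b h"
  shows "gap b (\<lambda>x. f x + h x)"
proof -
  obtain C D where C: "\<And>k. acov f (int (2 * k)) \<le> C * b ^ (2 * k)"
    and D: "\<And>k. acov h (int (2 * k)) \<le> D * b ^ (2 * k)"
    using f h by (auto simp: gap_def)
  note l = gap_L2[OF f] gap_L2[OF h]
  have "acov (\<lambda>x. f x + h x) (int (2 * k)) \<le> (2 * C + 2 * D) * b ^ (2 * k)" for k
    using gamma_parallelogram(1)[OF l, of "int (2 * k)"] gamma_even_nonneg[OF L2_diff[OF l], of k] C[of k] D[of k]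
    by (simp add: algebra_simps)
  then show ?thesis unfolding gap_def using L2_add[OF l] by blast
qed

lemma gap_sum:
  assumes "finite I" "\<And>i. i \<in> I \<Longrightarrow> gap b (f i)"
  shows "gap b (\<lambda>x. \<Sum>i\<in>I. u i * f i x)"
  using assms
proof (induction I rule: finite_induct)
  case empty
  show ?case by (auto simp: gap_def gamma_def intro!: exI[of _ 0])
next
  case (insert i I)
  then show ?case by (simp add: gap_add gap_cmult)
qed

end

section \<open>Ergodic averages\<close>

text \<open>A single term is negligible in the limit. With its converse below it shows that
  convergence of averages is a shift-invariant event, and it restores time 0 to averages along a
  chain observed from time 1.\<close>

lemma tendsto_average_drop:
  fixes a :: "nat \<Rightarrow> real"
  assumes "(\<lambda>n. (\<Sum>t<n. a (Suc t)) / real n) \<longlonglongrightarrow> L"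
  shows "(\<lambda>n. (\<Sum>t<n. a t) / real n) \<longlonglongrightarrow> L"
proof (rule LIMSEQ_imp_Suc)
  have "(\<lambda>n. a 0 / real (Suc n) + (\<Sum>t<n. a (Suc t)) / real n * (real n / real (Suc n))) \<longlonglongrightarrow> 0 + L * 1"
  proof (intro tendsto_intros assms)
    show "(\<lambda>n. a 0 / real (Suc n)) \<longlonglongrightarrow> 0"
      using LIMSEQ_Suc[OF lim_const_over_n[of "a 0"]] .
    show "(\<lambda>n. real n / real (Suc n)) \<longlonglongrightarrow> 1" by (rule LIMSEQ_n_over_Suc_n)
  qed
  moreover have "a 0 / real (Suc n) + (\<Sum>t<n. a (Suc t)) / real n * (real n / real (Suc n)) = (\<Sum>t<Suc n. a t) / real (Suc n)" for n
    by (cases "n = 0") (simp_all add: sum.lessThan_Suc_shift add_divide_distrib del: sum.lessThan_Suc)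
  ultimately show "(\<lambda>n. (\<Sum>t<Suc n. a t) / real (Suc n)) \<longlonglongrightarrow> L" by simp
qed

lemma tendsto_average_Suc:
  fixes a :: "nat \<Rightarrow> real"
  assumes "(\<lambda>n. (\<Sum>t<n. a t) / real n) \<longlonglongrightarrow> L"
  shows "(\<lambda>n. (\<Sum>t<n. a (Suc t)) / real n) \<longlonglongrightarrow> L"
proof -
  have "(\<lambda>n. (\<Sum>t<Suc n. a t) / real (Suc n) * (1 + 1 / real n) - a 0 / real n) \<longlonglongrightarrow> L * (1 + 0) - 0"
    by (intro tendsto_intros LIMSEQ_Suc[OF assms] lim_const_over_n)
  moreover have "\<forall>\<^sub>F n in sequentially. (\<Sum>t<Suc n. a t) / real (Suc n) * (1 + 1 / real n) - a 0 / real n = (\<Sum>t<n. a (Suc t)) / real n"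
    using eventually_gt_at_top[of 0]
  proof eventually_elim
    case (elim n)
    have "(1 + 1 / real n) = real (Suc n) / real n" using elim by (simp add: field_simps)
    then have "(\<Sum>t<Suc n. a t) / real (Suc n) * (1 + 1 / real n) = (\<Sum>t<Suc n. a t) / real n"
      by (simp del: sum.lessThan_Suc)
    then show ?case by (simp add: sum.lessThan_Suc_shift add_divide_distrib del: sum.lessThan_Suc)
  qed
  ultimately show ?thesis by (simp add: filterlim_cong)
qed

locale ergodic_system = prob_space P for P :: "'b measure" +
  fixes T :: "'b \<Rightarrow> 'b"
  assumes T_measurable [measurable]: "T \<in> P \<rightarrow>\<^sub>M P"
    and T_preserves: "distr P P T = P"
    and ergodic: "\<And>E. E \<in> sets P \<Longrightarrow> T -` E \<inter> space P = E \<Longrightarrow> prob E = 0 \<or> prob E = 1"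
begin

definition S :: "('b \<Rightarrow> real) \<Rightarrow> nat \<Rightarrow> 'b \<Rightarrow> real" where
  "S f n \<omega> = (\<Sum>i<n. f ((T ^^ i) \<omega>))"

lemma T_pow_measurable [measurable]: "(T ^^ i) \<in> P \<rightarrow>\<^sub>M P"
  by (induction i) (auto intro: measurable_comp)

lemma S_measurable [measurable]: "f \<in> borel_measurable P \<Longrightarrow> S f n \<in> borel_measurable P"
  unfolding S_def by (intro borel_measurable_sum measurable_compose[OF T_pow_measurable])

lemma S_0 [simp]: "S f 0 \<omega> = 0" by (simp add: S_def)

lemma S_Suc: "S f (Suc n) \<omega> = f \<omega> + S f n (T \<omega>)"
  by (simp add: S_def sum.lessThan_Suc_shift funpow_Suc_right del: sum.lessThan_Suc funpow.simps)

text \<open>The maximum of the partial sums \<open>S f m\<close> over m <= n, the empty sum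
  included. The recursion through T is the form in which Garsia's argument uses it.\<close>

fun F :: "('b \<Rightarrow> real) \<Rightarrow> nat \<Rightarrow> 'b \<Rightarrow> real" where
  "F f 0 \<omega> = 0"
| "F f (Suc n) \<omega> = max 0 (f \<omega> + F f n (T \<omega>))"

lemma F_nonneg: "0 \<le> F f n \<omega>" by (cases n) auto

lemma F_measurable [measurable]: "f \<in> borel_measurable P \<Longrightarrow> F f n \<in> borel_measurable P"
proof (induction n)
  case (Suc n)
  have [measurable]: "f \<in> borel_measurable P" "F f n \<in> borel_measurable P" using Suc by auto
  have "(\<lambda>\<omega>. max 0 (f \<omega> + F f n (T \<omega>))) \<in> borel_measurable P" by measurable
  then show ?case by (simp add: fun_eq_iff cong: measurable_cong)
qed (simp add: fun_eq_iff cong: measurable_cong)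

lemma integrable_T: "integrable P f \<Longrightarrow> integrable P (\<lambda>\<omega>. f (T \<omega>))"
  and integral_T: "integrable P f \<Longrightarrow> (\<integral>\<omega>. f (T \<omega>) \<partial>P) = (\<integral>\<omega>. f \<omega> \<partial>P)" for f :: "'b \<Rightarrow> real"
  using integrable_distr_eq[of T P P f] integral_distr[of T P P f] T_preserves by auto

lemma F_integrable: "integrable P f \<Longrightarrow> integrable P (F f n)"
proof (induction n)
  case (Suc n)
  have "integrable P (\<lambda>\<omega>. max 0 (f \<omega> + F f n (T \<omega>)))"
    using Suc integrable_T[of "F f n"] by (intro integrable_max) auto
  then show ?case by (simp add: fun_eq_iff cong: Bochner_Integration.integrable_cong)
qed (simp add: fun_eq_iff cong: Bochner_Integration.integrable_cong)

lemma S_le_F: "S f n \<omega> \<le> F f n \<omega>"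
  by (induction n arbitrary: \<omega>) (auto simp: S_Suc intro: max.coboundedI2)

lemma F_mono: "F f n \<omega> \<le> F f (Suc n) \<omega>"
proof (induction n arbitrary: \<omega>)
  case (Suc n)
  have "max 0 (f \<omega> + F f n (T \<omega>)) \<le> max 0 (f \<omega> + F f (Suc n) (T \<omega>))"
    by (intro max.mono add_left_mono Suc order_refl)
  then show ?case by simp
qed simp

text \<open>Garsia's argument: on the invariant set where the partial sums are unbounded,
  \<open>F f (Suc n) - F f n \<circ> T = max (- F f n \<circ> T) f\<close> decreases to \<open>f\<close>, while its integral is nonnegative.\<close>

lemma partial_sums_bounded_above:
  assumes f: "integrable P f" and neg: "(\<integral>\<omega>. f \<omega> \<partial>P) < 0"
  shows "AE \<omega> in P. \<exists>C::nat. \<forall>n. S f n \<omega> \<le> real C"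
proof -
  have [measurable]: "f \<in> borel_measurable P" using f by auto
  \<comment> \<open>The bounds range over natural numbers so that E is a countable combination;
    \<open>bd\<close> passes to real bounds, which absorb the shift by
    \<open>f \<omega>\<close>.\<close>
  define E where "E = {\<omega> \<in> space P. \<forall>C::nat. \<exists>n. S f n \<omega> > real C}"
  have E[measurable]: "E \<in> sets P" unfolding E_def by measurable
  have bd: "(\<forall>C::nat. \<exists>n. g n > real C) \<longleftrightarrow> (\<forall>C::real. \<exists>n. g n > C)" for g :: "nat \<Rightarrow> real"
    by (meson le_less_trans real_arch_simple)
  have shift: "(\<forall>C::real. \<exists>n. S f n (T \<omega>) > C) \<longleftrightarrow> (\<forall>C::real. \<exists>n. S f n \<omega> > C)" for \<omega>
  proof safe
    fix C :: real assume *: "\<forall>C. \<exists>n. S f n (T \<omega>) > C"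
    obtain n where "S f n (T \<omega>) > C - f \<omega>" using * by blast
    then have "S f (Suc n) \<omega> > C" by (simp add: S_Suc)
    then show "\<exists>n. S f n \<omega> > C" by blast
  next
    fix C :: real assume *: "\<forall>C. \<exists>n. S f n \<omega> > C"
    obtain n where n: "S f n \<omega> > max 0 (C + f \<omega>)" using * by blast
    then obtain m where "n = Suc m" by (cases n) auto
    then have "S f m (T \<omega>) > C" using n by (simp add: S_Suc)
    then show "\<exists>n. S f n (T \<omega>) > C" by blast
  qed
  have "T -` E \<inter> space P = E"
    using measurable_space[OF T_measurable] unfolding E_def bd by (auto simp: shift)
  then consider "prob E = 0" | "prob E = 1" using ergodic[OF E] by blast
  then show ?thesis
  proof cases
    case 1
    then have "AE \<omega> in P. \<omega> \<notin> E" using E by (subst AE_iff_measurable[OF _ refl]) (auto simp: emeasure_eq_measure Collect_conj_eq Int_absorb1[OF sets.sets_into_space])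
    then show ?thesis by (rule AE_mp) (auto simp: E_def not_less)
  next
    case 2
    then have "AE \<omega> in P. \<omega> \<in> E" using prob_eq_1[OF E] by simp
    then have lim: "AE \<omega> in P. (\<lambda>n. max (- F f n (T \<omega>)) (f \<omega>)) \<longlonglongrightarrow> f \<omega>"
    proof (rule AE_mp, intro AE_I2 impI)
      fix \<omega> assume "\<omega> \<in> space P" "\<omega> \<in> E"
      then have ub: "\<forall>C::real. \<exists>n. S f n (T \<omega>) > C" using shift[of \<omega>] bd[of "\<lambda>n. S f n \<omega>"] by (simp add: E_def)
      obtain N where N: "S f N (T \<omega>) > - f \<omega>" using ub by blast
      have "max (- F f n (T \<omega>)) (f \<omega>) = f \<omega>" if "n \<ge> N" for n
      proof -
        have "F f N (T \<omega>) \<le> F f n (T \<omega>)" using that by (rule lift_Suc_mono_le[of "\<lambda>n. F f n (T \<omega>)", OF F_mono])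
        then show ?thesis using N S_le_F[of f N "T \<omega>"] by simp
      qed
      then show "(\<lambda>n. max (- F f n (T \<omega>)) (f \<omega>)) \<longlonglongrightarrow> f \<omega>"
        by (intro tendsto_eventually) (auto simp: eventually_sequentially)
    qed
    \<comment> \<open>Since -F <= 0, the maximum lies between f and max 0 f, so |f|
      dominates.\<close>
    have "(\<lambda>n. \<integral>\<omega>. max (- F f n (T \<omega>)) (f \<omega>) \<partial>P) \<longlonglongrightarrow> (\<integral>\<omega>. f \<omega> \<partial>P)"
    proof (rule integral_dominated_convergence[where w="\<lambda>\<omega>. \<bar>f \<omega>\<bar>"])
      show "AE \<omega> in P. norm (max (- F f n (T \<omega>)) (f \<omega>)) \<le> \<bar>f \<omega>\<bar>" for n
      proof (rule AE_I2)
        fix \<omega> show "norm (max (- F f n (T \<omega>)) (f \<omega>)) \<le> \<bar>f \<omega>\<bar>"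
          using F_nonneg[of f n "T \<omega>"] by (auto simp: max_def)
      qed
    qed (use f lim in auto)
    \<comment> \<open>F increases with n, and T preserves the measure, so F composed with T has the
      same integral as F.\<close>
    moreover have "0 \<le> (\<integral>\<omega>. max (- F f n (T \<omega>)) (f \<omega>) \<partial>P)" for n
    proof -
      have "0 \<le> (\<integral>\<omega>. F f (Suc n) \<omega> \<partial>P) - (\<integral>\<omega>. F f n \<omega> \<partial>P)"
        using integral_mono[OF F_integrable[OF f, of n] F_integrable[OF f, of "Suc n"] F_mono] by simp
      also have "\<dots> = (\<integral>\<omega>. F f (Suc n) \<omega> \<partial>P) - (\<integral>\<omega>. F f n (T \<omega>) \<partial>P)"
        by (simp only: integral_T[OF F_integrable[OF f]])
      also have "\<dots> = (\<integral>\<omega>. F f (Suc n) \<omega> - F f n (T \<omega>) \<partial>P)"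
        by (rule Bochner_Integration.integral_diff[symmetric, OF F_integrable[OF f] integrable_T[OF F_integrable[OF f]]])
      also have "\<dots> = (\<integral>\<omega>. max (- F f n (T \<omega>)) (f \<omega>) \<partial>P)"
        by (intro Bochner_Integration.integral_cong) (auto simp: max_def)
      finally show ?thesis .
    qed
    ultimately have "0 \<le> (\<integral>\<omega>. f \<omega> \<partial>P)" by (intro LIMSEQ_le_const) auto
    then show ?thesis using neg by simp
  qed
qed

lemma S_add_const: "S (\<lambda>\<omega>. f \<omega> + c) n \<omega> = S f n \<omega> + real n * c"
  by (simp add: S_def sum.distrib)

text \<open>Subtracting the mean and e/2 makes the integral negative, so the partial sums stay below
  some C, and C/n is eventually below e/2.\<close>

lemma average_eventually_le:
  assumes f: "integrable P f" and e: "e > 0"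
  shows "AE \<omega> in P. \<forall>\<^sub>F n in sequentially. S f n \<omega> / real n \<le> (\<integral>\<omega>. f \<omega> \<partial>P) + e"
proof -
  define m where "m = (\<integral>\<omega>. f \<omega> \<partial>P)"
  have int: "integrable P (\<lambda>\<omega>. f \<omega> + (- m - e / 2))" using f by simp
  have "(\<integral>\<omega>. f \<omega> + (- m - e / 2) \<partial>P) < 0"
    using f e by (simp add: prob_space m_def)
  from partial_sums_bounded_above[OF int this] show ?thesis
  proof eventually_elim
    case (elim \<omega>)
    then obtain C :: nat where C: "\<And>n. S f n \<omega> + real n * (- m - e / 2) \<le> real C"
      by (auto simp: S_add_const)
    obtain N :: nat where N: "real N > 2 * real C / e" using reals_Archimedean2 by blast
    show ?case
    proof (rule eventually_sequentiallyI[of "Suc N"])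
      fix n assume n: "Suc N \<le> n"
      then have n0: "real n > 0" and "real n > 2 * real C / e" using N by auto
      then have "real C \<le> real n * (e / 2)" using e by (simp add: field_simps)
      then have "S f n \<omega> \<le> real n * (m + e)" using C[of n] by (simp add: algebra_simps)
      then show "S f n \<omega> / real n \<le> (\<integral>\<omega>. f \<omega> \<partial>P) + e" using n0 by (simp add: m_def divide_le_eq mult.commute)
    qed
  qed
qed

text \<open>The one-sided bound is used for f and for -f, at the countably many tolerances
  1/(j+1).\<close>

theorem birkhoff:
  fixes f :: "'b \<Rightarrow> real"
  assumes f: "integrable P f"
  shows "AE \<omega> in P. (\<lambda>n. (\<Sum>i<n. f ((T ^^ i) \<omega>)) / real n) \<longlonglongrightarrow> (\<integral>\<omega>. f \<omega> \<partial>P)"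
proof -
  define m where "m = (\<integral>\<omega>. f \<omega> \<partial>P)"
  have neg: "S (\<lambda>\<omega>. - f \<omega>) n \<omega> = - S f n \<omega>" for n \<omega> by (simp add: S_def sum_negf)
  have "AE \<omega> in P. \<forall>j::nat. (\<forall>\<^sub>F n in sequentially. S f n \<omega> / real n \<le> m + 1 / real (Suc j))
      \<and> (\<forall>\<^sub>F n in sequentially. S (\<lambda>\<omega>. - f \<omega>) n \<omega> / real n \<le> - m + 1 / real (Suc j))"
  proof (subst AE_all_countable, intro allI AE_conjI)
    fix j :: nat
    have j: "1 / real (Suc j) > 0" by simp
    show "AE \<omega> in P. \<forall>\<^sub>F n in sequentially. S f n \<omega> / real n \<le> m + 1 / real (Suc j)"
      using average_eventually_le[OF f j] by (simp add: m_def)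
    show "AE \<omega> in P. \<forall>\<^sub>F n in sequentially. S (\<lambda>\<omega>. - f \<omega>) n \<omega> / real n \<le> - m + 1 / real (Suc j)"
      using average_eventually_le[of "\<lambda>\<omega>. - f \<omega>", OF _ j] f by (simp add: m_def)
  qed
  then have "AE \<omega> in P. (\<lambda>n. S f n \<omega> / real n) \<longlonglongrightarrow> m"
  proof eventually_elim
    case (elim \<omega>)
    show ?case
    proof (rule metric_LIMSEQ_I)
      fix e :: real assume "e > 0"
      then obtain j where j: "1 / real (Suc j) < e" using nat_approx_posE by blast
      have "\<forall>\<^sub>F n in sequentially. dist (S f n \<omega> / real n) m < e"
        using elim[rule_format, of j, THEN conjunct1] elim[rule_format, of j, THEN conjunct2]
        by eventually_elim (use j in \<open>auto simp: neg dist_real_def abs_less_iff\<close>)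
      then show "\<exists>N. \<forall>n\<ge>N. dist (S f n \<omega> / real n) m < e" by (simp add: eventually_sequentially)
    qed
  qed
  then show ?thesis by (simp add: S_def m_def)
qed

end

section \<open>Path measures of the Markov chain\<close>

abbreviation seq_space :: "(nat \<Rightarrow> 'a::topological_space) measure" where
  "seq_space \<equiv> \<Pi>\<^sub>M i\<in>UNIV. borel"

lemma space_seq_space [simp]: "space (seq_space :: (nat \<Rightarrow> 'a::topological_space) measure) = UNIV"
  by (simp add: space_PiM)

abbreviation cylinder :: "(nat \<Rightarrow> 'a set) \<Rightarrow> nat \<Rightarrow> (nat \<Rightarrow> 'a) set" where
  "cylinder A l \<equiv> {\<omega>. \<forall>i<l. \<omega> i \<in> A i}"

lemma cylinder_sets [measurable]:
  "(\<And>i. A i \<in> sets borel) \<Longrightarrow> (cylinder A l) \<in> sets (seq_space :: (nat \<Rightarrow> 'a::topological_space) measure)"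
proof -
  assume [measurable]: "\<And>i. A i \<in> sets borel"
  have "{\<omega> \<in> space seq_space. \<forall>i<l. \<omega> i \<in> A i} \<in> sets (seq_space :: (nat \<Rightarrow> 'a) measure)"
    by measurable
  then show ?thesis by simp
qed

lemma prod_emb_eq_cylinder:
  fixes J :: "nat set"
  assumes "finite J" "\<And>i. i \<in> J \<Longrightarrow> A i \<in> sets (borel :: 'a::topological_space measure)"
  shows "\<exists>A' l. (\<forall>i. A' i \<in> sets borel) \<and> prod_emb UNIV (\<lambda>_. borel) J (Pi\<^sub>E J A) = {\<omega>. \<forall>i<l. \<omega> i \<in> A' i}"
proof -
  obtain l where l: "\<forall>j\<in>J. j < l" using finite_nat_set_iff_bounded[of J] assms(1) by auto
  have "prod_emb UNIV (\<lambda>_. borel) J (Pi\<^sub>E J A) = {\<omega>. \<forall>i<l. \<omega> i \<in> (if i \<in> J then A i else UNIV)}"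
  proof (intro set_eqI)
    fix \<omega> :: "nat \<Rightarrow> 'a"
    have "\<omega> \<in> prod_emb UNIV (\<lambda>_. borel) J (Pi\<^sub>E J A) \<longleftrightarrow> (\<forall>i\<in>J. \<omega> i \<in> A i)"
      by (simp add: prod_emb_iff PiE_iff)
    also have "\<dots> \<longleftrightarrow> (\<forall>i<l. \<omega> i \<in> (if i \<in> J then A i else UNIV))"
      using l by (metis UNIV_I)
    finally show "\<omega> \<in> prod_emb UNIV (\<lambda>_. borel) J (Pi\<^sub>E J A) \<longleftrightarrow> \<omega> \<in> {\<omega>. \<forall>i<l. \<omega> i \<in> (if i \<in> J then A i else UNIV)}"
      by simp
  qed
  moreover have "(if i \<in> J then A i else UNIV) \<in> sets borel" for i using assms(2) by auto
  ultimately show ?thesis by (intro exI[of _ "\<lambda>i. if i \<in> J then A i else UNIV"] exI[of _ l]) simp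
qed

lemma measure_eqI_cylinders:
  fixes \<mu> \<nu> :: "(nat \<Rightarrow> 'a::topological_space) measure"
  assumes sets: "sets \<mu> = sets seq_space" "sets \<nu> = sets seq_space" and fin: "finite_measure \<mu>"
    and eq: "\<And>A l. (\<And>i. A i \<in> sets borel) \<Longrightarrow> emeasure \<mu> (cylinder A l) = emeasure \<nu> (cylinder A l)"
  shows "\<mu> = \<nu>"
proof (rule measure_eqI_PiM_infinite[OF sets _ fin])
  fix A and J :: "nat set" assume "finite J" "\<And>i. i \<in> J \<Longrightarrow> A i \<in> sets (borel :: 'a measure)"
  then obtain A' l where "\<And>i. A' i \<in> sets borel" "prod_emb UNIV (\<lambda>_. borel) J (Pi\<^sub>E J A) = {\<omega>. \<forall>i<l. \<omega> i \<in> A' i}"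
    using prod_emb_eq_cylinder[of J A] by blast
  then show "emeasure \<mu> (prod_emb UNIV (\<lambda>_. borel) J (Pi\<^sub>E J A)) = emeasure \<nu> (prod_emb UNIV (\<lambda>_. borel) J (Pi\<^sub>E J A))"
    using eq by simp
qed

context markov_kernel
begin

lemma cyl_measurable_bounds:
  "(\<And>B. B \<in> set Bs \<Longrightarrow> B \<in> sets borel) \<Longrightarrow> cyl Q Bs \<in> borel_measurable borel \<and> (\<forall>y. 0 \<le> cyl Q Bs y \<and> cyl Q Bs y \<le> 1)"
proof (induction Bs)
  case Nil
  have "cyl Q [] = (\<lambda>_. 1)" by (simp add: fun_eq_iff)
  then show ?case by simp
next
  case (Cons B Bs)
  then have [measurable]: "cyl Q Bs \<in> borel_measurable borel" "B \<in> sets borel" and bd: "\<And>y. 0 \<le> cyl Q Bs y" "\<And>y. cyl Q Bs y \<le> 1"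
    by auto
  have eq: "cyl Q (B # Bs) = (\<lambda>y. \<integral>z. indicator B z * cyl Q Bs z \<partial>Q y)" by (simp add: fun_eq_iff)
  have "cyl Q (B # Bs) \<in> borel_measurable borel"
    unfolding eq by (rule measurable_compose[OF Q_measurable]) measurable
  moreover have "0 \<le> cyl Q (B # Bs) y \<and> cyl Q (B # Bs) y \<le> 1" for y
  proof -
    interpret Qy: prob_space "Q y" by (rule prob_space_Q)
    have "integrable (Q y) (\<lambda>z. indicator B z * cyl Q Bs z)"
      by (rule Qy.integrable_const_bound[of _ 1]) (auto simp: indicator_def bd)
    then have "(\<integral>z. indicator B z * cyl Q Bs z \<partial>Q y) \<le> (\<integral>z. 1 \<partial>Q y)"
      by (intro integral_mono) (auto simp: indicator_def bd)
    then show ?thesis using Qy.prob_space by (auto simp: bd)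
  qed
  ultimately show ?case by blast
qed

lemma ennreal_cyl_Cons:
  assumes [measurable]: "B \<in> sets borel" and Bs: "\<And>B. B \<in> set Bs \<Longrightarrow> B \<in> sets borel"
  shows "ennreal (cyl Q (B # Bs) y) = (\<integral>\<^sup>+z. indicator B z * ennreal (cyl Q Bs z) \<partial>Q y)"
proof -
  interpret Qy: prob_space "Q y" by (rule prob_space_Q)
  have [measurable]: "cyl Q Bs \<in> borel_measurable borel" and bd: "\<And>y. 0 \<le> cyl Q Bs y" "\<And>y. cyl Q Bs y \<le> 1"
    using cyl_measurable_bounds[OF Bs] by auto
  have "integrable (Q y) (\<lambda>z. indicator B z * cyl Q Bs z)"
    by (rule Qy.integrable_const_bound[of _ 1]) (auto simp: indicator_def bd)
  then have "ennreal (cyl Q (B # Bs) y) = (\<integral>\<^sup>+z. ennreal (indicator B z * cyl Q Bs z) \<partial>Q y)"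
    by (simp add: nn_integral_eq_integral bd)
  also have "\<dots> = (\<integral>\<^sup>+z. indicator B z * ennreal (cyl Q Bs z) \<partial>Q y)"
    by (intro nn_integral_cong) (auto simp: indicator_def)
  finally show ?thesis .
qed

text \<open>Ionescu-Tulcea applied to the kernel that sees only the most recent state. The
  existential form keeps the interpretation, which depends on y, inside the proof.\<close>

lemma path_measure_exists:
  "\<exists>\<mu>. prob_space \<mu> \<and> sets \<mu> = sets seq_space \<and>
     (\<forall>A l. (\<forall>i. A i \<in> sets borel) \<longrightarrow> emeasure \<mu> (cylinder A l) = ennreal (cyl Q (map A [0..<l]) y))"
proof -
  \<comment> \<open>The state from which step n departs: the starting point y for n = 0, otherwise
    coordinate n - 1.\<close>
  define last where "last n \<omega> = (if n = 0 then y else \<omega> (n - 1))" for n :: nat and \<omega> :: "nat \<Rightarrow> 'a"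
  have last_upd: "last (Suc n) (fun_upd \<omega> n z) = z" for n \<omega> z by (simp add: last_def)
  interpret IT: Ionescu_Tulcea "\<lambda>n \<omega>. Q (last n \<omega>)" "\<lambda>_. borel"
  proof (rule Ionescu_Tulcea.intro)
    fix n
    have "(\<lambda>\<omega>. last n \<omega>) \<in> PiM {0..<n} (\<lambda>_. borel) \<rightarrow>\<^sub>M borel"
      unfolding last_def by (cases "n = 0") (auto intro!: measurable_component_singleton)
    then show "(\<lambda>\<omega>. Q (last n \<omega>)) \<in> PiM {0..<n} (\<lambda>_. borel) \<rightarrow>\<^sub>M subprob_algebra borel"
      by (rule measurable_compose[OF _ Q_measurable])
  qed (rule prob_space_Q)
  \<comment> \<open>\<open>IT.C n l \<omega>\<close> runs l further steps from a prefix of length n.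
    The induction on l peels off the step at n, as \<open>cyl\<close> does, so the prefix has to be
    arbitrary.\<close>
  have C: "emeasure (IT.C n l \<omega>) {\<omega>' \<in> space (PiM {0..<n+l} (\<lambda>_. borel)). \<forall>i<n+l. \<omega>' i \<in> A i}
      = indicator (cylinder A n) \<omega> * ennreal (cyl Q (map A [n..<n+l]) (last n \<omega>))"
    if A: "\<And>i. A i \<in> sets borel" and \<omega>: "\<omega> \<in> space (PiM {0..<n} (\<lambda>_. borel))" for n l A \<omega>
    using \<omega>
  proof (induction l arbitrary: n \<omega>)
    case 0
    have [measurable]: "\<And>i. A i \<in> sets borel" by (rule A)
    have "{\<omega>' \<in> space (PiM {0..<n} (\<lambda>_. borel)). \<forall>i<n. \<omega>' i \<in> A i} \<in> sets (PiM {0..<n} (\<lambda>_. borel))"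
      by measurable
    then show ?case using 0 by (auto simp: indicator_def)
  next
    case (Suc l)
    let ?X = "{\<omega>' \<in> space (PiM {0..<n+Suc l} (\<lambda>_. borel)). \<forall>i<n+Suc l. \<omega>' i \<in> A i}"
    have [measurable]: "\<And>i. A i \<in> sets borel" by (rule A)
    have X: "?X \<in> sets (PiM {0..<n+Suc l} (\<lambda>_. borel))" by measurable
    have C1: "IT.C n 1 \<omega> = IT.eP n \<omega>"
      using bind_return[OF IT.measurable_eP[of n] Suc.prems] by simp
    have "IT.C n (Suc l) \<omega> = IT.C n 1 \<omega> \<bind> IT.C (n + 1) l"
      using IT.split_C[OF Suc.prems, of 1 l] by simp
    also have "\<dots> = IT.eP n \<omega> \<bind> IT.C (Suc n) l" by (simp only: C1) simp
    finally have "emeasure (IT.C n (Suc l) \<omega>) ?X = emeasure (IT.eP n \<omega> \<bind> IT.C (Suc n) l) ?X" by simp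
    also have "\<dots> = (\<integral>\<^sup>+\<omega>'. emeasure (IT.C (Suc n) l \<omega>') ?X \<partial>IT.eP n \<omega>)"
    proof (rule emeasure_bind)
      show "space (IT.eP n \<omega>) \<noteq> {}" using IT.prob_space_eP[OF Suc.prems] prob_space.not_empty by blast
      show "IT.C (Suc n) l \<in> IT.eP n \<omega> \<rightarrow>\<^sub>M subprob_algebra (PiM {0..<n+Suc l} (\<lambda>_. borel))"
        by (subst measurable_cong_sets[OF IT.sets_eP[OF Suc.prems] refl]) (use IT.measurable_C[of "Suc n" l] in simp)
    qed (rule X)
    also have "\<dots> = (\<integral>\<^sup>+z. emeasure (IT.C (Suc n) l (fun_upd \<omega> n z)) ?X \<partial>Q (last n \<omega>))"
    proof (rule IT.nn_integral_eP[OF Suc.prems])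
      show "(\<lambda>x. emeasure (IT.C (Suc n) l x) ?X) \<in> borel_measurable (PiM {0..<Suc n} (\<lambda>_. borel))"
        using X by (intro measurable_compose[OF IT.measurable_C]) simp
    qed
    also have "\<dots> = (\<integral>\<^sup>+z. indicator (cylinder A n) \<omega> * (indicator (A n) z * ennreal (cyl Q (map A [Suc n..<Suc n + l]) z)) \<partial>Q (last n \<omega>))"
    proof (rule nn_integral_cong)
      fix z
      have sp: "fun_upd \<omega> n z \<in> space (PiM {0..<Suc n} (\<lambda>_. borel))"
        using Suc.prems by (auto simp: space_PiM PiE_iff extensional_def)
      have "emeasure (IT.C (Suc n) l (fun_upd \<omega> n z)) ?X = indicator (cylinder A (Suc n)) (fun_upd \<omega> n z) *
          ennreal (cyl Q (map A [Suc n..<Suc n + l]) z)"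
        using Suc.IH[OF sp] by (simp add: last_upd del: upt_Suc fun_upd_apply)
      also have "indicator (cylinder A (Suc n)) (fun_upd \<omega> n z) = (indicator (cylinder A n) \<omega> * indicator (A n) z :: ennreal)"
        by (auto simp: indicator_def less_Suc_eq)
      finally show "emeasure (IT.C (Suc n) l (fun_upd \<omega> n z)) ?X = indicator (cylinder A n) \<omega> * (indicator (A n) z * ennreal (cyl Q (map A [Suc n..<Suc n + l]) z))"
        by (simp only: mult.assoc)
    qed
    also have "\<dots> = indicator (cylinder A n) \<omega> * ennreal (cyl Q (A n # map A [Suc n..<Suc n + l]) (last n \<omega>))"
    proof -
      define L where "L = map A [Suc n..<Suc n + l]"
      have L: "B \<in> sets borel" if "B \<in> set L" for B using that A by (auto simp: L_def)
      have [measurable]: "cyl Q L \<in> borel_measurable borel"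
        using cyl_measurable_bounds[of L] L by blast
      have "ennreal (cyl Q (A n # L) (last n \<omega>)) = (\<integral>\<^sup>+z. indicator (A n) z * ennreal (cyl Q L z) \<partial>Q (last n \<omega>))"
        by (rule ennreal_cyl_Cons[OF A]) (rule L)
      moreover have "(\<lambda>z. indicator (A n) z * ennreal (cyl Q L z)) \<in> borel_measurable (Q (last n \<omega>))"
        by (subst measurable_cong_sets[OF sets_Q refl]) measurable
      ultimately show ?thesis unfolding L_def[symmetric] by (simp only: nn_integral_cmult)
    qed
    also have "A n # map A [Suc n..<Suc n + l] = map A [n..<n + Suc l]"
      by (simp add: upt_conv_Cons del: upt_Suc)
    finally show ?case .
  qed
  have "emeasure IT.PF.lim (cylinder A l) = ennreal (cyl Q (map A [0..<l]) y)"
    if A: "\<And>i. A i \<in> sets borel" for A l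
  proof -
    have [measurable]: "\<And>i. A i \<in> sets borel" by (rule A)
    let ?X = "{\<omega>' \<in> space (PiM {0..<l} (\<lambda>_. borel)). \<forall>i<l. \<omega>' i \<in> A i}"
    have X: "?X \<in> sets (PiM {0..<l} (\<lambda>_. borel))" by measurable
    have "prod_emb UNIV (\<lambda>_. borel) {0..<l} ?X = cylinder A l"
      by (auto simp: prod_emb_def space_PiM PiE_iff)
    then have "emeasure IT.PF.lim (cylinder A l) = emeasure (IT.CI {0..<l}) ?X"
      using IT.lim[of "{0..<l}" ?X] X by simp
    also have "\<dots> = emeasure (IT.C 0 l (\<lambda>_. undefined)) (prod_emb {0..<l} (\<lambda>_. borel) {0..<l} ?X)"
      by (rule IT.emeasure_CI) (use X in auto)
    also have "prod_emb {0..<l} (\<lambda>_. borel) {0..<l} ?X = ?X"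
      using X by (intro prod_emb_id) (auto simp: space_PiM)
    also have "emeasure (IT.C 0 l (\<lambda>_. undefined)) ?X = ennreal (cyl Q (map A [0..<l]) y)"
      using C[OF A, of "\<lambda>_. undefined" 0 l] by (simp add: space_PiM last_def)
    finally show ?thesis .
  qed
  moreover have "prob_space IT.PF.lim"
  proof (rule prob_spaceI)
    have "space IT.PF.lim = UNIV" using sets_eq_imp_space_eq[OF IT.PF.sets_lim] by (simp add: space_PiM)
    then show "emeasure IT.PF.lim (space IT.PF.lim) = 1" using calculation[of "\<lambda>_. UNIV" 0] by simp
  qed
  ultimately show ?thesis using IT.PF.sets_lim by blast
qed

text \<open>The law of (X_1, X_2, ...) given X_0 = y: coordinate i of a path is the state at time i
  + 1.\<close>

definition path :: "'a \<Rightarrow> (nat \<Rightarrow> 'a) measure" where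
  "path y = (SOME \<mu>. prob_space \<mu> \<and> sets \<mu> = sets seq_space \<and>
     (\<forall>A l. (\<forall>i. A i \<in> sets borel) \<longrightarrow> emeasure \<mu> (cylinder A l) = ennreal (cyl Q (map A [0..<l]) y)))"

lemma prob_space_path: "prob_space (path y)"
  and sets_path [simp, measurable_cong]: "sets (path y) = sets seq_space"
  and emeasure_path_cylinder: "(\<And>i. A i \<in> sets borel) \<Longrightarrow> emeasure (path y) (cylinder A l) = ennreal (cyl Q (map A [0..<l]) y)"
  using someI_ex[OF path_measure_exists[of y]] unfolding path_def by auto

lemma space_path [simp]: "space (path y) = UNIV"
  using sets_eq_imp_space_eq[OF sets_path] by simp

text \<open>It suffices to test cylinders, whose probabilities \<open>cyl\<close> are measurable in
  the starting state.\<close>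

lemma path_measurable [measurable]: "path \<in> borel \<rightarrow>\<^sub>M subprob_algebra seq_space"
proof (rule measurable_prob_algebraD, rule measurable_prob_algebra_generated[OF sets_PiM Int_stable_prod_algebra prod_algebra_sets_into_space])
  fix B assume "B \<in> prod_algebra UNIV (\<lambda>_::nat. borel :: 'a measure)"
  then obtain J E where B: "B = prod_emb UNIV (\<lambda>_. borel) J (Pi\<^sub>E J E)" and J: "finite J" "\<And>i. i \<in> J \<Longrightarrow> E i \<in> sets (borel :: 'a measure)"
    by (rule prod_algebraE) blast
  obtain A l where A: "\<And>i. A i \<in> sets borel" and "prod_emb UNIV (\<lambda>_. borel) J (Pi\<^sub>E J E) = cylinder A l"
    using prod_emb_eq_cylinder[of J E] J by blast
  with B have "(\<lambda>a. emeasure (path a) B) = (\<lambda>a. ennreal (cyl Q (map A [0..<l]) a))"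
    by (simp add: emeasure_path_cylinder)
  moreover have "cyl Q (map A [0..<l]) \<in> borel_measurable borel"
  proof -
    have "C \<in> sets borel" if "C \<in> set (map A [0..<l])" for C using that A by auto
    then show ?thesis using cyl_measurable_bounds by blast
  qed
  ultimately show "(\<lambda>a. emeasure (path a) B) \<in> borel_measurable borel" by simp
qed (auto simp: prob_space_path)

lemma case_nat_kernel [measurable]:
  "(\<lambda>z. distr (path z) seq_space (case_nat z)) \<in> borel \<rightarrow>\<^sub>M subprob_algebra seq_space"
  by (rule measurable_distr2[OF _ path_measurable]) measurable

text \<open>First-step decomposition: X_1 = z is drawn from Q y and put in front of a path started
  at z.\<close>

lemma path_unfold: "path y = Q y \<bind> (\<lambda>z. distr (path z) seq_space (case_nat z))"
proof (rule measure_eqI_cylinders)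
  show "finite_measure (path y)" using prob_space_path prob_space_def by blast
  fix A :: "nat \<Rightarrow> 'a set" and l assume A[measurable]: "\<And>i. A i \<in> sets borel"
  have "emeasure (Q y \<bind> (\<lambda>z. distr (path z) seq_space (case_nat z))) (cylinder A l)
     = (\<integral>\<^sup>+z. emeasure (distr (path z) seq_space (case_nat z)) (cylinder A l) \<partial>Q y)"
    by (rule emeasure_bind[where N=seq_space]) (auto simp: measurable_cong_sets[OF sets_Q refl])
  also have "\<dots> = (\<integral>\<^sup>+z. emeasure (path z) {\<omega>. \<forall>i<l. case_nat z \<omega> i \<in> A i} \<partial>Q y)"
    by (intro nn_integral_cong, subst emeasure_distr) (auto simp: vimage_def)
  also have "\<dots> = ennreal (cyl Q (map A [0..<l]) y)"
  proof (cases l)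
    case 0
    then show ?thesis using prob_space.emeasure_space_1[OF prob_space_path] prob_space.emeasure_space_1[OF prob_space_Q, of y] by simp
  next
    case (Suc l')
    have "emeasure (path z) {\<omega>. \<forall>i<l. case_nat z \<omega> i \<in> A i} = indicator (A 0) z * ennreal (cyl Q (map (\<lambda>i. A (Suc i)) [0..<l']) z)" for z
    proof -
      have "{\<omega>. \<forall>i<l. case_nat z \<omega> i \<in> A i} = (if z \<in> A 0 then {\<omega>. \<forall>i<l'. \<omega> i \<in> A (Suc i)} else {})"
        unfolding Suc All_less_Suc2 by auto
      then show ?thesis by (simp add: emeasure_path_cylinder)
    qed
    moreover have "map A [0..<l] = A 0 # map (\<lambda>i. A (Suc i)) [0..<l']"
      by (simp only: Suc upt_conv_Cons[OF zero_less_Suc] map_Suc_upt[symmetric] list.map map_map comp_def)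
    ultimately show ?thesis by (simp only:) (subst ennreal_cyl_Cons, auto)
  qed
  finally show "emeasure (path y) (cylinder A l) = emeasure (Q y \<bind> (\<lambda>z. distr (path z) seq_space (case_nat z))) (cylinder A l)"
    by (simp add: emeasure_path_cylinder)
qed (auto intro!: sets_bind)

lemma emeasure_path_step:
  assumes E[measurable]: "E \<in> sets seq_space"
  shows "emeasure (path y) E = (\<integral>\<^sup>+z. emeasure (path z) {\<omega>. case_nat z \<omega> \<in> E} \<partial>Q y)"
proof -
  have "emeasure (path y) E = (\<integral>\<^sup>+z. emeasure (distr (path z) seq_space (case_nat z)) E \<partial>Q y)"
    by (subst path_unfold, rule emeasure_bind[where N=seq_space]) (auto simp: measurable_cong_sets[OF sets_Q refl])
  also have "\<dots> = (\<integral>\<^sup>+z. emeasure (path z) {\<omega>. case_nat z \<omega> \<in> E} \<partial>Q y)"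
    by (intro nn_integral_cong, subst emeasure_distr) (auto simp: vimage_def)
  finally show ?thesis .
qed

definition shift :: "(nat \<Rightarrow> 'a) \<Rightarrow> nat \<Rightarrow> 'a" where "shift \<omega> = (\<lambda>i. \<omega> (Suc i))"

lemma shift_measurable [measurable]: "shift \<in> seq_space \<rightarrow>\<^sub>M seq_space"
  unfolding shift_def by (intro measurable_abs_UNIV measurable_component_singleton) simp

lemma shift_case_nat [simp]: "shift (case_nat z \<omega>) = \<omega>" by (simp add: shift_def)

lemma shift_pow: "(shift ^^ n) \<omega> = (\<lambda>i. \<omega> (i + n))"
  by (induction n) (auto simp: shift_def)

text \<open>The Markov property at time 1: the shift forgets X_1 and leaves a path started from that
  state.\<close>

lemma distr_path_shift: "distr (path y) seq_space shift = Q y \<bind> path"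
proof (rule measure_eqI)
  fix E assume "E \<in> sets (distr (path y) seq_space shift)"
  then have E[measurable]: "E \<in> sets seq_space" by simp
  have "emeasure (distr (path y) seq_space shift) E = emeasure (path y) (shift -` E)"
    by (subst emeasure_distr) auto
  also have "\<dots> = (\<integral>\<^sup>+z. emeasure (path z) E \<partial>Q y)"
    using measurable_sets[OF shift_measurable E] by (subst emeasure_path_step) auto
  also have "\<dots> = emeasure (Q y \<bind> path) E"
    by (rule emeasure_bind[symmetric, where N=seq_space]) (auto simp: measurable_cong_sets[OF sets_Q refl])
  finally show "emeasure (distr (path y) seq_space shift) E = emeasure (Q y \<bind> path) E" .
qed (auto intro!: sets_bind[symmetric])

end

section \<open>Total variation, harmonic functions and the zero-one law\<close>

text \<open>All quantifiers on the right range over natural numbers, so the set of convergence is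
  measurable.\<close>

lemma LIMSEQ_iff_countable:
  fixes X :: "nat \<Rightarrow> 'a::metric_space"
  shows "X \<longlonglongrightarrow> L \<longleftrightarrow> (\<forall>j. \<exists>N. \<forall>n\<ge>N. dist (X n) L < 1 / real (Suc j))"
proof
  assume *: "\<forall>j. \<exists>N. \<forall>n\<ge>N. dist (X n) L < 1 / real (Suc j)"
  show "X \<longlonglongrightarrow> L"
  proof (rule metric_LIMSEQ_I)
    fix e :: real assume "0 < e"
    then obtain j where j: "1 / real (Suc j) < e" using nat_approx_posE by blast
    obtain N where "\<forall>n\<ge>N. dist (X n) L < 1 / real (Suc j)" using * by blast
    then have "\<forall>n\<ge>N. dist (X n) L < e" using j by (meson less_trans)
    then show "\<exists>N. \<forall>n\<ge>N. dist (X n) L < e" by blast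
  qed
next
  assume lim: "X \<longlonglongrightarrow> L"
  show "\<forall>j. \<exists>N. \<forall>n\<ge>N. dist (X n) L < 1 / real (Suc j)"
  proof
    fix j
    have "0 < 1 / real (Suc j)" by simp
    from metric_LIMSEQ_D[OF lim this] show "\<exists>N. \<forall>n\<ge>N. dist (X n) L < 1 / real (Suc j)" .
  qed
qed

lemma tv_dist_ge:
  fixes \<mu> \<nu> :: "'a::topological_space measure"
  assumes "prob_space \<mu>" "prob_space \<nu>" "A \<in> sets borel"
  shows "\<bar>measure \<mu> A - measure \<nu> A\<bar> \<le> tv_dist \<mu> \<nu>"
  unfolding tv_dist_def
proof (rule cSUP_upper[OF assms(3)])
  interpret \<mu>: prob_space \<mu> by fact
  interpret \<nu>: prob_space \<nu> by fact
  have "\<bar>measure \<mu> A - measure \<nu> A\<bar> \<le> 1" for A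
    using \<mu>.prob_le_1[of A] \<nu>.prob_le_1[of A] measure_nonneg[of \<mu> A] measure_nonneg[of \<nu> A] by linarith
  then show "bdd_above ((\<lambda>A. \<bar>measure \<mu> A - measure \<nu> A\<bar>) ` sets borel)" by (intro bdd_aboveI) auto
qed

text \<open>The sum counts the levels i/N not exceeding u, and these are the first floor(N u)
  ones.\<close>

lemma staircase:
  fixes u :: real
  assumes "0 \<le> u" "u \<le> 1" "0 < N"
  shows "(\<Sum>i=1..N. indicator {v. real i / real N \<le> v} u) / real N \<le> u"
    "u \<le> (\<Sum>i=1..N. indicator {v. real i / real N \<le> v} u) / real N + 1 / real N"
proof -
  define m where "m = nat \<lfloor>real N * u\<rfloor>"
  have m: "real m \<le> real N * u" "real N * u < real m + 1" using assms by (auto simp: m_def)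
  have mN: "m \<le> N"
  proof -
    have "real N * u \<le> real N * 1" using assms by (intro mult_left_mono) auto
    then show ?thesis using m by linarith
  qed
  have "(\<Sum>i=1..N. indicator {v. real i / real N \<le> v} u) = (\<Sum>i=1..N. if i \<le> m then 1 else 0 :: real)"
  proof (intro sum.cong refl)
    fix i
    have "real i / real N \<le> u \<longleftrightarrow> real i \<le> real N * u" using assms by (simp add: divide_le_eq mult.commute)
    also have "\<dots> \<longleftrightarrow> i \<le> m" using m by linarith
    finally show "indicator {v. real i / real N \<le> v} u = (if i \<le> m then 1 else 0 :: real)" by (simp add: indicator_def)
  qed
  also have "\<dots> = (\<Sum>i\<in>{1..m}. 1)" using mN by (intro sum.mono_neutral_cong_right) auto
  also have "\<dots> = real m" by simp
  finally have eq: "(\<Sum>i=1..N. indicator {v. real i / real N \<le> v} u) = real m" .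
  show "(\<Sum>i=1..N. indicator {v. real i / real N \<le> v} u) / real N \<le> u"
    "u \<le> (\<Sum>i=1..N. indicator {v. real i / real N \<le> v} u) / real N + 1 / real N"
    unfolding eq using m assms by (simp_all add: divide_le_eq le_divide_eq mult.commute flip: add_divide_distrib)
qed

text \<open>\<open>tv_dist\<close> is a supremum over events. The staircase is an average of N
  indicators within 1/N of h, and each indicator loses at most \<open>tv_dist\<close>, so the
  constant is 1.\<close>

lemma tv_dist_integral:
  fixes \<mu> \<nu> :: "'a::topological_space measure" and h :: "'a \<Rightarrow> real"
  assumes prob: "prob_space \<mu>" "prob_space \<nu>" and sets: "sets \<mu> = sets borel" "sets \<nu> = sets borel"
    and h[measurable]: "h \<in> borel_measurable borel" and h01: "\<And>y. 0 \<le> h y" "\<And>y. h y \<le> 1"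
  shows "(\<integral>y. h y \<partial>\<mu>) \<le> (\<integral>y. h y \<partial>\<nu>) + tv_dist \<mu> \<nu>"
proof (rule field_le_epsilon)
  fix e :: real assume "0 < e"
  then obtain n where n: "1 / real (Suc n) < e" using nat_approx_posE by blast
  define N where "N = Suc n"
  define hN where "hN = (\<lambda>y. (\<Sum>i=1..N. indicator {y. real i / real N \<le> h y} y) / real N)"
  interpret \<mu>: prob_space \<mu> by fact
  interpret \<nu>: prob_space \<nu> by fact
  have A: "{y. real i / real N \<le> h y} \<in> sets borel" for i by measurable
  have ind: "indicator {y. real i / real N \<le> h y} y = (indicator {v. real i / real N \<le> v} (h y) :: real)" for i y
    by (simp add: indicator_def)
  have hN: "hN y \<le> h y" "h y \<le> hN y + 1 / real N" for y
    using staircase[OF h01, of N y] unfolding hN_def ind by (simp_all add: N_def)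
  have intI: "integrable M (indicator {y. real i / real N \<le> h y} :: 'a \<Rightarrow> real)"
    if "prob_space M" "sets M = sets borel" for M i
  proof -
    interpret M: prob_space M by fact
    show ?thesis using A that by (intro integrable_real_indicator) (auto simp: M.emeasure_eq_measure)
  qed
  have inth: "integrable M h" if "prob_space M" "sets M = sets borel" for M
  proof -
    interpret M: prob_space M by fact
    show ?thesis by (rule M.integrable_const_bound[of _ 1]) (auto simp: h01 measurable_cong_sets[OF that(2) refl])
  qed
  have intN: "integrable M hN" if "prob_space M" "sets M = sets borel" for M
    unfolding hN_def by (intro integrable_divide_zero Bochner_Integration.integrable_sum intI that)
  have sp: "space M = UNIV" if "sets M = sets borel" for M :: "'a measure" using sets_eq_imp_space_eq[OF that] by simp
  have val: "(\<integral>y. hN y \<partial>M) = (\<Sum>i=1..N. measure M {y. real i / real N \<le> h y}) / real N"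
    if "prob_space M" "sets M = sets borel" for M
    unfolding hN_def using intI[OF that] A that(2) sp[OF that(2)] by (simp add: Bochner_Integration.integral_sum)
  have "(\<integral>y. h y \<partial>\<mu>) \<le> (\<integral>y. hN y + 1 / real N \<partial>\<mu>)"
    by (intro integral_mono inth intN prob sets Bochner_Integration.integrable_add hN) auto
  also have "\<dots> = (\<integral>y. hN y \<partial>\<mu>) + 1 / real N"
    using intN[OF prob(1) sets(1)] \<mu>.prob_space by simp
  also have "(\<integral>y. hN y \<partial>\<mu>) \<le> (\<Sum>i=1..N. measure \<nu> {y. real i / real N \<le> h y} + tv_dist \<mu> \<nu>) / real N"
    unfolding val[OF prob(1) sets(1)]
  proof (intro divide_right_mono sum_mono)
    fix i show "measure \<mu> {y. real i / real N \<le> h y} \<le> measure \<nu> {y. real i / real N \<le> h y} + tv_dist \<mu> \<nu>"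
      using tv_dist_ge[OF prob A[of i]] by linarith
  qed simp
  also have "\<dots> = (\<integral>y. hN y \<partial>\<nu>) + tv_dist \<mu> \<nu>"
    unfolding val[OF prob(2) sets(2)] by (simp add: sum.distrib add_divide_distrib N_def)
  also have "(\<integral>y. hN y \<partial>\<nu>) \<le> (\<integral>y. h y \<partial>\<nu>)"
    by (intro integral_mono inth intN prob sets hN)
  finally show "(\<integral>y. h y \<partial>\<mu>) \<le> (\<integral>y. h y \<partial>\<nu>) + tv_dist \<mu> \<nu> + e" using n by (simp add: N_def)
qed

lemma tv_dist_commute: "tv_dist \<mu> \<nu> = tv_dist \<nu> \<mu>"
  by (simp add: tv_dist_def abs_minus_commute)

context markov_kernel
begin

lemma harmonic_kpow:
  fixes h :: "'a \<Rightarrow> real"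
  assumes [measurable]: "h \<in> borel_measurable borel" and h01: "\<And>y. 0 \<le> h y" "\<And>y. h y \<le> 1"
    and harm: "\<And>y. (\<integral>z. h z \<partial>Q y) = h y"
  shows "(\<integral>z. h z \<partial>kpow Q n y) = h y"
proof (induction n)
  case 0
  then show ?case by (simp add: integral_return)
next
  case (Suc n)
  interpret P: prob_space "kpow Q (Suc n) y" by (rule prob_space_kpow)
  have int: "integrable (kpow Q n y \<bind> Q) h"
    using P.integrable_const_bound[of h 1] by (simp add: h01 measurable_cong_sets[OF sets_kpow refl, of "Suc n", simplified])
  have "(\<integral>z. h z \<partial>(kpow Q n y \<bind> Q)) = (\<integral>z. \<integral>w. h w \<partial>Q z \<partial>kpow Q n y)"
    by (rule integrable_bind_kernel(3)[OF _ _ int, where N=borel]) (auto simp: measurable_cong_sets[OF sets_kpow refl])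
  then show ?case using Suc by (simp add: harm)
qed

text \<open>Invariance lets the first coordinate be stripped from E, and E has probability c from
  every state. Hence E is independent of each cylinder.\<close>

lemma kernel_cylinder_int:
  assumes E: "E \<in> sets seq_space" "shift -` E = E" and c: "\<And>z. emeasure (path z) E = c"
    and A: "\<And>i. A i \<in> sets borel"
  shows "emeasure (path y) ((cylinder A l) \<inter> E) = c * emeasure (path y) (cylinder A l)"
  using A
proof (induction l arbitrary: A y)
  case 0
  then show ?case using c prob_space.emeasure_space_1[OF prob_space_path] by simp
next
  case (Suc l)
  have [measurable]: "\<And>i. A i \<in> sets borel" by (rule Suc.prems)
  let ?C = "{\<omega>. \<forall>i<l. \<omega> i \<in> A (Suc i)}"
  have inv: "case_nat z \<omega> \<in> E \<longleftrightarrow> \<omega> \<in> E" for z \<omega>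
  proof -
    have "case_nat z \<omega> \<in> shift -` E \<longleftrightarrow> \<omega> \<in> E" by simp
    then show ?thesis by (simp only: E(2))
  qed
  have C: "(cylinder A (Suc l)) \<in> sets seq_space" by (rule cylinder_sets) (rule Suc.prems)
  have Cm: "?C \<in> sets seq_space" by (rule cylinder_sets) (rule Suc.prems)
  have meas: "(\<lambda>z. emeasure (path z) ?C) \<in> borel_measurable borel"
    using Cm by (intro measurable_compose[OF path_measurable]) simp
  have "emeasure (path y) ((cylinder A (Suc l)) \<inter> E)
      = (\<integral>\<^sup>+z. emeasure (path z) {\<omega>. case_nat z \<omega> \<in> (cylinder A (Suc l)) \<inter> E} \<partial>Q y)"
    using C E(1) by (intro emeasure_path_step) auto
  also have "\<dots> = (\<integral>\<^sup>+z. c * (indicator (A 0) z * emeasure (path z) ?C) \<partial>Q y)"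
  proof (rule nn_integral_cong)
    fix z
    have "{\<omega>. case_nat z \<omega> \<in> (cylinder A (Suc l)) \<inter> E} = (if z \<in> A 0 then ?C \<inter> E else {})"
      unfolding All_less_Suc2 using inv by auto
    then show "emeasure (path z) {\<omega>. case_nat z \<omega> \<in> (cylinder A (Suc l)) \<inter> E} = c * (indicator (A 0) z * emeasure (path z) ?C)"
      using Suc.IH[of "\<lambda>i. A (Suc i)" z] by simp
  qed
  also have "\<dots> = c * (\<integral>\<^sup>+z. indicator (A 0) z * emeasure (path z) ?C \<partial>Q y)"
  proof (rule nn_integral_cmult)
    show "(\<lambda>z. indicator (A 0) z * emeasure (path z) ?C) \<in> borel_measurable (Q y)"
      unfolding measurable_cong_sets[OF sets_Q refl]
      by (intro borel_measurable_times_ennreal borel_measurable_indicator meas Suc.prems)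
  qed
  also have "(\<integral>\<^sup>+z. indicator (A 0) z * emeasure (path z) ?C \<partial>Q y) = emeasure (path y) (cylinder A (Suc l))"
  proof -
    have "{\<omega>. case_nat z \<omega> \<in> (cylinder A (Suc l))} = (if z \<in> A 0 then ?C else {})" for z
      unfolding All_less_Suc2 by auto
    then have "emeasure (path z) {\<omega>. case_nat z \<omega> \<in> (cylinder A (Suc l))} = indicator (A 0) z * emeasure (path z) ?C" for z
      by simp
    then show ?thesis by (subst emeasure_path_step[OF C]) (simp only:)
  qed
  finally show ?case .
qed

text \<open>Coordinate k is the state at time k + 1. The induction goes through the shift and hence
  through the left recursion of \<open>kpow\<close>.\<close>

lemma distr_path_coordinate:
  "distr (path y) borel (\<lambda>\<omega>. \<omega> k) = kpow Q (Suc k) y"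
proof (induction k arbitrary: y)
  case 0
  show ?case
  proof (rule measure_eqI)
    fix A assume "A \<in> sets (distr (path y) borel (\<lambda>\<omega>. \<omega> 0))"
    then have A[measurable]: "A \<in> sets borel" by simp
    have m: "(\<lambda>\<omega>. \<omega> 0) \<in> path y \<rightarrow>\<^sub>M borel" by (subst measurable_cong_sets[OF sets_path refl]) (rule measurable_component_singleton, simp)
    have "emeasure (distr (path y) borel (\<lambda>\<omega>. \<omega> 0)) A = emeasure (path y) {\<omega>. \<forall>i<Suc 0. \<omega> i \<in> A}"
      using m by (subst emeasure_distr) (auto simp: vimage_def)
    also have "\<dots> = ennreal (cyl Q [A] y)" by (subst emeasure_path_cylinder) auto
    also have "\<dots> = emeasure (Q y) A" by (subst ennreal_cyl_Cons) auto
    finally show "emeasure (distr (path y) borel (\<lambda>\<omega>. \<omega> 0)) A = emeasure (kpow Q (Suc 0) y) A"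
      using kpow_1[of y] by simp
  qed simp
next
  case (Suc k)
  have m: "(\<lambda>\<omega>. \<omega> k) \<in> seq_space \<rightarrow>\<^sub>M (borel :: 'a measure)" by (rule measurable_component_singleton) simp
  have "distr (path y) borel (\<lambda>\<omega>. \<omega> (Suc k)) = distr (distr (path y) seq_space shift) borel (\<lambda>\<omega>. \<omega> k)"
    by (subst distr_distr[OF m]) (auto simp: shift_def comp_def)
  also have "\<dots> = Q y \<bind> (\<lambda>z. distr (path z) borel (\<lambda>\<omega>. \<omega> k))"
    unfolding distr_path_shift
    by (rule distr_bind[where K=seq_space]) (auto simp: measurable_cong_sets[OF sets_Q refl] m)
  also have "\<dots> = kpow Q (Suc (Suc k)) y" by (simp only: Suc kpow_Suc_left[of "Suc k"])
  finally show ?case .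
qed

end

locale geometrically_ergodic = reversible_kernel +
  assumes geometric: "A3 Q \<pi>"
begin

lemma tv_dist_kpow_small:
  assumes "0 < e"
  shows "\<exists>n. tv_dist (kpow Q n x) \<pi> < e"
proof -
  obtain \<rho> Mf where \<rho>: "\<rho> < 1" and Mf: "\<And>x. 0 \<le> Mf x" and le: "\<And>x n. tv_dist (kpow Q n x) \<pi> \<le> Mf x * \<rho> ^ n"
    using geometric unfolding A3_def by blast
  show ?thesis
  proof (cases "0 \<le> \<rho>")
    case True
    have "(\<lambda>n. Mf x * \<rho> ^ n) \<longlonglongrightarrow> Mf x * 0"
      using True \<rho> by (intro tendsto_intros LIMSEQ_power_zero) auto
    then have "\<forall>\<^sub>F n in sequentially. Mf x * \<rho> ^ n < e"
      using assms by (intro order_tendstoD(2)[where y="Mf x * 0"]) auto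
    then obtain n where "Mf x * \<rho> ^ n < e" by (auto simp: eventually_sequentially)
    then show ?thesis using le[of n x] by (intro exI[of _ n]) linarith
  next
    \<comment> \<open>\<open>A3\<close> admits negative \<rho>; then n = 1 already makes the bound
      nonpositive.\<close>
    case False
    then have "Mf x * \<rho> ^ 1 \<le> 0" using Mf[of x] by (simp add: mult_nonneg_nonpos)
    then show ?thesis using le[of 1 x] assms by (intro exI[of _ 1]) linarith
  qed
qed

text \<open>h(x) equals the Q^n-average of h at x, which is within the total variation distance of
  the \<pi>-average since h takes values in [0,1].\<close>

lemma bounded_harmonic_constant:
  fixes h :: "'a \<Rightarrow> real"
  assumes h: "h \<in> borel_measurable borel" and h01: "\<And>y. 0 \<le> h y" "\<And>y. h y \<le> 1"
    and harm: "\<And>y. (\<integral>z. h z \<partial>Q y) = h y"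
  shows "h x = (\<integral>y. h y \<partial>\<pi>)"
proof (rule antisym)
  note kp = harmonic_kpow[OF h h01 harm]
  show "h x \<le> (\<integral>y. h y \<partial>\<pi>)"
  proof (rule field_le_epsilon)
    fix e :: real assume "0 < e"
    then obtain n where "tv_dist (kpow Q n x) \<pi> < e" using tv_dist_kpow_small by blast
    then show "h x \<le> (\<integral>y. h y \<partial>\<pi>) + e"
      using tv_dist_integral[OF prob_space_kpow prob_pi sets_kpow sets_pi h h01, of n x] by (simp add: kp)
  qed
  show "(\<integral>y. h y \<partial>\<pi>) \<le> h x"
  proof (rule field_le_epsilon)
    fix e :: real assume "0 < e"
    then obtain n where "tv_dist (kpow Q n x) \<pi> < e" using tv_dist_kpow_small by blast
    then show "(\<integral>y. h y \<partial>\<pi>) \<le> h x + e"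
      using tv_dist_integral[OF prob_pi prob_space_kpow sets_pi sets_kpow h h01, of n x] by (simp add: kp tv_dist_commute)
  qed
qed

text \<open>The chain started from \<pi>, seen from time 1 on.\<close>

definition stat :: "(nat \<Rightarrow> 'a) measure" where "stat = \<pi> \<bind> path"

lemma sets_stat [simp, measurable_cong]: "sets stat = sets seq_space"
  unfolding stat_def by (rule sets_bind) auto

lemma space_stat [simp]: "space stat = UNIV"
  using sets_eq_imp_space_eq[OF sets_stat] by simp

lemma prob_space_stat: "prob_space stat"
  unfolding stat_def by (rule pi.prob_space_bind[where S=seq_space]) (auto simp: prob_space_path)

lemma distr_stat_shift: "distr stat stat shift = stat"
proof -
  have "distr stat stat shift = distr (\<pi> \<bind> path) seq_space shift"
    unfolding stat_def[symmetric] by (rule distr_cong) auto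
  also have "\<dots> = \<pi> \<bind> (\<lambda>y. distr (path y) seq_space shift)"
    by (rule distr_bind[where K=seq_space]) auto
  also have "\<dots> = \<pi> \<bind> (\<lambda>y. Q y \<bind> path)" by (simp only: distr_path_shift)
  also have "\<dots> = (\<pi> \<bind> Q) \<bind> path"
    by (rule bind_assoc[symmetric, where N=borel and R=seq_space]) auto
  finally show ?thesis by (simp only: stationary stat_def)
qed

text \<open>By first-step analysis the probability of E is harmonic in the starting state, hence a
  constant c. Then E is independent of all cylinders, so of itself, and c = c^2.\<close>

lemma invariant_event:
  assumes E: "E \<in> sets seq_space" "shift -` E = E"
  shows "measure (path y) E = measure stat E" "measure stat E = 0 \<or> measure stat E = 1"
proof -
  interpret P: prob_space "path y" for y by (rule prob_space_path)
  interpret S: prob_space stat by (rule prob_space_stat)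
  define h where "h = (\<lambda>y. measure (path y) E)"
  have h[measurable]: "h \<in> borel_measurable borel"
    unfolding h_def using E(1) by (intro measurable_compose[OF path_measurable]) simp
  have h01: "0 \<le> h y" "h y \<le> 1" for y by (auto simp: h_def)
  have harm: "(\<integral>z. h z \<partial>Q y) = h y" for y
  proof -
    interpret Qy: prob_space "Q y" by (rule prob_space_Q)
    have int: "integrable (Q y) h" by (rule Qy.integrable_const_bound[of _ 1]) (auto simp: h01)
    have "{\<omega>. case_nat z \<omega> \<in> shift -` E} = E" for z by simp
    then have "{\<omega>. case_nat z \<omega> \<in> E} = E" for z by (simp only: E(2))
    then have "ennreal (h y) = (\<integral>\<^sup>+z. ennreal (h z) \<partial>Q y)"
      using emeasure_path_step[OF E(1), of y] by (simp add: h_def P.emeasure_eq_measure)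
    also have "\<dots> = ennreal (\<integral>z. h z \<partial>Q y)" using int h01 by (intro nn_integral_eq_integral) auto
    finally show ?thesis using h01 by (simp add: integral_nonneg)
  qed
  define c where "c = (\<integral>y. h y \<partial>\<pi>)"
  have c: "h y = c" for y unfolding c_def by (rule bounded_harmonic_constant[OF h h01 harm])
  have "emeasure stat E = (\<integral>\<^sup>+y. emeasure (path y) E \<partial>\<pi>)"
    unfolding stat_def using E(1) by (intro emeasure_bind[where N=seq_space]) auto
  also have "\<dots> = ennreal c"
    using c pi.emeasure_space_1 by (simp add: P.emeasure_eq_measure h_def)
  finally have s: "measure stat E = c" using h01[of undefined] c by (simp add: S.emeasure_eq_measure)
  show "measure (path y) E = measure stat E" using c[of y] by (simp add: s h_def)
  have ec: "emeasure (path z) E = ennreal c" for z using c[of z] by (simp add: P.emeasure_eq_measure h_def)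
  have dens: "emeasure (density (path y) (indicator E)) B = emeasure (path y) (B \<inter> E)" if B: "B \<in> sets seq_space" for B
  proof -
    have "emeasure (density (path y) (indicator E)) B = (\<integral>\<^sup>+\<omega>. indicator E \<omega> * indicator B \<omega> \<partial>path y)"
      using B E(1) by (intro emeasure_density) auto
    also have "\<dots> = (\<integral>\<^sup>+\<omega>. indicator (B \<inter> E) \<omega> \<partial>path y)"
      by (intro nn_integral_cong) (auto simp: indicator_def)
    also have "\<dots> = emeasure (path y) (B \<inter> E)" using B E(1) by simp
    finally show ?thesis .
  qed
  have densc: "emeasure (density (path y) (\<lambda>_. ennreal c)) B = ennreal c * emeasure (path y) B" if "B \<in> sets seq_space" for B
    using that by (simp add: emeasure_density nn_integral_cmult_indicator)
  \<comment> \<open>Independence is written as equality of two measures, which cylinders determine;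
    evaluating at E itself gives c = c^2.\<close>
  have "density (path y) (indicator E) = density (path y) (\<lambda>_. ennreal c)"
  proof (rule measure_eqI_cylinders)
    show "finite_measure (density (path y) (indicator E))"
      by (rule finite_measureI) (simp add: dens[of UNIV, simplified] sets.top[of seq_space, simplified] P.emeasure_eq_measure)
    fix A :: "nat \<Rightarrow> 'a set" and l assume A: "\<And>i. A i \<in> sets (borel :: 'a measure)"
    show "emeasure (density (path y) (indicator E)) (cylinder A l) = emeasure (density (path y) (\<lambda>_. ennreal c)) (cylinder A l)"
      using cylinder_sets[of A l] A kernel_cylinder_int[OF E ec A] by (simp only: dens densc)
  qed simp_all
  then have "emeasure (path y) (E \<inter> E) = ennreal c * emeasure (path y) E"
    using dens[OF E(1)] densc[OF E(1)] by simp
  then have "ennreal c = ennreal c * ennreal c" by (simp add: ec)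
  moreover have "0 \<le> c" using h01[of undefined] c by simp
  ultimately have "c = c * c" by (simp flip: ennreal_mult)
  then show "measure stat E = 0 \<or> measure stat E = 1" by (simp add: s)
qed

sublocale stat: ergodic_system stat shift
proof (intro ergodic_system.intro ergodic_system_axioms.intro prob_space_stat distr_stat_shift)
  show "shift \<in> stat \<rightarrow>\<^sub>M stat" using shift_measurable by (simp add: measurable_cong_sets[OF sets_stat sets_stat])
  show "measure stat E = 0 \<or> measure stat E = 1" if "E \<in> sets stat" "shift -` E \<inter> space stat = E" for E
    using invariant_event(2)[of E] that by simp
qed

proposition path_law_of_large_numbers:
  fixes f :: "(nat \<Rightarrow> 'a) \<Rightarrow> real"
  assumes f: "integrable stat f"
  shows "AE \<omega> in path y. (\<lambda>n. (\<Sum>t<n. f (\<lambda>i. \<omega> (i + t))) / real n) \<longlonglongrightarrow> (\<integral>\<omega>. f \<omega> \<partial>stat)"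
proof -
  define L where "L = (\<integral>\<omega>. f \<omega> \<partial>stat)"
  have [measurable]: "f \<in> borel_measurable seq_space" using borel_measurable_integrable[OF f] by (simp add: measurable_cong_sets[OF sets_stat refl])
  define E where "E = {\<omega>. (\<lambda>n. (\<Sum>t<n. f ((shift ^^ t) \<omega>)) / real n) \<longlonglongrightarrow> L}"
  have pw[measurable]: "(shift ^^ t) \<in> seq_space \<rightarrow>\<^sub>M seq_space" for t
    by (induction t) (auto intro: measurable_comp)
  have mt: "(\<lambda>\<omega>. f ((shift ^^ t) \<omega>)) \<in> borel_measurable seq_space" for t
    by (rule measurable_compose[OF pw]) simp
  have "{\<omega> \<in> space seq_space. (\<lambda>n. (\<Sum>t<n. f ((shift ^^ t) \<omega>)) / real n) \<longlonglongrightarrow> L} \<in> sets seq_space"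
  proof -
    have [measurable]: "(\<lambda>\<omega>. (\<Sum>t<n. f ((shift ^^ t) \<omega>)) / real n) \<in> borel_measurable seq_space" for n
      by (intro borel_measurable_divide borel_measurable_sum mt) simp
    have "{\<omega> \<in> space seq_space. \<forall>j. \<exists>N. \<forall>n\<ge>N. dist ((\<Sum>t<n. f ((shift ^^ t) \<omega>)) / real n) L < 1 / real (Suc j)} \<in> sets seq_space"
      by measurable
    then show ?thesis by (simp only: LIMSEQ_iff_countable)
  qed
  then have E: "E \<in> sets seq_space" by (simp add: E_def)
  \<comment> \<open>Invariance holds as an exact equality of sets, because the averages along a path
    and along its shift have the limit L together or not at all.\<close>
  have "shift -` E = E"
  proof (intro set_eqI iffI)
    fix \<omega>
    have sw: "f ((shift ^^ t) (shift \<omega>)) = f ((shift ^^ Suc t) \<omega>)" for t by (simp add: funpow_swap1)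
    show "\<omega> \<in> E" if "\<omega> \<in> shift -` E"
      using that tendsto_average_drop[of "\<lambda>t. f ((shift ^^ t) \<omega>)" L] unfolding E_def vimage_def mem_Collect_eq sw by blast
    show "\<omega> \<in> shift -` E" if "\<omega> \<in> E"
      using that tendsto_average_Suc[of "\<lambda>t. f ((shift ^^ t) \<omega>)" L] unfolding E_def vimage_def mem_Collect_eq sw by blast
  qed
  note inv = invariant_event[OF E this]
  have "AE \<omega> in stat. \<omega> \<in> E" using stat.birkhoff[OF f] by (simp add: E_def L_def)
  then have "measure stat E = 1" using E by (subst stat.prob_eq_1) auto
  then have "measure (path y) E = 1" using inv(1)[of y] by simp
  then have "AE \<omega> in path y. \<omega> \<in> E" using E by (subst prob_space.prob_eq_1[OF prob_space_path, symmetric]) auto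
  then show ?thesis by (simp add: E_def L_def shift_pow)
qed

end

section \<open>Consistency of the covariance estimators\<close>

context geometrically_ergodic
begin

lemma coordinates_measurable: "(\<lambda>\<omega>. (\<omega> 0, \<omega> k)) \<in> seq_space \<rightarrow>\<^sub>M (borel \<Otimes>\<^sub>M borel :: ('a \<times> 'a) measure)"
  by (intro measurable_Pair measurable_component_singleton) auto

lemma emeasure_path_pair:
  assumes A: "A \<in> sets borel" and B: "B \<in> sets borel"
  shows "emeasure (path y) {\<omega>. \<omega> 0 \<in> A \<and> \<omega> k \<in> B} = (\<integral>\<^sup>+z. indicator A z * emeasure (kpow Q k z) B \<partial>Q y)"
proof -
  have "{\<omega>. \<omega> 0 \<in> A \<and> \<omega> k \<in> B} = (\<lambda>\<omega>. (\<omega> 0, \<omega> k)) -` (A \<times> B) \<inter> space seq_space" by auto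
  then have E: "{\<omega>. \<omega> 0 \<in> A \<and> \<omega> k \<in> B} \<in> sets seq_space"
    using measurable_sets[OF coordinates_measurable[of k], of "A \<times> B"] A B by simp
  have "emeasure (path z) {\<omega>. case_nat z \<omega> \<in> {\<omega>. \<omega> 0 \<in> A \<and> \<omega> k \<in> B}} = indicator A z * emeasure (kpow Q k z) B" for z
  proof (cases k)
    case 0
    then have "{\<omega>. case_nat z \<omega> \<in> {\<omega>. \<omega> 0 \<in> A \<and> \<omega> k \<in> B}} = (if z \<in> A \<and> z \<in> B then UNIV else {})" by auto
    then show ?thesis using B 0 prob_space.emeasure_space_1[OF prob_space_path, of z] by (auto simp: indicator_def)
  next
    case (Suc j)
    have m: "(\<lambda>\<omega>. \<omega> j) \<in> path z \<rightarrow>\<^sub>M borel"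
      unfolding measurable_cong_sets[OF sets_path refl] by (rule measurable_component_singleton) simp
    have "{\<omega>. case_nat z \<omega> \<in> {\<omega>. \<omega> 0 \<in> A \<and> \<omega> k \<in> B}} = (if z \<in> A then {\<omega>. \<omega> j \<in> B} else {})"
      by (auto simp: Suc)
    moreover have "emeasure (path z) {\<omega>. \<omega> j \<in> B} = emeasure (kpow Q k z) B"
      unfolding Suc distr_path_coordinate[symmetric] using m B by (subst emeasure_distr) (auto simp: vimage_def)
    ultimately show ?thesis by simp
  qed
  then show ?thesis by (subst emeasure_path_step[OF E]) (simp only:)
qed

text \<open>The first coordinate is X_1, whose law is \<pi> by stationarity; k steps later the state
  is drawn from Q^k.\<close>

lemma distr_stat_pair: "distr stat (borel \<Otimes>\<^sub>M borel) (\<lambda>\<omega>. (\<omega> 0, \<omega> k)) = joint k"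
proof (rule measure_eqI_rectangles)
  have m: "(\<lambda>\<omega>. (\<omega> 0, \<omega> k)) \<in> stat \<rightarrow>\<^sub>M (borel \<Otimes>\<^sub>M borel)"
    unfolding measurable_cong_sets[OF sets_stat refl] by (rule coordinates_measurable)
  show "finite_measure (distr stat (borel \<Otimes>\<^sub>M borel) (\<lambda>\<omega>. (\<omega> 0, \<omega> k)))"
    using stat.prob_space_distr[OF m] by (simp add: prob_space_def)
  fix A B :: "'a set" assume AB[measurable]: "A \<in> sets borel" "B \<in> sets borel"
  have "(\<lambda>\<omega>. (\<omega> 0, \<omega> k)) -` (A \<times> B) = {\<omega>. \<omega> 0 \<in> A \<and> \<omega> k \<in> B}" by auto
  then have E: "{\<omega>. \<omega> 0 \<in> A \<and> \<omega> k \<in> B} \<in> sets seq_space"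
    using measurable_sets[OF coordinates_measurable[of k], of "A \<times> B"] AB by simp
  have bm: "(\<lambda>z. indicator A z * emeasure (kpow Q k z) B) \<in> borel_measurable borel"
    by (intro borel_measurable_times_ennreal borel_measurable_indicator AB(1) measurable_compose[OF kpow_measurable]) simp
  have "emeasure (distr stat (borel \<Otimes>\<^sub>M borel) (\<lambda>\<omega>. (\<omega> 0, \<omega> k))) (A \<times> B) = emeasure stat {\<omega>. \<omega> 0 \<in> A \<and> \<omega> k \<in> B}"
    using m by (subst emeasure_distr) (auto intro!: arg_cong[where f="emeasure stat"])
  also have "\<dots> = (\<integral>\<^sup>+y. emeasure (path y) {\<omega>. \<omega> 0 \<in> A \<and> \<omega> k \<in> B} \<partial>\<pi>)"
    unfolding stat_def using E by (intro emeasure_bind[where N=seq_space]) auto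
  also have "\<dots> = (\<integral>\<^sup>+y. \<integral>\<^sup>+z. indicator A z * emeasure (kpow Q k z) B \<partial>Q y \<partial>\<pi>)"
    by (simp only: emeasure_path_pair[OF AB])
  also have "\<dots> = (\<integral>\<^sup>+z. indicator A z * emeasure (kpow Q k z) B \<partial>(\<pi> \<bind> Q))"
    by (rule nn_integral_bind[symmetric, OF bm]) simp
  also have "\<dots> = emeasure (joint k) (A \<times> B)"
    by (simp only: stationary emeasure_joint_times[OF AB])
  finally show "emeasure (distr stat (borel \<Otimes>\<^sub>M borel) (\<lambda>\<omega>. (\<omega> 0, \<omega> k))) (A \<times> B) = emeasure (joint k) (A \<times> B)" .
qed simp_all

lemma stat_product:
  assumes f: "L2 f" and h: "L2 h"
  shows "integrable stat (\<lambda>\<omega>. f (\<omega> 0) * h (\<omega> k))"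
    "(\<integral>\<omega>. f (\<omega> 0) * h (\<omega> k) \<partial>stat) = cov f h (int k) + mean f * mean h"
proof -
  have m: "(\<lambda>\<omega>. (\<omega> 0, \<omega> k)) \<in> stat \<rightarrow>\<^sub>M (borel \<Otimes>\<^sub>M borel)"
    unfolding measurable_cong_sets[OF sets_stat refl] by (rule coordinates_measurable)
  note [measurable] = L2_measurable[OF f] L2_measurable[OF h]
  have F: "(\<lambda>p. f (fst p) * h (snd p)) \<in> borel_measurable (borel \<Otimes>\<^sub>M borel)" by measurable
  have "integrable (distr stat (borel \<Otimes>\<^sub>M borel) (\<lambda>\<omega>. (\<omega> 0, \<omega> k))) (\<lambda>p. f (fst p) * h (snd p))"
    unfolding distr_stat_pair by (rule joint_mult_integrable[OF f h])
  then show "integrable stat (\<lambda>\<omega>. f (\<omega> 0) * h (\<omega> k))"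
    using integrable_distr_eq[OF m F] by simp
  show "(\<integral>\<omega>. f (\<omega> 0) * h (\<omega> k) \<partial>stat) = cov f h (int k) + mean f * mean h"
    using integral_distr[OF m F] by (simp add: distr_stat_pair gamma_eq_joint[OF f h])
qed

text \<open>\<open>markov_chain_from\<close> prescribes the finite-dimensional events of X_1, X_2,
  ..., which is why \<open>path\<close> starts at time 1.\<close>

lemma distr_chain:
  assumes "markov_chain_from M X Q x"
  shows "distr M seq_space (\<lambda>\<omega> i. X (Suc i) \<omega>) = path x"
proof (rule measure_eqI_cylinders)
  have M: "prob_space M" and X: "\<And>t. X t \<in> M \<rightarrow>\<^sub>M borel"
    and law: "\<And>Bs. (\<forall>B\<in>set Bs. B \<in> sets borel) \<Longrightarrow> measure M {\<omega>\<in>space M. \<forall>i<length Bs. X (Suc i) \<omega> \<in> Bs ! i} = cyl Q Bs x"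
    using assms unfolding markov_chain_from_def by blast+
  interpret M: prob_space M by (rule M)
  have m: "(\<lambda>\<omega> i. X (Suc i) \<omega>) \<in> M \<rightarrow>\<^sub>M seq_space"
    by (intro measurable_abs_UNIV X)
  show "finite_measure (distr M seq_space (\<lambda>\<omega> i. X (Suc i) \<omega>))"
    using M.prob_space_distr[OF m] by (simp add: prob_space_def)
  fix A :: "nat \<Rightarrow> 'a set" and l assume A: "\<And>i. A i \<in> sets borel"
  have "emeasure (distr M seq_space (\<lambda>\<omega> i. X (Suc i) \<omega>)) (cylinder A l)
    = emeasure M {\<omega>\<in>space M. \<forall>i<l. X (Suc i) \<omega> \<in> A i}"
    using m cylinder_sets[of A l] A by (subst emeasure_distr) (auto intro!: arg_cong[where f="emeasure M"])
  also have "\<dots> = ennreal (cyl Q (map A [0..<l]) x)"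
    using law[of "map A [0..<l]"] A by (auto simp: M.emeasure_eq_measure cong: conj_cong)
  also have "\<dots> = emeasure (path x) (cylinder A l)"
    by (rule emeasure_path_cylinder[symmetric, OF A])
  finally show "emeasure (distr M seq_space (\<lambda>\<omega> i. X (Suc i) \<omega>)) (cylinder A l) = emeasure (path x) (cylinder A l)" .
qed simp_all

text \<open>The law of large numbers for paths speaks of times from 1 on; the term at t = 0 is then
  restored to the averages.\<close>

proposition chain_product_averages:
  assumes chain: "markov_chain_from M X Q x" and f: "L2 f" and h: "L2 h"
  shows "AE \<omega> in M. (\<lambda>n. (\<Sum>t<n. f (X t \<omega>) * h (X (t + k) \<omega>)) / real n) \<longlonglongrightarrow> cov f h (int k) + mean f * mean h"
proof -
  have X: "\<And>t. X t \<in> M \<rightarrow>\<^sub>M borel" using chain unfolding markov_chain_from_def by blast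
  have m: "(\<lambda>\<omega> i. X (Suc i) \<omega>) \<in> M \<rightarrow>\<^sub>M seq_space" by (intro measurable_abs_UNIV X)
  have "AE \<omega> in distr M seq_space (\<lambda>\<omega> i. X (Suc i) \<omega>). (\<lambda>n. (\<Sum>t<n. f (\<omega> t) * h (\<omega> (k + t))) / real n) \<longlonglongrightarrow> cov f h (int k) + mean f * mean h"
    using path_law_of_large_numbers[OF stat_product(1)[OF f h, of k], of x]
    unfolding distr_chain[OF chain] by (simp add: stat_product(2)[OF f h])
  from AE_distrD[OF m this] show ?thesis
  proof eventually_elim
    case (elim \<omega>)
    show ?case
      by (rule tendsto_average_drop) (use elim in \<open>simp add: add.commute\<close>)
  qed
qed

text \<open>The product average with h = 1, whose covariance with f vanishes.\<close>

lemma chain_averages: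
  assumes chain: "markov_chain_from M X Q x" and f: "L2 f"
  shows "AE \<omega> in M. (\<lambda>n. (\<Sum>t<n. f (X t \<omega>)) / real n) \<longlonglongrightarrow> mean f"
  using chain_product_averages[OF chain f L2_const[of 1], of 0] gamma_commute[OF f L2_const[of 1]]
  by (simp add: gamma_const_left f)

end

section \<open>Empirical covariances\<close>

lemma tendsto_average_truncate:
  fixes a :: "nat \<Rightarrow> real"
  assumes "(\<lambda>n. (\<Sum>t<n. a t) / real n) \<longlonglongrightarrow> L"
  shows "(\<lambda>n. (\<Sum>t<n - k. a t) / real n) \<longlonglongrightarrow> L"
proof (rule LIMSEQ_offset[where k=k])
  have "(\<lambda>n. 1 - real k / real (n + k)) \<longlonglongrightarrow> 1 - 0"
    by (intro tendsto_diff tendsto_const LIMSEQ_ignore_initial_segment[OF lim_const_over_n])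
  moreover have "\<forall>\<^sub>F n in sequentially. 1 - real k / real (n + k) = real n / real (n + k)"
    using eventually_gt_at_top[of 0] by eventually_elim (simp add: field_simps)
  ultimately have "(\<lambda>n. real n / real (n + k)) \<longlonglongrightarrow> 1" by (simp add: filterlim_cong)
  from tendsto_mult[OF assms this]
  have "(\<lambda>n. (\<Sum>t<n. a t) / real n * (real n / real (n + k))) \<longlonglongrightarrow> L" by simp
  moreover have "(\<Sum>t<n. a t) / real n * (real n / real (n + k)) = (\<Sum>t<n + k - k. a t) / real (n + k)" for n
    by (cases "n = 0") simp_all
  ultimately show "(\<lambda>n. (\<Sum>t<n + k - k. a t) / real (n + k)) \<longlonglongrightarrow> L" by (simp only:)
qed

lemma tendsto_average_shift:
  fixes a :: "nat \<Rightarrow> real"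
  assumes "(\<lambda>n. (\<Sum>t<n. a t) / real n) \<longlonglongrightarrow> L"
  shows "(\<lambda>n. (\<Sum>t<n. a (t + k)) / real n) \<longlonglongrightarrow> L"
proof (induction k)
  case (Suc k)
  show ?case using tendsto_average_Suc[OF Suc] by simp
qed (use assms in simp)

text \<open>Centred at the full-sample means and divided by n at every lag, to agree with
  \<open>autocov_emp\<close>. Its bilinearity reduces all directions to finitely many pairs of
  coordinates.\<close>

definition cross_emp :: "nat \<Rightarrow> (nat \<Rightarrow> real) \<Rightarrow> (nat \<Rightarrow> real) \<Rightarrow> nat \<Rightarrow> real" where
  "cross_emp n y z k = (if k < n then (\<Sum>t<n - k. (y t - (\<Sum>t<n. y t) / real n) * (z (t + k) - (\<Sum>t<n. z t) / real n)) / real n else 0)"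

text \<open>Expanding the centred product leaves truncated averages of the product, of each factor
  and of 1; the limits combine to (c + a b) - a b - a b + a b.\<close>

lemma cross_emp_tendsto:
  assumes y: "(\<lambda>n. (\<Sum>t<n. y t) / real n) \<longlonglongrightarrow> a" and z: "(\<lambda>n. (\<Sum>t<n. z t) / real n) \<longlonglongrightarrow> b"
    and yz: "(\<lambda>n. (\<Sum>t<n. y t * z (t + k)) / real n) \<longlonglongrightarrow> c + a * b"
  shows "(\<lambda>n. cross_emp n y z k) \<longlonglongrightarrow> c"
proof -
  define Y where "Y = (\<lambda>n. (\<Sum>t<n. y t) / real n)"
  define Z where "Z = (\<lambda>n. (\<Sum>t<n. z t) / real n)"
  have one: "(\<lambda>n. (\<Sum>t<n. 1) / real n) \<longlonglongrightarrow> (1::real)"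
    by (rule tendsto_eventually) (auto intro!: eventually_sequentiallyI[of 1])
  have "(\<lambda>n. (\<Sum>t<n - k. y t * z (t + k)) / real n - Z n * ((\<Sum>t<n - k. y t) / real n)
      - Y n * ((\<Sum>t<n - k. z (t + k)) / real n) + Y n * Z n * ((\<Sum>t<n - k. 1) / real n)) \<longlonglongrightarrow> (c + a * b) - b * a - a * b + a * b * 1"
    unfolding Y_def Z_def
    by (intro tendsto_add tendsto_diff tendsto_mult y z tendsto_average_truncate[OF yz] tendsto_average_truncate[OF y]
        tendsto_average_truncate[OF tendsto_average_shift[OF z]] tendsto_average_truncate[OF one])
  moreover have "\<forall>\<^sub>F n in sequentially. (\<Sum>t<n - k. y t * z (t + k)) / real n - Z n * ((\<Sum>t<n - k. y t) / real n)
      - Y n * ((\<Sum>t<n - k. z (t + k)) / real n) + Y n * Z n * ((\<Sum>t<n - k. 1) / real n) = cross_emp n y z k"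
    using eventually_gt_at_top[of k]
  proof eventually_elim
    case (elim n)
    have eq: "(\<Sum>t<n - k. (y t - Y n) * (z (t + k) - Z n))
       = (\<Sum>t<n - k. y t * z (t + k)) - Z n * (\<Sum>t<n - k. y t) - Y n * (\<Sum>t<n - k. z (t + k)) + Y n * Z n * (\<Sum>t<n - k. 1)"
      by (simp add: algebra_simps sum.distrib sum_subtractf sum_distrib_left)
    have "cross_emp n y z k = (\<Sum>t<n - k. (y t - Y n) * (z (t + k) - Z n)) / real n"
      using elim by (simp add: cross_emp_def Y_def Z_def)
    then show ?case unfolding eq by (simp only: add_divide_distrib diff_divide_distrib times_divide_eq_right)
  qed
  ultimately show ?thesis by (simp add: filterlim_cong)
qed

lemma autocov_emp_cross: "autocov_emp n y k = cross_emp n y y (nat \<bar>k\<bar>)"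
  by (simp add: autocov_emp_def cross_emp_def Let_def)

lemma cross_emp_sum:
  "cross_emp n (\<lambda>t. \<Sum>i\<in>I. u i * y i t) (\<lambda>t. \<Sum>j\<in>I. u j * y j t) k
    = (\<Sum>i\<in>I. \<Sum>j\<in>I. u i * u j * cross_emp n (y i) (y j) k)"
proof (cases "k < n")
  case True
  define m where "m = (\<lambda>i. (\<Sum>t<n. y i t) / real n)"
  have m: "(\<Sum>t<n. y i t) / real n = m i" for i by (simp add: m_def)
  have mean: "(\<Sum>t<n. \<Sum>i\<in>I. u i * y i t) / real n = (\<Sum>i\<in>I. u i * m i)"
    unfolding m_def by (subst sum.swap) (simp add: sum_divide_distrib sum_distrib_left)
  have "(\<Sum>t<n - k. ((\<Sum>i\<in>I. u i * y i t) - (\<Sum>i\<in>I. u i * m i)) * ((\<Sum>j\<in>I. u j * y j (t + k)) - (\<Sum>j\<in>I. u j * m j)))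
     = (\<Sum>t<n - k. \<Sum>i\<in>I. \<Sum>j\<in>I. u i * u j * ((y i t - m i) * (y j (t + k) - m j)))"
  proof (rule sum.cong[OF refl])
    fix t
    have c: "(\<Sum>i\<in>I. u i * z i) - (\<Sum>i\<in>I. u i * m i) = (\<Sum>i\<in>I. u i * (z i - m i))" for z
      by (simp add: sum_subtractf right_diff_distrib)
    show "((\<Sum>i\<in>I. u i * y i t) - (\<Sum>i\<in>I. u i * m i)) * ((\<Sum>j\<in>I. u j * y j (t + k)) - (\<Sum>j\<in>I. u j * m j))
      = (\<Sum>i\<in>I. \<Sum>j\<in>I. u i * u j * ((y i t - m i) * (y j (t + k) - m j)))"
      unfolding c sum_product by (intro sum.cong refl) simp
  qed
  also have "\<dots> = (\<Sum>i\<in>I. \<Sum>j\<in>I. u i * u j * (\<Sum>t<n - k. (y i t - m i) * (y j (t + k) - m j)))"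
    by (subst sum.swap, rule sum.cong[OF refl], subst sum.swap) (simp add: sum_distrib_left)
  finally show ?thesis
    unfolding cross_emp_def mean m using True by (simp only: if_True sum_divide_distrib[where A=I] times_divide_eq_right)
qed (simp add: cross_emp_def)

text \<open>|a b| <= (a^2 + b^2)/2, and both resulting sums are parts of the full sum of squares. A
  bound at lag 0 thus serves for all lags.\<close>

lemma autocov_emp_le_0: "\<bar>autocov_emp n y k\<bar> \<le> autocov_emp n y 0"
proof (cases "nat \<bar>k\<bar> < n")
  case True
  define a where "a = (\<lambda>t. y t - (\<Sum>t<n. y t) / real n)"
  define j where "j = nat \<bar>k\<bar>"
  have j: "j < n" using True by (simp add: j_def)
  have "\<bar>\<Sum>t<n - j. a t * a (t + j)\<bar> \<le> (\<Sum>t<n - j. \<bar>a t * a (t + j)\<bar>)" by (rule sum_abs)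
  also have "\<dots> \<le> (\<Sum>t<n - j. ((a t)\<^sup>2 + (a (t + j))\<^sup>2) / 2)"
  proof (intro sum_mono)
    fix t show "\<bar>a t * a (t + j)\<bar> \<le> ((a t)\<^sup>2 + (a (t + j))\<^sup>2) / 2"
      using sum_squares_bound[of "\<bar>a t\<bar>" "\<bar>a (t + j)\<bar>"] by (simp add: abs_mult)
  qed
  also have "\<dots> = ((\<Sum>t<n - j. (a t)\<^sup>2) + (\<Sum>t<n - j. (a (t + j))\<^sup>2)) / 2"
    by (simp add: sum_divide_distrib[symmetric] sum.distrib)
  also have "\<dots> \<le> ((\<Sum>t<n. (a t)\<^sup>2) + (\<Sum>t<n. (a t)\<^sup>2)) / 2"
  proof -
    have "(\<Sum>t<n - j. (a t)\<^sup>2) \<le> (\<Sum>t<n. (a t)\<^sup>2)" by (rule sum_mono2) auto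
    moreover have "(\<Sum>t<n - j. (a (t + j))\<^sup>2) = (\<Sum>t\<in>(\<lambda>t. t + j) ` {..<n - j}. (a t)\<^sup>2)"
      by (subst sum.reindex) auto
    moreover have "\<dots> \<le> (\<Sum>t<n. (a t)\<^sup>2)" by (rule sum_mono2) auto
    ultimately show ?thesis by simp
  qed
  finally have "\<bar>\<Sum>t<n - j. a t * a (t + j)\<bar> \<le> (\<Sum>t<n. (a t)\<^sup>2)" by simp
  then have "\<bar>\<Sum>t<n - j. a t * a (t + j)\<bar> / real n \<le> (\<Sum>t<n. (a t)\<^sup>2) / real n"
    by (rule divide_right_mono) simp
  then show ?thesis
    using True by (simp add: autocov_emp_cross cross_emp_def a_def j_def power2_eq_square)
qed (auto simp: autocov_emp_def Let_def intro!: divide_nonneg_nonneg sum_nonneg)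

lemma autocov_emp_finite_support: "finite {k. autocov_emp n y k \<noteq> 0}"
proof (rule finite_subset)
  show "{k. autocov_emp n y k \<noteq> 0} \<subseteq> {- int n..int n}"
    by (auto simp: autocov_emp_def Let_def split: if_splits)
qed simp

lemma infsum_sum_real:
  fixes f :: "'i \<Rightarrow> 'k \<Rightarrow> real"
  assumes "finite I" "\<And>i. i \<in> I \<Longrightarrow> f i summable_on A"
  shows "(\<lambda>k. \<Sum>i\<in>I. f i k) summable_on A \<and> infsum (\<lambda>k. \<Sum>i\<in>I. f i k) A = (\<Sum>i\<in>I. infsum (f i) A)"
  using assms
proof (induction I rule: finite_induct)
  case (insert i I)
  then have "f i summable_on A" "(\<lambda>k. \<Sum>i\<in>I. f i k) summable_on A"
    and eq: "infsum (\<lambda>k. \<Sum>i\<in>I. f i k) A = (\<Sum>i\<in>I. infsum (f i) A)" by auto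
  from summable_on_add[OF this(1,2)] infsum_add[OF this(1,2)] show ?case using insert by (simp add: eq)
qed simp

lemma autocov_emp_uminus: "autocov_emp n (\<lambda>t. - y t) = autocov_emp n y"
proof
  fix k
  have "(- y t - (- m)) * (- y s - (- m)) = (y t - m) * (y s - m)" for t s m by (simp add: algebra_simps)
  then show "autocov_emp n (\<lambda>t. - y t) k = autocov_emp n y k"
    by (simp add: autocov_emp_def Let_def sum_negf)
qed

text \<open>\<open>eigvec_selector\<close> promises something only for symmetric matrices.
  Exchanging i and j negates the scaled difference, and autocovariances do not see the sign.\<close>

lemma transpose_Sigma_pw: "transpose (Sigma_pw \<delta> n y) = Sigma_pw \<delta> n y"
proof -
  define s where "s = (\<lambda>i. sqrt (autocov_emp n (\<lambda>t. y t $ i) 0))"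
  have "Sigma_pw \<delta> n y $ i $ j = Sigma_pw \<delta> n y $ j $ i" for i j
  proof -
    have "autocov_emp n (\<lambda>t. y t $ i / s i - y t $ j / s j) = autocov_emp n (\<lambda>t. y t $ j / s j - y t $ i / s i)"
      using autocov_emp_uminus[of n "\<lambda>t. y t $ i / s i - y t $ j / s j"] by simp
    moreover have "(\<lambda>t. y t $ i / s i + y t $ j / s j) = (\<lambda>t. y t $ j / s j + y t $ i / s i)"
      by (simp add: add.commute)
    ultimately show ?thesis
      unfolding Sigma_pw_def Let_def s_def[symmetric]
      by (simp add: s_def[symmetric] min.commute[of "\<delta> $ i"] mult.commute[of "s i"])
  qed
  then show ?thesis by (simp add: transpose_def vec_eq_iff)
qed

section \<open>Conjugation by bounded matrices\<close>

lemma conj_matrix_entry: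
  fixes V H :: "real^'d^'d"
  shows "(transpose V ** H ** V) $ j $ k = (\<Sum>a\<in>UNIV. \<Sum>b\<in>UNIV. V $ a $ j * V $ b $ k * H $ a $ b)"
proof -
  have "(transpose V ** H ** V) $ j $ k = (\<Sum>b\<in>UNIV. \<Sum>a\<in>UNIV. V $ a $ j * V $ b $ k * H $ a $ b)"
    by (simp add: matrix_matrix_mult_def transpose_def sum_distrib_left sum_distrib_right ac_simps)
  then show ?thesis by (subst sum.swap)
qed

lemma conj_matrix_entry_le:
  fixes V H :: "real^'d^'d"
  assumes "\<And>a b. \<bar>V $ a $ b\<bar> \<le> 1"
  shows "\<bar>(transpose V ** H ** V) $ j $ k\<bar> \<le> (\<Sum>a\<in>UNIV. \<Sum>b\<in>UNIV. \<bar>H $ a $ b\<bar>)"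
proof -
  have "\<bar>V $ a $ j * V $ b $ k * H $ a $ b\<bar> \<le> \<bar>H $ a $ b\<bar>" for a b
  proof -
    have "\<bar>V $ a $ j\<bar> * \<bar>V $ b $ k\<bar> \<le> 1 * 1" by (intro mult_mono assms) auto
    then have "\<bar>V $ a $ j\<bar> * \<bar>V $ b $ k\<bar> * \<bar>H $ a $ b\<bar> \<le> 1 * \<bar>H $ a $ b\<bar>" by (intro mult_right_mono) auto
    then show ?thesis by (simp add: abs_mult)
  qed
  then have "(\<Sum>a\<in>UNIV. \<Sum>b\<in>UNIV. \<bar>V $ a $ j * V $ b $ k * H $ a $ b\<bar>) \<le> (\<Sum>a\<in>UNIV. \<Sum>b\<in>UNIV. \<bar>H $ a $ b\<bar>)"
    by (intro sum_mono)
  moreover have "\<bar>(transpose V ** H ** V) $ j $ k\<bar> \<le> (\<Sum>a\<in>UNIV. \<Sum>b\<in>UNIV. \<bar>V $ a $ j * V $ b $ k * H $ a $ b\<bar>)"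
    unfolding conj_matrix_entry by (rule order_trans[OF sum_abs sum_mono]) (rule sum_abs)
  ultimately show ?thesis by simp
qed

text \<open>V may vary without converging: with entries bounded by 1, each entry of the conjugate is
  at most the sum of all |H a b|.\<close>

lemma conj_matrix_tendsto_0:
  fixes V H :: "nat \<Rightarrow> real^'d^'d"
  assumes V: "\<And>n a b. \<bar>V n $ a $ b\<bar> \<le> 1" and H: "\<And>a b. (\<lambda>n. H n $ a $ b) \<longlonglongrightarrow> 0"
  shows "(\<lambda>n. (transpose (V n) ** H n ** V n) $ j $ k) \<longlonglongrightarrow> 0"
proof (rule Lim_null_comparison)
  show "\<forall>\<^sub>F n in sequentially. norm ((transpose (V n) ** H n ** V n) $ j $ k) \<le> (\<Sum>a\<in>UNIV. \<Sum>b\<in>UNIV. \<bar>H n $ a $ b\<bar>)"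
    using conj_matrix_entry_le[OF V] by (intro always_eventually allI) simp
  have "(\<lambda>n. \<Sum>a\<in>UNIV. \<Sum>b\<in>UNIV. \<bar>H n $ a $ b\<bar>) \<longlonglongrightarrow> (\<Sum>a\<in>(UNIV::'d set). \<Sum>b\<in>(UNIV::'d set). \<bar>0\<bar>)"
    by (intro tendsto_sum tendsto_rabs H)
  then show "(\<lambda>n. \<Sum>a\<in>UNIV. \<Sum>b\<in>UNIV. \<bar>H n $ a $ b\<bar>) \<longlonglongrightarrow> 0" by simp
qed

lemma orthogonal_matrix_entry_le:
  fixes V :: "real^'d^'d"
  assumes "orthogonal_matrix V"
  shows "\<bar>V $ a $ b\<bar> \<le> 1"
proof -
  have "(\<Sum>a\<in>UNIV. (V $ a $ b)\<^sup>2) = (transpose V ** V) $ b $ b"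
    by (simp add: matrix_matrix_mult_def transpose_def power2_eq_square)
  also have "\<dots> = 1" using assms by (simp add: orthogonal_matrix_def mat_def)
  finally have "(V $ a $ b)\<^sup>2 \<le> 1"
    using member_le_sum[of a UNIV "\<lambda>a. (V $ a $ b)\<^sup>2"] by simp
  then show ?thesis by (simp add: abs_square_le_1)
qed

lemma inner_eq_sum: "u \<bullet> x = (\<Sum>i\<in>UNIV. u $ i * x $ i)" for u x :: "real^'d"
  by (simp add: inner_vec_def)

section \<open>Consistency of the pilot estimator and of its spectral correction\<close>

context geometrically_ergodic
begin

text \<open>The projection directions \<open>u n\<close> depend on the sample and need not converge: eigenvectors of
  the pilot estimator are discontinuous where the limit has multiple eigenvalues.\<close>

proposition projected_variance_consistent:
  fixes g :: "'a \<Rightarrow> real^'d" and y :: "nat \<Rightarrow> real^'d" and u :: "nat \<Rightarrow> real^'d"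
  assumes L: "\<And>j. L2 (\<lambda>x. g x $ j)"
    and C: "\<And>i j k. (\<lambda>n. cross_emp n (\<lambda>t. y t $ i) (\<lambda>t. y t $ j) k) \<longlonglongrightarrow> cov (\<lambda>x. g x $ i) (\<lambda>x. g x $ j) (int k)"
    and \<delta>: "0 < \<delta>" "\<delta> \<le> 1" and gap: "\<And>n. gap (1 - \<delta>) (\<lambda>x. u n \<bullet> g x)" and uB: "\<And>n i. \<bar>u n $ i\<bar> \<le> B"
  shows "(\<lambda>n. sigma2 (Proj \<delta> (autocov_emp n (\<lambda>t. u n \<bullet> y t))) - sigma2 (acov (\<lambda>x. u n \<bullet> g x))) \<longlonglongrightarrow> 0"
proof -
  define c where "c = (\<lambda>i j k n. cross_emp n (\<lambda>t. y t $ i) (\<lambda>t. y t $ j) k)"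
  define \<Gamma> where "\<Gamma> = (\<lambda>i j k. cov (\<lambda>x. g x $ i) (\<lambda>x. g x $ j) k)"
  have B0: "0 \<le> B" using uB[of 0 undefined] by (meson abs_ge_zero order_trans)
  have r: "autocov_emp n (\<lambda>t. u n \<bullet> y t) k = (\<Sum>i\<in>UNIV. \<Sum>j\<in>UNIV. u n $ i * u n $ j * c i j (nat \<bar>k\<bar>) n)" for n k
    unfolding autocov_emp_cross inner_eq_sum c_def by (rule cross_emp_sum)
  have m: "acov (\<lambda>x. u n \<bullet> g x) k = (\<Sum>i\<in>UNIV. \<Sum>j\<in>UNIV. u n $ i * u n $ j * \<Gamma> i j (int (nat \<bar>k\<bar>)))" for n k
  proof -
    have "\<Gamma> i j (int (nat \<bar>k\<bar>)) = \<Gamma> i j k" for i j by (simp add: \<Gamma>_def gamma_abs[OF L L])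
    then show ?thesis unfolding inner_eq_sum \<Gamma>_def by (subst gamma_sum_sum[OF L]) simp
  qed
  have uu: "\<bar>u n $ i * u n $ j\<bar> \<le> B * B" for n i j
    unfolding abs_mult by (intro mult_mono uB B0) auto
  \<comment> \<open>A bound on quadratic forms that is uniform over the directions, so limits of the
    coefficients carry over to them.\<close>
  have quad_le: "\<bar>\<Sum>i\<in>UNIV. \<Sum>j\<in>UNIV. u n $ i * u n $ j * a i j\<bar> \<le> (\<Sum>i\<in>UNIV. \<Sum>j\<in>UNIV. B * B * \<bar>a i j\<bar>)" for n a
    by (rule order_trans[OF sum_abs], rule sum_mono, rule order_trans[OF sum_abs], rule sum_mono)
       (simp only: abs_mult[of "_ * _"], rule mult_right_mono[OF uu abs_ge_zero])
  have "\<exists>D. \<forall>n. \<bar>c i j 0 n\<bar> \<le> D" for i j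
    using convergent_imp_Bseq[OF convergentI[OF C[of i j 0]]] by (auto simp: Bseq_def c_def)
  then obtain D where D: "\<And>i j n. \<bar>c i j 0 n\<bar> \<le> D i j" by metis
  \<comment> \<open>R has to dominate the empirical and the true variances of all directions; the
    lag 0 cross-covariances are bounded because they converge.\<close>
  define R where "R = (\<Sum>i\<in>UNIV. \<Sum>j\<in>UNIV. B * B * D i j) + (\<Sum>i\<in>UNIV. \<Sum>j\<in>UNIV. B * B * \<bar>\<Gamma> i j 0\<bar>)"
  have D0: "0 \<le> D i j" for i j using D[of i j 0] by (meson abs_ge_zero order_trans)
  have R1: "(\<Sum>i\<in>UNIV. \<Sum>j\<in>UNIV. B * B * D i j) \<le> R" "(\<Sum>i\<in>UNIV. \<Sum>j\<in>UNIV. B * B * \<bar>\<Gamma> i j 0\<bar>) \<le> R"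
    unfolding R_def using B0 D0 by (simp_all add: sum_nonneg)
  show ?thesis
  proof (rule sigma2_Proj_consistent[OF \<delta>, of _ R])
    show "finite {k. autocov_emp n (\<lambda>t. u n \<bullet> y t) k \<noteq> 0}" for n by (rule autocov_emp_finite_support)
    show "acov (\<lambda>x. u n \<bullet> g x) \<in> Minf (1 - \<delta>)" for n
      using gap_Minf[OF gap] \<delta> by simp
    show "acov (\<lambda>x. u n \<bullet> g x) 0 \<le> R" for n
      using quad_le[of n "\<lambda>i j. \<Gamma> i j 0"] R1(2) unfolding m by (simp add: abs_le_iff)
    fix n k
    have "\<bar>autocov_emp n (\<lambda>t. u n \<bullet> y t) 0\<bar> \<le> (\<Sum>i\<in>UNIV. \<Sum>j\<in>UNIV. B * B * \<bar>c i j 0 n\<bar>)"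
      unfolding r using quad_le[of n "\<lambda>i j. c i j 0 n"] by simp
    also have "\<dots> \<le> (\<Sum>i\<in>UNIV. \<Sum>j\<in>UNIV. B * B * D i j)"
      using B0 D by (intro sum_mono mult_left_mono) auto
    finally show "\<bar>autocov_emp n (\<lambda>t. u n \<bullet> y t) k\<bar> \<le> R"
      using autocov_emp_le_0[of n "\<lambda>t. u n \<bullet> y t" k] R1(1) by linarith
  next
    fix k
    show "(\<lambda>n. autocov_emp n (\<lambda>t. u n \<bullet> y t) k - acov (\<lambda>x. u n \<bullet> g x) k) \<longlonglongrightarrow> 0"
    proof (rule Lim_null_comparison[OF always_eventually[OF allI]])
      fix n
      have "autocov_emp n (\<lambda>t. u n \<bullet> y t) k - acov (\<lambda>x. u n \<bullet> g x) k
        = (\<Sum>i\<in>UNIV. \<Sum>j\<in>UNIV. u n $ i * u n $ j * (c i j (nat \<bar>k\<bar>) n - \<Gamma> i j (int (nat \<bar>k\<bar>))))"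
        unfolding r m by (simp only: right_diff_distrib sum_subtractf)
      then show "norm (autocov_emp n (\<lambda>t. u n \<bullet> y t) k - acov (\<lambda>x. u n \<bullet> g x) k)
        \<le> (\<Sum>i\<in>UNIV. \<Sum>j\<in>UNIV. B * B * \<bar>c i j (nat \<bar>k\<bar>) n - \<Gamma> i j (int (nat \<bar>k\<bar>))\<bar>)"
        using quad_le[of n "\<lambda>i j. c i j (nat \<bar>k\<bar>) n - \<Gamma> i j (int (nat \<bar>k\<bar>))"] by simp
      have "(\<lambda>n. \<Sum>i\<in>UNIV. \<Sum>j\<in>UNIV. B * B * \<bar>c i j (nat \<bar>k\<bar>) n - \<Gamma> i j (int (nat \<bar>k\<bar>))\<bar>)
        \<longlonglongrightarrow> (\<Sum>i\<in>(UNIV::'d set). \<Sum>j\<in>(UNIV::'d set). B * B * \<bar>\<Gamma> i j (int (nat \<bar>k\<bar>)) - \<Gamma> i j (int (nat \<bar>k\<bar>))\<bar>)"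
        unfolding c_def \<Gamma>_def
        by (intro tendsto_sum tendsto_mult tendsto_const tendsto_rabs tendsto_diff C)
      then show "(\<lambda>n. \<Sum>i\<in>UNIV. \<Sum>j\<in>UNIV. B * B * \<bar>c i j (nat \<bar>k\<bar>) n - \<Gamma> i j (int (nat \<bar>k\<bar>))\<bar>) \<longlonglongrightarrow> 0" by simp
    qed
  qed
qed

text \<open>Polarisation: a cross-covariance is a quarter of the difference of two autocovariances,
  each of which decays geometrically.\<close>

lemma gamma_summable:
  assumes f: "gap b f" and h: "gap b h" and b: "0 \<le> b" "b < 1"
  shows "cov f h summable_on UNIV"
    "sigma2 (acov (\<lambda>x. f x + h x)) - sigma2 (acov (\<lambda>x. f x - h x)) = 4 * infsum (cov f h) UNIV"
proof -
  have "gap b (\<lambda>x. f x + h x)" by (rule gap_add[OF f h])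
  then have p: "acov (\<lambda>x. f x + h x) summable_on UNIV"
    using Minf_summable[OF gap_Minf b] b by blast
  have "gap b (\<lambda>x. f x - h x)" using gap_add[OF f gap_cmult[OF h, of "-1"]] by simp
  then have m: "acov (\<lambda>x. f x - h x) summable_on UNIV"
    using Minf_summable[OF gap_Minf b] b by blast
  have eq: "cov f h = (\<lambda>k. (1/4) * acov (\<lambda>x. f x + h x) k + (-1/4) * acov (\<lambda>x. f x - h x) k)"
    using gamma_parallelogram(2)[OF gap_L2[OF f] gap_L2[OF h]] by (simp add: fun_eq_iff field_simps)
  show "cov f h summable_on UNIV" by (subst eq, rule summable_on_lincomb[OF p m])
  show "sigma2 (acov (\<lambda>x. f x + h x)) - sigma2 (acov (\<lambda>x. f x - h x)) = 4 * infsum (cov f h) UNIV"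
    by (subst eq, subst infsum_lincomb[OF p m]) (simp add: sigma2_def)
qed

text \<open>When u is a column of V this identifies the target of the projected variance with a
  diagonal entry of V^T \<Sigma> V. The gap justifies exchanging the sum over lags with the finite
  sums.\<close>

lemma sigma2_gamma_inner:
  fixes g :: "'a \<Rightarrow> real^'d"
  assumes gap: "\<And>i. gap b (\<lambda>x. g x $ i)" and b: "0 \<le> b" "b < 1"
  shows "sigma2 (acov (\<lambda>x. u \<bullet> g x)) = (\<Sum>i\<in>UNIV. \<Sum>j\<in>UNIV. u $ i * u $ j * Sigma_true Q \<pi> g $ i $ j)"
proof -
  note s = gamma_summable(1)[OF gap gap b]
  have "acov (\<lambda>x. u \<bullet> g x) = (\<lambda>k. \<Sum>i\<in>UNIV. \<Sum>j\<in>UNIV. u $ i * u $ j * cov (\<lambda>x. g x $ i) (\<lambda>x. g x $ j) k)"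
    unfolding inner_eq_sum using gap_L2[OF gap] by (intro ext gamma_sum_sum)
  moreover have inner: "(\<lambda>k. \<Sum>j\<in>UNIV. u $ i * u $ j * cov (\<lambda>x. g x $ i) (\<lambda>x. g x $ j) k) summable_on UNIV \<and>
      infsum (\<lambda>k. \<Sum>j\<in>UNIV. u $ i * u $ j * cov (\<lambda>x. g x $ i) (\<lambda>x. g x $ j) k) UNIV
      = (\<Sum>j\<in>UNIV. infsum (\<lambda>k. u $ i * u $ j * cov (\<lambda>x. g x $ i) (\<lambda>x. g x $ j) k) UNIV)" for i
    by (intro infsum_sum_real summable_on_cmult_right s) simp
  ultimately show ?thesis
    using infsum_sum_real[of UNIV "\<lambda>i k. \<Sum>j\<in>UNIV. u $ i * u $ j * cov (\<lambda>x. g x $ i) (\<lambda>x. g x $ j) k" UNIV]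
    by (simp add: sigma2_def Sigma_true_def infsum_cmult_right')
qed

text \<open>Diagonal entries use the direction e_i, the others e_i/s_i +- e_j/s_j. The latter vary
  with n, but positive variances keep the empirical s_i eventually away from 0, so they remain
  bounded.\<close>

lemma Sigma_pw_consistent:
  fixes g :: "'a \<Rightarrow> real^'d" and y :: "nat \<Rightarrow> real^'d" and \<delta> :: "real^'d"
  assumes C: "\<And>i j k. (\<lambda>n. cross_emp n (\<lambda>t. y t $ i) (\<lambda>t. y t $ j) k) \<longlonglongrightarrow> cov (\<lambda>x. g x $ i) (\<lambda>x. g x $ j) (int k)"
    and \<delta>: "\<And>i. 0 < \<delta> $ i" "\<And>i. \<delta> $ i \<le> 1" and gap: "\<And>i. gap (1 - \<delta> $ i) (\<lambda>x. g x $ i)"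
    and pos: "\<And>i. acov (\<lambda>x. g x $ i) 0 > 0"
  shows "(\<lambda>n. Sigma_pw \<delta> n y $ i $ j) \<longlonglongrightarrow> Sigma_true Q \<pi> g $ i $ j"
proof (cases "i = j")
  case True
  have "(\<lambda>n. sigma2 (Proj (\<delta> $ i) (autocov_emp n (\<lambda>t. axis i 1 \<bullet> y t)))
      - sigma2 (acov (\<lambda>x. axis i 1 \<bullet> g x))) \<longlonglongrightarrow> 0"
  proof (rule projected_variance_consistent[OF gap_L2[OF gap] C \<delta>(1) \<delta>(2), where B=1])
    show "gap (1 - \<delta> $ i) (\<lambda>x. axis i 1 \<bullet> g x)" using gap[of i] by (simp add: inner_axis')
    show "\<bar>(axis i 1 :: real^'d) $ k\<bar> \<le> 1" for k by (simp add: axis_def)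
  qed
  then have "(\<lambda>n. sigma2 (Proj (\<delta> $ i) (autocov_emp n (\<lambda>t. y t $ i)))) \<longlonglongrightarrow> sigma2 (acov (\<lambda>x. g x $ i))"
    by (simp add: inner_axis' LIM_zero_cancel)
  then show ?thesis by (simp add: True Sigma_pw_def Sigma_true_def sigma2_def Let_def)
next
  case False
  define f where "f = (\<lambda>i x. g x $ i)"
  define s where "s = (\<lambda>i n. sqrt (autocov_emp n (\<lambda>t. y t $ i) 0))"
  define s\<^sub>0 where "s\<^sub>0 = (\<lambda>i. sqrt (acov (f i) 0))"
  have s: "s i \<longlonglongrightarrow> s\<^sub>0 i" for i
    using C[of i i 0] unfolding s_def s\<^sub>0_def f_def autocov_emp_cross by (intro tendsto_real_sqrt) simp
  have s0: "s\<^sub>0 i > 0" for i using pos by (simp add: s\<^sub>0_def f_def)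
  have inv: "(\<lambda>n. 1 / s i n) \<longlonglongrightarrow> 1 / s\<^sub>0 i" for i
    using s0[of i] by (intro tendsto_divide tendsto_const s) simp
  \<comment> \<open>A convergent sequence is bounded; at the finitely many n with
    \<open>s i n = 0\<close> the quotient is 0 by convention.\<close>
  have "\<exists>D. \<forall>n. \<bar>1 / s i n\<bar> \<le> D" for i
    using convergent_imp_Bseq[OF convergentI[OF inv[of i]]] by (auto simp: Bseq_def)
  then obtain D where D: "\<And>i n. \<bar>1 / s i n\<bar> \<le> D i" by metis
  define \<eta> where "\<eta> = min (\<delta> $ i) (\<delta> $ j)"
  have \<eta>: "0 < \<eta>" "\<eta> \<le> 1" "0 \<le> 1 - \<eta>" "1 - \<eta> < 1" using \<delta>[of i] \<delta>[of j] by (auto simp: \<eta>_def)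
  have gi: "gap (1 - \<eta>) (\<lambda>x. c * f i x)" and gj: "gap (1 - \<eta>) (\<lambda>x. c * f j x)" for c
    using gap_mono[OF gap[of i], of "1 - \<eta>"] gap_mono[OF gap[of j], of "1 - \<eta>"] \<delta>[of i] \<delta>[of j]
    by (auto simp: \<eta>_def f_def intro!: gap_cmult)
  \<comment> \<open>\<open>\<sigma>\<close> is 1 for the sum and -1 for the difference of the two
    scaled coordinates.\<close>
  define V where "V = (\<lambda>\<sigma> n. sigma2 (acov (\<lambda>x. 1 / s i n * f i x + \<sigma> * (1 / s j n * f j x))))"
  define P where "P = (\<lambda>\<sigma> n. sigma2 (Proj \<eta> (autocov_emp n (\<lambda>t. y t $ i / s i n + \<sigma> * (y t $ j / s j n)))))"
  have PV: "(\<lambda>n. P \<sigma> n - V \<sigma> n) \<longlonglongrightarrow> 0" if \<sigma>: "\<bar>\<sigma>\<bar> = 1" for \<sigma>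
  proof -
    define u where "u = (\<lambda>n. axis i (1 / s i n) + axis j (\<sigma> * (1 / s j n)) :: real^'d)"
    have ui: "u n \<bullet> z = 1 / s i n * z $ i + \<sigma> * (1 / s j n * z $ j)" for n z
      by (simp add: u_def inner_add_left inner_axis')
    have "(\<lambda>n. sigma2 (Proj \<eta> (autocov_emp n (\<lambda>t. u n \<bullet> y t))) - sigma2 (acov (\<lambda>x. u n \<bullet> g x))) \<longlonglongrightarrow> 0"
    proof (rule projected_variance_consistent[OF gap_L2[OF gap] C \<eta>(1,2), where B="D i + D j"])
      show "gap (1 - \<eta>) (\<lambda>x. u n \<bullet> g x)" for n
        unfolding ui using gap_add[OF gi[of "1 / s i n"] gj[of "\<sigma> * (1 / s j n)"]] by (simp add: f_def mult.assoc)
      have D0: "0 \<le> D i" "0 \<le> D j" using D[of i 0] D[of j 0] by (meson abs_ge_zero order_trans)+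
      show "\<bar>u n $ k\<bar> \<le> D i + D j" for n k
        using D[of i n] D[of j n] D0 False \<sigma> by (auto simp: u_def axis_def abs_mult)
    qed
    then show ?thesis unfolding ui P_def V_def by (simp add: f_def)
  qed
  have "(\<lambda>n. s i n * s j n / 4 * ((P 1 n - V 1 n) - (P (-1) n - V (-1) n))) \<longlonglongrightarrow> s\<^sub>0 i * s\<^sub>0 j / 4 * (0 - 0)"
    by (intro tendsto_mult tendsto_divide tendsto_diff s PV tendsto_const) auto
  then have lim0: "(\<lambda>n. s i n * s j n / 4 * ((P 1 n - V 1 n) - (P (-1) n - V (-1) n))) \<longlonglongrightarrow> 0" by simp
  \<comment> \<open>Polarisation of the scaled coordinates produces 1/(s_i s_j), which the prefactor
    s_i s_j / 4 cancels exactly as soon as both scales are positive.\<close>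
  have VV: "V 1 n - V (-1) n = 4 * (1 / s i n * (1 / s j n) * infsum (cov (f i) (f j)) UNIV)" for n
  proof -
    have "V 1 n - V (-1) n = 4 * infsum (cov (\<lambda>x. 1 / s i n * f i x) (\<lambda>x. 1 / s j n * f j x)) UNIV"
      using gamma_summable(2)[OF gi[of "1 / s i n"] gj[of "1 / s j n"] \<eta>(3,4)] by (simp add: V_def)
    also have "cov (\<lambda>x. 1 / s i n * f i x) (\<lambda>x. 1 / s j n * f j x) = (\<lambda>k. 1 / s i n * (1 / s j n) * cov (f i) (f j) k)"
    proof
      fix k
      have l: "L2 (f i)" "L2 (f j)" using gap_L2[OF gap] by (simp_all add: f_def)
      have "cov (\<lambda>x. 1 / s i n * f i x) (\<lambda>x. 1 / s j n * f j x) k = 1 / s i n * cov (\<lambda>x. 1 / s j n * f j x) (f i) k"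
        by (simp only: gamma_cmult_left[OF l(1) L2_cmult[OF l(2)]] gamma_commute[OF l(1) L2_cmult[OF l(2)]])
      also have "\<dots> = 1 / s i n * (1 / s j n) * cov (f i) (f j) k"
        by (simp only: gamma_cmult_left[OF l(2) l(1)] gamma_commute[OF l(2) l(1)] mult.assoc)
      finally show "cov (\<lambda>x. 1 / s i n * f i x) (\<lambda>x. 1 / s j n * f j x) k = 1 / s i n * (1 / s j n) * cov (f i) (f j) k" .
    qed
    finally show ?thesis by (simp only: infsum_cmult_right')
  qed
  have ev: "\<forall>\<^sub>F n in sequentially. s i n * s j n / 4 * ((P 1 n - V 1 n) - (P (-1) n - V (-1) n)) + infsum (cov (f i) (f j)) UNIV = s i n * s j n / 4 * (P 1 n - P (-1) n)"
    using order_tendstoD(1)[OF s[of i] s0[of i]] order_tendstoD(1)[OF s[of j] s0[of j]]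
  proof eventually_elim
    case (elim n)
    have "s i n * s j n / 4 * (V 1 n - V (-1) n) = infsum (cov (f i) (f j)) UNIV"
      unfolding VV using elim by simp
    then show ?case by (simp only: right_diff_distrib)
  qed
  have "(\<lambda>n. s i n * s j n / 4 * (P 1 n - P (-1) n)) \<longlonglongrightarrow> 0 + infsum (cov (f i) (f j)) UNIV"
    by (rule Lim_transform_eventually[OF tendsto_add[OF lim0 tendsto_const] ev])
  then show ?thesis
    using False by (simp add: Sigma_pw_def Sigma_true_def Let_def s_def P_def f_def \<eta>_def)
qed

text \<open>With G = V^T \<Sigma> V and D the diagonal matrix of projected variances, the error is V
  (D - G) V^T, so it remains to send the entries of D - G to 0.\<close>

lemma Sigma_psd_consistent:
  fixes g :: "'a \<Rightarrow> real^'d" and y :: "nat \<Rightarrow> real^'d" and \<delta> :: "real^'d" and U :: "real^'d^'d \<Rightarrow> real^'d^'d"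
  assumes C: "\<And>i j k. (\<lambda>n. cross_emp n (\<lambda>t. y t $ i) (\<lambda>t. y t $ j) k) \<longlonglongrightarrow> cov (\<lambda>x. g x $ i) (\<lambda>x. g x $ j) (int k)"
    and \<delta>: "\<And>i. 0 < \<delta> $ i" "\<And>i. \<delta> $ i \<le> 1" and gap: "\<And>i. gap (1 - \<delta> $ i) (\<lambda>x. g x $ i)"
    and pos: "\<And>i. acov (\<lambda>x. g x $ i) 0 > 0"
    and U: "eigvec_selector U"
  shows "(\<lambda>n. Sigma_psd U \<delta> n y) \<longlonglongrightarrow> Sigma_true Q \<pi> g"
proof -
  define \<Sigma> where "\<Sigma> = Sigma_true Q \<pi> g"
  define S where "S = (\<lambda>n. Sigma_pw \<delta> n y)"
  define V where "V = (\<lambda>n. U (S n))"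
  have S: "(\<lambda>n. S n $ i $ j) \<longlonglongrightarrow> \<Sigma> $ i $ j" for i j
    unfolding S_def \<Sigma>_def by (rule Sigma_pw_consistent[OF C \<delta> gap pos])
  have orth: "orthogonal_matrix (V n)" and eig: "\<exists>c. S n *v column j (V n) = c *s column j (V n)" for n j
    using U transpose_Sigma_pw[of \<delta> n y] unfolding eigvec_selector_def V_def S_def by blast+
  have V1: "\<bar>V n $ a $ b\<bar> \<le> 1" for n a b by (rule orthogonal_matrix_entry_le[OF orth])
  \<comment> \<open>The smallest component of \<open>\<delta>\<close> gives the widest interval
    [-(1-\<eta>), 1-\<eta>], which carries the spectral measures of all components and hence of all
    directions.\<close>
  define \<eta> where "\<eta> = Min (range (\<lambda>i. \<delta> $ i))"
  have "\<eta> \<in> range (\<lambda>i. \<delta> $ i)" unfolding \<eta>_def by (rule Min_in) auto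
  then have \<eta>: "0 < \<eta>" "\<eta> \<le> 1" "0 \<le> 1 - \<eta>" "1 - \<eta> < 1" using \<delta> by auto
  have \<eta>_le: "\<eta> \<le> \<delta> $ i" for i unfolding \<eta>_def by (rule Min_le) auto
  have gap': "gap (1 - \<eta>) (\<lambda>x. g x $ i)" for i
    using gap_mono[OF gap[of i], of "1 - \<eta>"] \<eta>_le[of i] \<delta>(2)[of i] by simp
  have gapu: "gap (1 - \<eta>) (\<lambda>x. u \<bullet> g x)" for u
    unfolding inner_eq_sum by (rule gap_sum) (auto intro: gap')
  define lam where "lam = (\<lambda>n j. sigma2 (Proj \<eta> (autocov_emp n (\<lambda>t. column j (V n) \<bullet> y t))))"
  define D where "D = (\<lambda>n. (\<chi> i j. if i = j then lam n j else 0) :: real^'d^'d)"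
  define G where "G = (\<lambda>n. transpose (V n) ** \<Sigma> ** V n)"
  have psd: "Sigma_psd U \<delta> n y = V n ** D n ** transpose (V n)" for n
    unfolding Sigma_psd_def Let_def V_def S_def D_def lam_def \<eta>_def by (rule refl)
  have VV: "transpose (V n) ** V n = mat 1" "V n ** transpose (V n) = mat 1" for n
    using orth[of n] by (simp_all add: orthogonal_matrix_def)
  have VGV: "V n ** G n ** transpose (V n) = \<Sigma>" for n
  proof -
    have "V n ** G n ** transpose (V n) = (V n ** transpose (V n)) ** \<Sigma> ** (V n ** transpose (V n))"
      by (simp only: G_def matrix_mul_assoc)
    then show ?thesis by (simp only: VV matrix_mul_lid matrix_mul_rid)
  qed
  have H: "(\<lambda>n. (D n - G n) $ j $ k) \<longlonglongrightarrow> 0" for j k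
  proof (cases "j = k")
    case True
    have "(\<lambda>n. lam n j - sigma2 (acov (\<lambda>x. column j (V n) \<bullet> g x))) \<longlonglongrightarrow> 0"
      unfolding lam_def
      by (rule projected_variance_consistent[OF gap_L2[OF gap] C \<eta>(1,2) gapu, where B=1]) (simp add: column_def V1)
    moreover have "sigma2 (acov (\<lambda>x. column j (V n) \<bullet> g x)) = G n $ j $ j" for n
      unfolding G_def conj_matrix_entry sigma2_gamma_inner[OF gap' \<eta>(3,4)] by (simp add: column_def \<Sigma>_def)
    ultimately show ?thesis by (simp add: True D_def)
  next
    case False
    have "(transpose (V n) ** S n ** V n) $ j $ k = 0" for n
    proof -
      obtain c where c: "S n *v column k (V n) = c *s column k (V n)" using eig by blast
      have "(S n ** V n) $ a $ k = c * V n $ a $ k" for a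
        using arg_cong[OF c, of "\<lambda>v. v $ a"] by (simp add: matrix_matrix_mult_def matrix_vector_mult_def column_def)
      then have "(transpose (V n) ** (S n ** V n)) $ j $ k = c * (transpose (V n) ** V n) $ j $ k"
        by (subst (1 2) matrix_matrix_mult_def) (simp add: sum_distrib_left ac_simps)
      then show ?thesis using False by (simp add: VV matrix_mul_assoc mat_def)
    qed
    \<comment> \<open>Off the diagonal D vanishes and so does V^T S V; adding the latter to -G
      leaves the conjugate of S - \<Sigma>.\<close>
    then have eq: "(D n - G n) $ j $ k = (transpose (V n) ** (S n - \<Sigma>) ** V n) $ j $ k" for n
      using False by (simp add: D_def G_def conj_matrix_entry right_diff_distrib sum_subtractf)
    have "(\<lambda>n. (S n - \<Sigma>) $ a $ b) \<longlonglongrightarrow> 0" for a b using S[of a b] by (simp add: LIM_zero)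
    from conj_matrix_tendsto_0[of V "\<lambda>n. S n - \<Sigma>", OF V1 this] show ?thesis unfolding eq .
  qed
  have "(\<lambda>n. Sigma_psd U \<delta> n y $ a $ b - \<Sigma> $ a $ b) \<longlonglongrightarrow> 0" for a b
  proof -
    have "Sigma_psd U \<delta> n y $ a $ b - \<Sigma> $ a $ b = (transpose (transpose (V n)) ** (D n - G n) ** transpose (V n)) $ a $ b" for n
    proof -
      have "Sigma_psd U \<delta> n y $ a $ b - \<Sigma> $ a $ b = (transpose (transpose (V n)) ** D n ** transpose (V n)) $ a $ b - (transpose (transpose (V n)) ** G n ** transpose (V n)) $ a $ b"
        by (simp only: psd VGV transpose_transpose)
      then show ?thesis by (simp only: conj_matrix_entry right_diff_distrib sum_subtractf vector_minus_component)
    qed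
    moreover have "\<bar>transpose (V n) $ a $ b\<bar> \<le> 1" for n a b using V1 by (simp add: transpose_def)
    ultimately show ?thesis using conj_matrix_tendsto_0[of "\<lambda>n. transpose (V n)" "\<lambda>n. D n - G n", OF _ H] by simp
  qed
  then show ?thesis unfolding \<Sigma>_def[symmetric] by (intro vec_tendstoI) (rule LIM_zero_cancel)
qed

end

theorem theorem3:
  fixes Q :: "'a::polish_space \<Rightarrow> 'a measure"
    and \<pi> :: "'a measure"
    and g :: "'a \<Rightarrow> real^'d"
    and \<delta> :: "real^'d"
    and U :: "real^'d^'d \<Rightarrow> real^'d^'d"
    and M :: "'b measure"
    and X :: "nat \<Rightarrow> 'b \<Rightarrow> 'a"
    and x :: 'a
  assumes kernel: "Q \<in> borel \<rightarrow>\<^sub>M prob_algebra borel"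
    and pi: "prob_space \<pi>" "sets \<pi> = sets borel"
    and A1: "A1 Q"
    and A2: "reversible Q \<pi>"
    and A3: "A3 Q \<pi>"
    and B1: "\<And>j. (\<lambda>z. g z $ j) \<in> borel_measurable borel \<and> integrable \<pi> (\<lambda>z. (g z $ j)\<^sup>2)"
    and var_pos: "\<And>j. (\<integral>z. (g z $ j - (\<integral>w. g w $ j \<partial>\<pi>))\<^sup>2 \<partial>\<pi>) > 0"
    and delta: "\<And>i. 0 < \<delta> $ i \<and> \<delta> $ i \<le> Delta (spectral_measure Q \<pi> (\<lambda>z. g z $ i))"
    and U: "eigvec_selector U"
    and chain: "markov_chain_from M X Q x"
  shows "AE \<omega> in M. (\<lambda>n. Sigma_psd U \<delta> n (\<lambda>t. g (X t \<omega>))) \<longlonglongrightarrow> Sigma_true Q \<pi> g"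
proof -
  interpret geometrically_ergodic Q \<pi>
    by (intro geometrically_ergodic.intro reversible_kernel.intro markov_kernel.intro reversible_kernel_axioms.intro
        geometrically_ergodic_axioms.intro kernel pi A2 A3)
  have L: "L2 (\<lambda>z. g z $ j)" for j using B1[of j] by (simp add: L2_def)
  have pos: "acov (\<lambda>z. g z $ j) 0 > 0" for j
  proof -
    \<comment> \<open>The lag 0 autocovariance is the variance, so the positivity assumption rules
      out a vanishing spectral measure.\<close>
    have "acov (\<lambda>z. g z $ j) 0 = pi.variance (\<lambda>z. g z $ j)"
      using pi.variance_eq[OF L2_integrable[OF L[of j]] L2_sq[OF L[of j]]]
      by (simp add: gamma_eq_K[OF L L] K_0[OF L2_measurable[OF L]] power2_eq_square)
    then show ?thesis using var_pos[of j] by simp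
  qed
  note gap = Delta_gap[OF L pos delta[THEN conjunct1] delta[THEN conjunct2]]
  \<comment> \<open>One null set serves for all pairs of coordinates and all lags; on its complement
    the convergence is a statement about a single path.\<close>
  have "AE \<omega> in M. \<forall>i j. \<forall>k. (\<lambda>n. cross_emp n (\<lambda>t. g (X t \<omega>) $ i) (\<lambda>t. g (X t \<omega>) $ j) k)
      \<longlonglongrightarrow> cov (\<lambda>x. g x $ i) (\<lambda>x. g x $ j) (int k)"
  proof (intro eventually_all_finite, subst AE_all_countable, intro allI)
    fix i j k
    show "AE \<omega> in M. (\<lambda>n. cross_emp n (\<lambda>t. g (X t \<omega>) $ i) (\<lambda>t. g (X t \<omega>) $ j) k)
      \<longlonglongrightarrow> cov (\<lambda>x. g x $ i) (\<lambda>x. g x $ j) (int k)"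
      using chain_averages[OF chain L[of i]] chain_averages[OF chain L[of j]] chain_product_averages[OF chain L[of i] L[of j], of k]
      by eventually_elim (rule cross_emp_tendsto)
  qed
  then show ?thesis
  proof eventually_elim
    case (elim \<omega>)
    show ?case
      by (rule Sigma_psd_consistent[OF _ delta[THEN conjunct1] gap(1) gap(2) pos U]) (use elim in blast)
  qed
qed

end
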